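(* Let $\mathcal{M}$ be a class of closed Riemannian manifolds which is precompact in the Gromov-Hausdorff topology, and suppose that every $X \in \overline{\mathcal{M}}$ (the Gromov-Hausdorff closure of $\mathcal{M}$) is a non-branching geodesic metric space. Then for every $\epsilon > 0$ there is a $\delta > 0$ such that every $M \in \mathcal{M}$ which is $\delta$-tightly covered by two open balls satisfies $\operatorname{excess} M < \epsilon$; and vice versa, for every $\epsilon > 0$ there is a $\delta > 0$ such that every $M \in \mathcal{M}$ with $\operatorname{excess} M < \delta$ is $\epsilon$-tightly covered by two open balls.
   Context: A closed manifold is a compact connected manifold without boundary, of positive dimension. In a metric space with distance $\rho$, $B(p,r)$ denotes the open ball of radius $r$ centered at $p$. Each Riemannian manifold is regarded as a metric space with its Riemannian distance $\rho$. $\overline{\mathcal{M}}$ consists of all compact metric spaces (up to isometry) that are Gromov-Hausdorff limits of sequences in $\mathcal{M}$. For $\delta>0$, $M$ is $\delta$-tightly covered by two open balls if there are points $p,q\in M$ with $\rho(p,q)=2r$, $r>0$, such that $M = B(p,r+\delta)\cup B(q,r+\delta)$. For a compact metric space $X$, $\operatorname{excess} X=\min_{p,q\in X}\max_{x\in X}\big(\rho(p,x)+\rho(x,q)-\rho(p,q)\big)$; thus $\operatorname{excess} X<\delta$ means that there is a pair of points $p,q\in X$ such that $\rho(p,x)+\rho(x,q)-\rho(p,q)<\delta$ for all $x\in X$. A geodesic metric space $X$ (any two points are joined by a minimal geodesic, i.e. a curve whose length is the distance between its endpoints, parametrized by arc length) is non-branching if any two minimal geodesics $c_{xy},c_{xz}:[0,2\eta]\to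 X$ from a common point $x$ to $y$ and to $z$ respectively coincide whenever $c_{xy}(\eta)=c_{xz}(\eta)$. *)

theory Defs
  imports "HOL-Analysis.Analysis"
begin

section \<open>Closed Riemannian manifolds\<close>

text \<open>
  The dimension of a manifold is a natural number rather than a type, so that a class of manifolds
  may contain manifolds of different dimensions. Coordinates are taken in the topological space
  \<^const>\<open>Euclidean_space\<close> \<open>n\<close> of sequences vanishing from index \<open>n\<close> on.
  Differentiability of class \<open>C\<^sup>k\<close> on an open subset of it is expressed by
  existence and continuity of the iterated partial derivatives.
\<close>

primrec Ck_on :: "nat \<Rightarrow> nat \<Rightarrow> (nat \<Rightarrow> real) set \<Rightarrow> ((nat \<Rightarrow> real) \<Rightarrow> real) \<Rightarrow> bool" where
  "Ck_on 0 n V f \<longleftrightarrow>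
     continuous_map (subtopology (Euclidean_space n) V) euclideanreal f"
| "Ck_on (Suc k) n V f \<longleftrightarrow>
     continuous_map (subtopology (Euclidean_space n) V) euclideanreal f \<and>
     (\<forall>i<n. \<exists>g. (\<forall>x\<in>V. ((\<lambda>t. f (x(i := t))) has_real_derivative g x) (at (x i))) \<and> Ck_on k n V g)"

definition smooth_on_open :: "nat \<Rightarrow> (nat \<Rightarrow> real) set \<Rightarrow> ((nat \<Rightarrow> real) \<Rightarrow> real) \<Rightarrow> bool" where
  "smooth_on_open n V f \<longleftrightarrow> openin (Euclidean_space n) V \<and> (\<forall>k. Ck_on k n V f)"

definition partial_deriv :: "nat \<Rightarrow> ((nat \<Rightarrow> real) \<Rightarrow> real) \<Rightarrow> (nat \<Rightarrow> real) \<Rightarrow> real" where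
  "partial_deriv i f x = deriv (\<lambda>t. f (x(i := t))) (x i)"

type_synonym 'a chart = "'a set \<times> ('a \<Rightarrow> nat \<Rightarrow> real)"

definition chart_inv :: "'a chart \<Rightarrow> (nat \<Rightarrow> real) \<Rightarrow> 'a" where
  "chart_inv c = inv_into (fst c) (snd c)"

text \<open>
  The Riemannian metric is given by its components: \<open>rm_tensor M c p i j\<close> is
  \<open>g\<^sub>p (\<partial>/\<partial>x\<^sub>i, \<partial>/\<partial>x\<^sub>j)\<close>, where \<open>x\<close> are the coordinates of the chart \<open>c\<close>.
\<close>

record 'a riemannian_manifold =
  rm_top :: "'a topology"
  rm_dim :: nat
  rm_atlas :: "'a chart set"
  rm_tensor :: "'a chart \<Rightarrow> 'a \<Rightarrow> nat \<Rightarrow> nat \<Rightarrow> real"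

definition smooth_atlas :: "'a topology \<Rightarrow> nat \<Rightarrow> 'a chart set \<Rightarrow> bool" where
  "smooth_atlas T n A \<longleftrightarrow>
     (\<forall>(U, \<phi>)\<in>A. openin T U \<and> openin (Euclidean_space n) (\<phi> ` U) \<and>
        homeomorphic_map (subtopology T U) (subtopology (Euclidean_space n) (\<phi> ` U)) \<phi>) \<and>
     topspace T = (\<Union>(U, \<phi>)\<in>A. U) \<and>
     (\<forall>c\<in>A. \<forall>c'\<in>A. \<forall>k<n.
        smooth_on_open n (snd c ` (fst c \<inter> fst c')) (\<lambda>x. snd c' (chart_inv c x) k))"

text \<open>The last conjunct is the transformation law of a covariant tensor of rank two.\<close>

definition riemannian_metric ::
    "nat \<Rightarrow> 'a chart set \<Rightarrow> ('a chart \<Rightarrow> 'a \<Rightarrow> nat \<Rightarrow> nat \<Rightarrow> real) \<Rightarrow> bool" where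
  "riemannian_metric n A g \<longleftrightarrow>
     (\<forall>c\<in>A. \<forall>i<n. \<forall>j<n. smooth_on_open n (snd c ` fst c) (\<lambda>x. g c (chart_inv c x) i j)) \<and>
     (\<forall>c\<in>A. \<forall>p\<in>fst c. \<forall>i<n. \<forall>j<n. g c p i j = g c p j i) \<and>
     (\<forall>c\<in>A. \<forall>p\<in>fst c. \<forall>v. (\<exists>i<n. v i \<noteq> 0) \<longrightarrow> (\<Sum>i<n. \<Sum>j<n. g c p i j * v i * v j) > 0) \<and>
     (\<forall>c\<in>A. \<forall>c'\<in>A. \<forall>p\<in>fst c \<inter> fst c'. \<forall>i<n. \<forall>j<n.
        g c p i j =
          (\<Sum>k<n. \<Sum>l<n. g c' p k l *
             partial_deriv i (\<lambda>x. snd c' (chart_inv c x) k) (snd c p) *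
             partial_deriv j (\<lambda>x. snd c' (chart_inv c x) l) (snd c p)))"

text \<open>
  Second countability is not listed: it follows from compactness and the existence of charts.
\<close>

definition closed_riemannian_manifold :: "'a riemannian_manifold \<Rightarrow> bool" where
  "closed_riemannian_manifold M \<longleftrightarrow>
     topspace (rm_top M) \<noteq> {} \<and> 0 < rm_dim M \<and>
     Hausdorff_space (rm_top M) \<and> compact_space (rm_top M) \<and> connected_space (rm_top M) \<and>
     smooth_atlas (rm_top M) (rm_dim M) (rm_atlas M) \<and>
     riemannian_metric (rm_dim M) (rm_atlas M) (rm_tensor M)"

subsection \<open>The Riemannian distance\<close>

definition C1_curve_on :: "'a riemannian_manifold \<Rightarrow> real \<Rightarrow> real \<Rightarrow> (real \<Rightarrow> 'a) \<Rightarrow> bool" where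
  "C1_curve_on M a b \<gamma> \<longleftrightarrow>
     continuous_map (top_of_set {a..b}) (rm_top M) \<gamma> \<and>
     (\<forall>c\<in>rm_atlas M. \<forall>k<rm_dim M. \<exists>v.
        continuous_on {t\<in>{a..b}. \<gamma> t \<in> fst c} v \<and>
        (\<forall>t\<in>{a..b}. \<gamma> t \<in> fst c \<longrightarrow>
           ((\<lambda>s. snd c (\<gamma> s) k) has_real_derivative v t) (at t within {a..b})))"

definition piecewise_C1_curve :: "'a riemannian_manifold \<Rightarrow> (real \<Rightarrow> 'a) \<Rightarrow> bool" where
  "piecewise_C1_curve M \<gamma> \<longleftrightarrow>
     continuous_map (top_of_set {0..1}) (rm_top M) \<gamma> \<and>
     (\<exists>m (t :: nat \<Rightarrow> real). t 0 = 0 \<and> t m = 1 \<and>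
        (\<forall>i<m. t i < t (Suc i) \<and> C1_curve_on M (t i) (t (Suc i)) \<gamma>))"

text \<open>
  By the transformation law, the speed does not depend on the chart that is chosen. Its value is
  meaningless at the finitely many corners of a piecewise \<open>C\<^sup>1\<close> curve, which do not
  contribute to the integral.
\<close>

definition riem_speed :: "'a riemannian_manifold \<Rightarrow> (real \<Rightarrow> 'a) \<Rightarrow> real \<Rightarrow> real" where
  "riem_speed M \<gamma> t =
     (let c = (SOME c. c \<in> rm_atlas M \<and> \<gamma> t \<in> fst c);
          v = (\<lambda>k. deriv (\<lambda>s. snd c (\<gamma> s) k) t)
      in sqrt (\<Sum>i<rm_dim M. \<Sum>j<rm_dim M. rm_tensor M c (\<gamma> t) i j * v i * v j))"

definition riem_length :: "'a riemannian_manifold \<Rightarrow> (real \<Rightarrow> 'a) \<Rightarrow> real" where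
  "riem_length M \<gamma> = integral {0..1} (riem_speed M \<gamma>)"

text \<open>
  The type \<^typ>\<open>'a metric\<close> requires distance functions to be nonnegative and symmetric also outside
  of the carrier, whence the default value \<open>0\<close>.
\<close>

definition riem_dist :: "'a riemannian_manifold \<Rightarrow> 'a \<Rightarrow> 'a \<Rightarrow> real" where
  "riem_dist M p q =
     (if p \<in> topspace (rm_top M) \<and> q \<in> topspace (rm_top M)
      then Inf {riem_length M \<gamma> | \<gamma>. piecewise_C1_curve M \<gamma> \<and> \<gamma> 0 = p \<and> \<gamma> 1 = q}
      else 0)"

definition riem_metric_space :: "'a riemannian_manifold \<Rightarrow> 'a metric" where
  "riem_metric_space M = metric (topspace (rm_top M), riem_dist M)"

section \<open>The Gromov-Hausdorff topology\<close>

definition hausdorff_dist :: "('a \<Rightarrow> 'a \<Rightarrow> real) \<Rightarrow> 'a set \<Rightarrow> 'a set \<Rightarrow> real" where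
  "hausdorff_dist D A B =
     Inf {e. 0 < e \<and> (\<forall>x\<in>A. \<exists>y\<in>B. D x y < e) \<and> (\<forall>y\<in>B. \<exists>x\<in>A. D x y < e)}"

text \<open>The metrics on the disjoint union of two spaces that extend the given metrics.\<close>

definition admissible_metric :: "'a metric \<Rightarrow> 'b metric \<Rightarrow> ('a + 'b \<Rightarrow> 'a + 'b \<Rightarrow> real) \<Rightarrow> bool" where
  "admissible_metric X Y D \<longleftrightarrow>
     Metric_space (mspace X <+> mspace Y) D \<and>
     (\<forall>x\<in>mspace X. \<forall>x'\<in>mspace X. D (Inl x) (Inl x') = mdist X x x') \<and>
     (\<forall>y\<in>mspace Y. \<forall>y'\<in>mspace Y. D (Inr y) (Inr y') = mdist Y y y')"

definition gh_dist :: "'a metric \<Rightarrow> 'b metric \<Rightarrow> real" where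
  "gh_dist X Y =
     Inf {hausdorff_dist D (Inl ` mspace X) (Inr ` mspace Y) | D. admissible_metric X Y D}"

definition compact_metric :: "'a metric \<Rightarrow> bool" where
  "compact_metric X \<longleftrightarrow> mspace X \<noteq> {} \<and> compact_space (mtopology_of X)"

text \<open>
  Isometric spaces are not identified, so \<^const>\<open>gh_dist\<close> is only a pseudometric on the compact
  spaces; compactness of an isometry-invariant set is the same as in the quotient.
  Spaces are carried by subsets of a type \<^typ>\<open>'a\<close>. If this type carries a manifold of positive
  dimension, then it has at least the cardinality of the continuum, so that every compact metric
  space is isometric to one carried by a subset of \<^typ>\<open>'a\<close>.
\<close>

definition gh_openin :: "'a metric set \<Rightarrow> bool" where
  "gh_openin \<U> \<longleftrightarrow>
     \<U> \<subseteq> Collect compact_metric \<and>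
     (\<forall>X\<in>\<U>. \<exists>e>0. \<forall>Y. compact_metric Y \<and> gh_dist X Y < e \<longrightarrow> Y \<in> \<U>)"

definition gh_topology :: "'a metric topology" where
  "gh_topology = topology gh_openin"

lemma istopology_gh_openin: "istopology (gh_openin :: 'a metric set \<Rightarrow> bool)"
  unfolding istopology_def
proof (intro conjI allI impI)
  fix S T :: "'a metric set"
  assume S: "gh_openin S" and T: "gh_openin T"
  show "gh_openin (S \<inter> T)"
    unfolding gh_openin_def
  proof (intro conjI ballI)
    show "S \<inter> T \<subseteq> Collect compact_metric"
      using S by (auto simp: gh_openin_def)
    fix X assume "X \<in> S \<inter> T"
    then have X: "X \<in> S" "X \<in> T"
      by auto
    obtain d where "d > 0" "\<forall>Y. compact_metric Y \<and> gh_dist X Y < d \<longrightarrow> Y \<in> S"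
      using S X(1) unfolding gh_openin_def by meson
    moreover obtain e where "e > 0" "\<forall>Y. compact_metric Y \<and> gh_dist X Y < e \<longrightarrow> Y \<in> T"
      using T X(2) unfolding gh_openin_def by meson
    ultimately show "\<exists>e>0. \<forall>Y. compact_metric Y \<and> gh_dist X Y < e \<longrightarrow> Y \<in> S \<inter> T"
      by (intro exI[of _ "min d e"]) auto
  qed
next
  fix \<K> :: "'a metric set set"
  assume \<K>: "\<forall>K\<in>\<K>. gh_openin K"
  show "gh_openin (\<Union>\<K>)"
    unfolding gh_openin_def
  proof (intro conjI ballI)
    show "\<Union>\<K> \<subseteq> Collect compact_metric"
      using \<K> by (auto simp: gh_openin_def)
    fix X assume "X \<in> \<Union>\<K>"
    then obtain K where K: "K \<in> \<K>" "X \<in> K" ..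
    then obtain e where "e > 0" "\<forall>Y. compact_metric Y \<and> gh_dist X Y < e \<longrightarrow> Y \<in> K"
      using \<K> unfolding gh_openin_def by meson
    with K show "\<exists>e>0. \<forall>Y. compact_metric Y \<and> gh_dist X Y < e \<longrightarrow> Y \<in> \<Union>\<K>"
      by (intro exI[of _ e]) auto
  qed
qed

lemma openin_gh_topology: "openin gh_topology \<U> \<longleftrightarrow> gh_openin \<U>"
  unfolding gh_topology_def topology_inverse'[OF istopology_gh_openin] ..

lemma topspace_gh_topology: "topspace gh_topology = Collect compact_metric"
proof -
  have "gh_openin (Collect compact_metric)"
    unfolding gh_openin_def by (auto intro!: exI[of _ "1 :: real"])
  moreover have "\<U> \<subseteq> Collect compact_metric" if "gh_openin \<U>" for \<U> :: "'a metric set"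
    using that unfolding gh_openin_def by (rule conjunct1)
  ultimately show ?thesis
    unfolding topspace_def openin_gh_topology by blast
qed

definition gh_closure :: "'a metric set \<Rightarrow> 'a metric set" where
  "gh_closure \<S> =
     {X. compact_metric X \<and> (\<exists>\<sigma>. range \<sigma> \<subseteq> \<S> \<and> (\<lambda>n. gh_dist (\<sigma> n) X) \<longlonglongrightarrow> 0)}"

definition gh_precompact :: "'a metric set \<Rightarrow> bool" where
  "gh_precompact \<S> \<longleftrightarrow> compactin gh_topology (gh_closure \<S>)"

section \<open>Excess and tight covers\<close>

definition tightly_covered :: "real \<Rightarrow> 'a metric \<Rightarrow> bool" where
  "tightly_covered \<delta> X \<longleftrightarrow>
     (\<exists>p\<in>mspace X. \<exists>q\<in>mspace X. \<exists>r>0. mdist X p q = 2 * r \<and>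
        mspace X = mball_of X p (r + \<delta>) \<union> mball_of X q (r + \<delta>))"

text \<open>For a compact space, infimum and supremum are attained.\<close>

definition excess :: "'a metric \<Rightarrow> real" where
  "excess X =
     (INF (p, q)\<in>mspace X \<times> mspace X. SUP x\<in>mspace X. mdist X p x + mdist X x q - mdist X p q)"

section \<open>Geodesic and non-branching spaces\<close>

definition curve_length :: "'a metric \<Rightarrow> (real \<Rightarrow> 'a) \<Rightarrow> real \<Rightarrow> real \<Rightarrow> ereal" where
  "curve_length X c a b =
     Sup {ereal (\<Sum>i<n. mdist X (c (t i)) (c (t (Suc i)))) | n t.
            t 0 = a \<and> t n = b \<and> (\<forall>i<n. t i \<le> t (Suc i))}"

definition minimal_geodesic :: "'a metric \<Rightarrow> real \<Rightarrow> (real \<Rightarrow> 'a) \<Rightarrow> 'a \<Rightarrow> 'a \<Rightarrow> bool" where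
  "minimal_geodesic X L c x y \<longleftrightarrow>
     0 \<le> L \<and> continuous_map (top_of_set {0..L}) (mtopology_of X) c \<and> c 0 = x \<and> c L = y \<and>
     curve_length X c 0 L = ereal (mdist X x y) \<and>
     (\<forall>s t. 0 \<le> s \<and> s \<le> t \<and> t \<le> L \<longrightarrow> curve_length X c s t = ereal (t - s))"

definition geodesic_space :: "'a metric \<Rightarrow> bool" where
  "geodesic_space X \<longleftrightarrow>
     (\<forall>x\<in>mspace X. \<forall>y\<in>mspace X. \<exists>L c. minimal_geodesic X L c x y)"

definition non_branching :: "'a metric \<Rightarrow> bool" where
  "non_branching X \<longleftrightarrow>
     (\<forall>x\<in>mspace X. \<forall>y\<in>mspace X. \<forall>z\<in>mspace X. \<forall>\<eta>>0. \<forall>c c'.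
        minimal_geodesic X (2 * \<eta>) c x y \<and> minimal_geodesic X (2 * \<eta>) c' x z \<and> c \<eta> = c' \<eta> \<longrightarrow>
        (\<forall>t\<in>{0..2 * \<eta>}. c t = c' t))"

end

theory Submission
  imports Defs
begin

text \<open>
  Small excess gives a tight cover directly: if \<open>\<rho>(p, x) + \<rho>(x, q) < \<rho>(p, q) + \<epsilon>\<close>, then one of the
  two summands is smaller than \<open>\<rho>(p, q) / 2 + \<epsilon>\<close>; if \<open>p = q\<close>, the whole manifold is small and any
  second point will do for \<open>q\<close>.

  For the converse, let \<open>X\<close> be a non-branching limit space which is the union of the closed balls of
  radius \<open>r\<close> around \<open>p\<close> and \<open>q\<close>, where \<open>\<rho>(p, q) = 2 r\<close>. A shortest path from \<open>q\<close> to a point \<open>x\<close> of the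
  ball around \<open>p\<close> passes through a midpoint of \<open>p\<close> and \<open>q\<close>. As paths do not branch there, \<open>x\<close> lies
  between \<open>p\<close> and \<open>q\<close> or beyond \<open>p\<close>. If no point lies beyond \<open>p\<close> or \<open>q\<close>, then \<open>p\<close> and \<open>q\<close> show that
  \<open>X\<close> has excess zero; otherwise \<open>X\<close> turns out to be a segment, and its end points do. By compactness
  a space without such a pair is uniformly far from being covered by two balls of half the distance of their
  centres, and this persists for Gromov-Hausdorff close spaces. Compactness of the closure of the
  class makes the constants uniform.

  For all this the Riemannian distance has to be a metric which induces a compact topology.
\<close>

section \<open>Minimal geodesics and betweenness\<close>

text \<open>In the limit a tight cover degenerates: the balls become closed, of radius exactly half
  the distance of the centres, and the centres may merge. Hence
  \<open>two_ball_cover_zero_excess\<close> admits \<open>r = 0\<close>, and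
  \<open>uncovered_uniform\<close> ranges over all pairs of centres, equal ones included. Why the
  exceptional case is a segment: if \<open>x\<close> lies beyond \<open>p\<close>, a shortest path
  from \<open>p\<close> to any midpoint of \<open>p\<close> and \<open>q\<close> prolongs one from
  \<open>x\<close> to \<open>p\<close>, so non-branching leaves a single midpoint \<open>y\<close>.
  Shortest paths from \<open>q\<close> into the ball around \<open>p\<close>, and from
  \<open>p\<close> into the ball around \<open>q\<close>, must pass through \<open>y\<close>; beyond
  \<open>y\<close>, non-branching orders the points of each ball by their distance from
  \<open>y\<close>. The two arms join to a segment. Spaces are compared by correspondences of small
  distortion, along which centres and covers move pointwise; gluing along a correspondence links
  them to \<open>gh_dist\<close>. The Riemannian side rests on two estimates: nearby points are
  joined by short curves (\<open>reaches_near\<close>), distinct points only by curves of a definite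
  length (\<open>reaches_far\<close>).\<close>

lemma mdist_refl: "x \<in> mspace X \<Longrightarrow> mdist X x x = 0"
  by simp

text \<open>By \<open>minimal_geodesic_iff\<close> these are the minimal geodesics; as
  distance-preserving maps they can be cut and joined without the suprema in
  \<open>curve_length\<close>.\<close>

definition unit_speed :: "'a metric \<Rightarrow> real \<Rightarrow> (real \<Rightarrow> 'a) \<Rightarrow> bool" where
  "unit_speed X L c \<longleftrightarrow> 0 \<le> L \<and> (\<forall>t\<in>{0..L}. c t \<in> mspace X) \<and>
     (\<forall>s\<in>{0..L}. \<forall>t\<in>{0..L}. mdist X (c s) (c t) = \<bar>s - t\<bar>)"

text \<open>If one intermediate distance fell short of its parameter interval, the triangle
  inequality would bring the ends closer than \<open>L\<close>.\<close>

lemma unit_speedI: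
  assumes "0 \<le> L" and mem: "\<And>t. 0 \<le> t \<Longrightarrow> t \<le> L \<Longrightarrow> c t \<in> mspace X"
    and le: "\<And>s t. 0 \<le> s \<Longrightarrow> s \<le> t \<Longrightarrow> t \<le> L \<Longrightarrow> mdist X (c s) (c t) \<le> t - s"
    and ge: "L \<le> mdist X (c 0) (c L)"
  shows "unit_speed X L c"
proof -
  have eq: "mdist X (c s) (c t) = t - s" if "0 \<le> s" "s \<le> t" "t \<le> L" for s t
  proof -
    have "mdist X (c 0) (c L) \<le> mdist X (c 0) (c s) + mdist X (c s) (c L)"
      using that assms by (intro mdist_triangle) auto
    moreover have "mdist X (c s) (c L) \<le> mdist X (c s) (c t) + mdist X (c t) (c L)"
      using that assms by (intro mdist_triangle) auto
    ultimately show ?thesis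
      using le[of 0 s] le[of s t] le[of t L] that ge by auto
  qed
  have "mdist X (c s) (c t) = \<bar>s - t\<bar>" if "0 \<le> s" "s \<le> L" "0 \<le> t" "t \<le> L" for s t
    using eq[of s t] eq[of t s] that by (cases "s \<le> t") (auto simp: mdist_commute)
  then show ?thesis
    using assms by (auto simp: unit_speed_def)
qed

lemma unit_speed_continuous:
  assumes "unit_speed X L c"
  shows "continuous_map (top_of_set {0..L}) (mtopology_of X) c"
proof -
  interpret Metric_space "mspace X" "mdist X"
    by (rule Metric_space_mspace_mdist)
  have "continuous_map (top_of_set {0..L}) mtopology c"
    unfolding continuous_map_to_metric
  proof (intro ballI allI impI)
    fix t and e :: real assume t: "t \<in> topspace (top_of_set {0..L})" and "0 < e"
    show "\<exists>U. openin (top_of_set {0..L}) U \<and> t \<in> U \<and> (\<forall>s\<in>U. c s \<in> mball (c t) e)"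
      using t \<open>0 < e\<close> assms
      by (intro exI[of _ "{0..L} \<inter> ball t e"])
         (auto simp: unit_speed_def openin_open_Int dist_real_def)
  qed
  then show ?thesis
    by (simp add: mtopology_of_def)
qed

lemma dist_le_curve_length:
  assumes "s \<le> t"
  shows "ereal (mdist X (c s) (c t)) \<le> curve_length X c s t"
  unfolding curve_length_def
  by (rule Sup_upper, rule CollectI, rule exI[of _ 1], rule exI[of _ "\<lambda>i. if i = 0 then s else t"])
     (use assms in simp)

lemma curve_length_unit_speed:
  assumes c: "unit_speed X L c" and st: "0 \<le> s" "s \<le> t" "t \<le> L"
  shows "curve_length X c s t = ereal (t - s)"
proof (rule antisym)
  show "curve_length X c s t \<le> ereal (t - s)"
    unfolding curve_length_def
  proof (rule Sup_least, clarify)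
    fix n and u :: "nat \<Rightarrow> real"
    assume u: "s = u 0" "t = u n" "\<forall>i<n. u i \<le> u (Suc i)"
    have mono: "u i \<le> u j" if "i \<le> j" "j \<le> n" for i j
      using that by (induction j rule: dec_induct) (use u(3) in \<open>auto intro: order_trans\<close>)
    have "(\<Sum>i<n. mdist X (c (u i)) (c (u (Suc i)))) = (\<Sum>i<n. u (Suc i) - u i)"
    proof (rule sum.cong[OF refl])
      fix i assume "i \<in> {..<n}"
      then show "mdist X (c (u i)) (c (u (Suc i))) = u (Suc i) - u i"
        using c st mono[of 0 i] mono[of 0 "Suc i"] mono[of i n] mono[of "Suc i" n] mono[of i "Suc i"] u(1,2)
        by (auto simp: unit_speed_def)
    qed
    also have "\<dots> = u n - u 0"
      by (rule sum_lessThan_telescope)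
    finally show "ereal (\<Sum>i<n. mdist X (c (u i)) (c (u (Suc i)))) \<le> ereal (u n - u 0)"
      by simp
  qed
  have "mdist X (c s) (c t) = t - s"
    using c st by (auto simp: unit_speed_def)
  then show "ereal (t - s) \<le> curve_length X c s t"
    using dist_le_curve_length[of s t X c] st by simp
qed

text \<open>Chords are at most as long as arcs, and the whole chord has length \<open>L\<close>, so
  \<open>unit_speedI\<close> applies. Conversely, the partition sums of a distance-preserving map
  telescope.\<close>

lemma minimal_geodesic_iff:
  "minimal_geodesic X L c x y \<longleftrightarrow> unit_speed X L c \<and> c 0 = x \<and> c L = y"
proof (intro iffI conjI)
  assume m: "minimal_geodesic X L c x y"
  then show "c 0 = x" "c L = y"
    by (auto simp: minimal_geodesic_def)
  have len: "curve_length X c s t = ereal (t - s)" if "0 \<le> s" "s \<le> t" "t \<le> L" for s t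
    using m that unfolding minimal_geodesic_def by blast
  show "unit_speed X L c"
  proof (rule unit_speedI)
    show "0 \<le> L"
      using m by (simp add: minimal_geodesic_def)
    show "c t \<in> mspace X" if "0 \<le> t" "t \<le> L" for t
      using m that by (auto simp: minimal_geodesic_def continuous_map_def)
    show "mdist X (c s) (c t) \<le> t - s" if "0 \<le> s" "s \<le> t" "t \<le> L" for s t
      using dist_le_curve_length[OF that(2), of X c] len[OF that] by simp
    show "L \<le> mdist X (c 0) (c L)"
      using m len[of 0 L] by (auto simp: minimal_geodesic_def)
  qed
next
  assume u: "unit_speed X L c \<and> c 0 = x \<and> c L = y"
  then have "mdist X x y = L"
    by (auto simp: unit_speed_def)
  then show "minimal_geodesic X L c x y"
    using u unit_speed_continuous[of X L c] curve_length_unit_speed[of X L c] curve_length_unit_speed[of X L c 0 L]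
    by (auto simp: minimal_geodesic_def unit_speed_def)
qed

lemma unit_speed_subsegment:
  assumes "unit_speed X L c" "0 \<le> u" "u \<le> v" "v \<le> L"
  shows "unit_speed X (v - u) (\<lambda>t. c (u + t))"
  using assms by (auto simp: unit_speed_def)

text \<open>The bound \<open>ge\<close> on the distance of the outer ends rules out a shortcut past
  the joint; \<open>unit_speedI\<close> then asks only for the triangle inequality there.\<close>

lemma unit_speed_join:
  assumes c: "unit_speed X a c" and c': "unit_speed X b c'" and "c a = c' 0"
    and ge: "a + b \<le> mdist X (c 0) (c' b)"
  shows "unit_speed X (a + b) (\<lambda>t. if t \<le> a then c t else c' (t - a))" (is "unit_speed _ _ ?c")
proof (rule unit_speedI)
  have ab: "0 \<le> a" "0 \<le> b"
    using c c' by (auto simp: unit_speed_def)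
  then show "0 \<le> a + b" by simp
  show "?c t \<in> mspace X" if "0 \<le> t" "t \<le> a + b" for t
    using that c c' by (auto simp: unit_speed_def)
  show "mdist X (?c s) (?c t) \<le> t - s" if st: "0 \<le> s" "s \<le> t" "t \<le> a + b" for s t
  proof -
    consider "t \<le> a" | "a < s" | "s \<le> a" "a < t" by linarith
    then show ?thesis
    proof cases
      case 3
      then have "mdist X (c s) (c' (t - a)) \<le> mdist X (c s) (c a) + mdist X (c' 0) (c' (t - a))"
        unfolding \<open>c a = c' 0\<close> using st c c' ab by (intro mdist_triangle) (auto simp: unit_speed_def)
      then show ?thesis
        using 3 st ab c c' by (auto simp: unit_speed_def)
    qed (use st c c' ab in \<open>auto simp: unit_speed_def\<close>)
  qed
  show "a + b \<le> mdist X (?c 0) (?c (a + b))"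
    using ab ge \<open>c a = c' 0\<close> by (cases "b = 0") auto
qed

lemma geodesic_space_segment:
  assumes "geodesic_space X" "x \<in> mspace X" "y \<in> mspace X"
  obtains c where "unit_speed X (mdist X x y) c" "c 0 = x" "c (mdist X x y) = y"
proof -
  obtain L c where m: "minimal_geodesic X L c x y"
    using assms unfolding geodesic_space_def by blast
  then have "L = mdist X x y"
    by (auto simp: minimal_geodesic_iff unit_speed_def)
  then show ?thesis
    using m that by (auto simp: minimal_geodesic_iff)
qed

text \<open>\<open>non_branching\<close> speaks of geodesics that meet at the middle of their common
  parameter interval. Applied to an interval centred at the supremum \<open>t1\<close> of the times
  of agreement, it extends the agreement beyond \<open>t1\<close>.\<close>

lemma non_branching_unit_speed:
  assumes nb: "non_branching X" and c: "unit_speed X L c" and c': "unit_speed X L c'"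
    and t0: "0 < t0" "t0 \<le> L" and eq: "\<And>t. 0 \<le> t \<Longrightarrow> t \<le> t0 \<Longrightarrow> c t = c' t"
  shows "c L = c' L"
proof -
  define S where "S = {t\<in>{0..L}. \<forall>s\<in>{0..t}. c s = c' s}"
  have "t0 \<in> S"
    using t0 eq by (auto simp: S_def)
  have bdd: "bdd_above S"
    by (auto simp: S_def intro: bdd_aboveI[of _ L])
  define t1 where "t1 = Sup S"
  have "t0 \<le> t1"
    unfolding t1_def by (rule cSup_upper[OF \<open>t0 \<in> S\<close> bdd])
  have "t1 \<le> L"
    unfolding t1_def by (rule cSup_least) (use \<open>t0 \<in> S\<close> in \<open>auto simp: S_def\<close>)
  have below: "c s = c' s" if s: "0 \<le> s" "s < t1" for s
  proof -
    obtain t where "t \<in> S" "s < t"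
      using s(2) \<open>t0 \<in> S\<close> unfolding t1_def by (metis less_cSupE empty_iff)
    then show ?thesis
      using s(1) by (auto simp: S_def)
  qed
  have mem: "c s \<in> mspace X" "c' s \<in> mspace X" if "0 \<le> s" "s \<le> L" for s
    using c c' that by (auto simp: unit_speed_def)
  have at: "c t1 = c' t1"
  proof -
    have "mdist X (c t1) (c' t1) \<le> e" if "0 < e" for e
    proof -
      \<comment> \<open>The curves agree at \<open>s\<close>, and from there each travels at most
        \<open>e / 2\<close> until \<open>t1\<close>.\<close>
      define s where "s = max 0 (t1 - e / 2)"
      have s: "0 \<le> s" "s < t1" "t1 - s \<le> e / 2"
        using t0 \<open>t0 \<le> t1\<close> that unfolding s_def by linarith+
      have "mdist X (c t1) (c' t1) \<le> mdist X (c t1) (c s) + mdist X (c' s) (c' t1)"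
        unfolding below[OF s(1,2), symmetric] using s \<open>t1 \<le> L\<close> by (intro mdist_triangle mem) auto
      also have "\<dots> = 2 * (t1 - s)"
        using c c' s \<open>t1 \<le> L\<close> by (auto simp: unit_speed_def)
      finally show ?thesis
        using s by simp
    qed
    then have "mdist X (c t1) (c' t1) \<le> 0"
      by (rule field_le_epsilon) simp
    then have "mdist X (c t1) (c' t1) = 0"
      by (simp add: antisym)
    then show ?thesis
      using mem[of t1] t0 \<open>t0 \<le> t1\<close> \<open>t1 \<le> L\<close> by auto
  qed
  have "t1 = L"
  proof (rule ccontr)
    assume "t1 \<noteq> L"
    \<comment> \<open>The largest radius for which the interval around \<open>t1\<close> stays
      within \<open>{0..L}\<close>.\<close>
    define h where "h = min t1 (L - t1)"
    have h: "0 < h" "h \<le> t1" "t1 + h \<le> L"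
      using \<open>t1 \<noteq> L\<close> \<open>t1 \<le> L\<close> t0 \<open>t0 \<le> t1\<close> by (auto simp: h_def)
    let ?d = "\<lambda>t. c (t1 - h + t)" and ?d' = "\<lambda>t. c' (t1 - h + t)"
    have "minimal_geodesic X (2 * h) ?d (?d 0) (?d (2 * h))" "minimal_geodesic X (2 * h) ?d' (?d 0) (?d' (2 * h))"
      unfolding minimal_geodesic_iff
      using unit_speed_subsegment[OF c, of "t1 - h" "t1 + h"] unit_speed_subsegment[OF c', of "t1 - h" "t1 + h"] h
        below[of "t1 - h"] by auto
    moreover have "?d 0 \<in> mspace X" "?d (2 * h) \<in> mspace X" "?d' (2 * h) \<in> mspace X"
      using h by (auto intro!: mem)
    moreover have "?d h = ?d' h"
      using at by simp
    ultimately have *: "?d t = ?d' t" if "t \<in> {0..2 * h}" for t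
      using nb that \<open>0 < h\<close> unfolding non_branching_def by blast
    have "t1 + h \<in> S"
      unfolding S_def
    proof (clarsimp, intro conjI ballI)
      show "0 \<le> t1 + h" "t1 + h \<le> L"
        using h by auto
      fix s assume "s \<in> {0..t1 + h}"
      then show "c s = c' s"
        using below[of s] *[of "s - (t1 - h)"] h by (cases "s < t1") auto
    qed
    then have "t1 + h \<le> t1"
      unfolding t1_def by (rule cSup_upper[OF _ bdd])
    with \<open>0 < h\<close> show False by simp
  qed
  then show ?thesis
    using at by simp
qed

abbreviation between :: "'a metric \<Rightarrow> 'a \<Rightarrow> 'a \<Rightarrow> 'a \<Rightarrow> bool" where
  "between X a b c \<equiv> mdist X a b + mdist X b c = mdist X a c"

text \<open>Shortest paths from \<open>a\<close> through \<open>b\<close> to \<open>c\<close> and to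
  \<open>c'\<close> can be given the same first piece, of positive length since
  \<open>a \<noteq> b\<close>. They cannot part afterwards, so the shorter one ends on the longer
  one.\<close>

lemma non_branching_between:
  assumes X: "geodesic_space X" "non_branching X"
    and mem: "a \<in> mspace X" "b \<in> mspace X" "c \<in> mspace X" "c' \<in> mspace X"
    and "a \<noteq> b" "between X a b c" "between X a b c'" "mdist X b c \<le> mdist X b c'"
  shows "between X b c c'"
proof -
  define l k k' where "l = mdist X a b" and "k = mdist X b c" and "k' = mdist X b c'"
  obtain g where g: "unit_speed X l g" "g 0 = a" "g l = b"
    using geodesic_space_segment[OF X(1) mem(1,2)] unfolding l_def by blast
  obtain h where h: "unit_speed X k h" "h 0 = b" "h k = c"
    using geodesic_space_segment[OF X(1) mem(2,3)] unfolding k_def by blast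
  obtain h' where h': "unit_speed X k' h'" "h' 0 = b" "h' k' = c'"
    using geodesic_space_segment[OF X(1) mem(2,4)] unfolding k'_def by blast
  have pos: "0 < l" "0 \<le> k" "k \<le> k'"
    using assms by (auto simp: l_def k_def k'_def less_le)
  let ?g = "\<lambda>t. if t \<le> l then g t else h (t - l)" and ?g' = "\<lambda>t. if t \<le> l then g t else h' (t - l)"
  have u: "unit_speed X (l + k) ?g"
    using assms(8) g h by (intro unit_speed_join) (auto simp: l_def k_def)
  have "unit_speed X (l + k') ?g'"
    using assms(9) g h' by (intro unit_speed_join) (auto simp: l_def k'_def)
  \<comment> \<open>The longer path is cut at the length of the shorter one.\<close>
  from unit_speed_subsegment[OF this, of 0 "l + k"] have u': "unit_speed X (l + k) ?g'"
    using pos by (simp cong: if_cong)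
  have "?g (l + k) = ?g' (l + k)"
    by (rule non_branching_unit_speed[OF X(2) u u' \<open>0 < l\<close>]) (use pos in auto)
  then have "h k = h' k"
    using pos g h h' by (cases "k = 0") auto
  then have "mdist X c c' = k' - k"
    using h'(1,3) h(3) pos by (auto simp: unit_speed_def)
  then show ?thesis
    by (simp add: k_def k'_def)
qed

section \<open>Spaces covered by two closed balls of half the distance of their centres\<close>

text \<open>The maximisers become the outer ends of the two arms in
  \<open>two_ball_cover_arms\<close>.\<close>

lemma compact_ball_farthest:
  assumes "compact_metric X" "y \<in> mspace X" "p \<in> mspace X" "0 \<le> r"
  obtains a where "a \<in> mspace X" "mdist X p a \<le> r"
    "\<And>w. w \<in> mspace X \<Longrightarrow> mdist X p w \<le> r \<Longrightarrow> mdist X y w \<le> mdist X y a"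
proof -
  interpret Metric_space "mspace X" "mdist X"
    by (rule Metric_space_mspace_mdist)
  have "\<forall>a\<in>mspace X. \<forall>e>0. \<exists>d>0. \<forall>x. x \<in> mspace X \<and> mdist X a x < d \<longrightarrow> dist (mdist X y a) (mdist X y x) < e"
  proof (intro ballI allI impI)
    fix a and e :: real assume "a \<in> mspace X" "0 < e"
    then show "\<exists>d>0. \<forall>x. x \<in> mspace X \<and> mdist X a x < d \<longrightarrow> dist (mdist X y a) (mdist X y x) < e"
      using assms(2) mdist_reverse_triangle[of a y] by (intro exI[of _ e]) (force simp: commute dist_real_def)
  qed
  then have "continuous_map mtopology euclideanreal (mdist X y)"
    using metric_continuous_map[OF Met_TC.Metric_space_axioms, of "mdist X y"] by simp
  moreover have "compactin mtopology (mcball p r)"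
    using assms(1) by (intro closedin_compact_space) (auto simp: compact_metric_def mtopology_of_def)
  ultimately have "compact (mdist X y ` mcball p r)"
    using image_compactin by fastforce
  moreover have "p \<in> mcball p r"
    using assms by simp
  ultimately obtain a where "a \<in> mcball p r" "\<forall>w\<in>mcball p r. mdist X y w \<le> mdist X y a"
    using compact_attains_sup[of "mdist X y ` mcball p r"] by blast
  then show ?thesis
    using that[of a] assms(3) by auto
qed

text \<open>On a shortest path from \<open>q\<close> to \<open>w\<close>, the points just beyond distance \<open>r\<close> from \<open>q\<close> must lie
  in the ball around \<open>p\<close>; hence the point at distance \<open>r\<close> is a midpoint of \<open>p\<close> and \<open>q\<close>.\<close>

lemma midpoint_towards:
  assumes X: "geodesic_space X" and mem: "p \<in> mspace X" "q \<in> mspace X" "w \<in> mspace X"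
    and pq: "mdist X p q = 2 * r"
    and cover: "\<And>x. x \<in> mspace X \<Longrightarrow> mdist X p x \<le> r \<or> mdist X q x \<le> r"
    and w: "mdist X p w \<le> r"
  obtains y where "y \<in> mspace X" "mdist X p y = r" "mdist X q y = r" "between X q y w"
proof -
  define D where "D = mdist X q w"
  obtain c where c: "unit_speed X D c" "c 0 = q" "c D = w"
    using geodesic_space_segment[OF X mem(2,3)] unfolding D_def by blast
  have "0 \<le> r"
    using pq mdist_nonneg[of X p q] by linarith
  have "r \<le> D"
    using mdist_triangle[OF mem(1,3,2)] mdist_commute[of X q w] w pq by (simp add: D_def)
  have cm: "c t \<in> mspace X" if "0 \<le> t" "t \<le> D" for t
    using c(1) that by (auto simp: unit_speed_def)
  have cd: "mdist X (c s) (c t) = \<bar>s - t\<bar>" if "0 \<le> s" "s \<le> D" "0 \<le> t" "t \<le> D" for s t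
    using c(1) that by (auto simp: unit_speed_def)
  have y: "c r \<in> mspace X" "mdist X q (c r) = r"
    using \<open>0 \<le> r\<close> \<open>r \<le> D\<close> cm[of r] cd[of 0 r] c(2) by auto
  have "mdist X p (c r) \<le> r"
  \<comment> \<open>If \<open>r = D\<close>, the path has no points beyond distance
    \<open>r\<close>, but its end is \<open>w\<close> itself.\<close>
  proof (cases "r = D")
    case True
    then show ?thesis using c(3) w by simp
  next
    case False
    show ?thesis
    proof (rule field_le_epsilon)
      fix e :: real assume "0 < e"
      define t where "t = min (r + e) D"
      have t: "r < t" "t \<le> D" "t \<le> r + e"
        using False \<open>r \<le> D\<close> \<open>0 < e\<close> by (auto simp: t_def)
      have "mdist X q (c t) = t"
        using cd[of 0 t] t \<open>0 \<le> r\<close> c(2) by auto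
      then have "mdist X p (c t) \<le> r"
        using cover[OF cm[of t]] t \<open>0 \<le> r\<close> by auto
      moreover have "mdist X p (c r) \<le> mdist X p (c t) + mdist X (c t) (c r)"
        using t \<open>0 \<le> r\<close> \<open>r \<le> D\<close> mem by (intro mdist_triangle cm) auto
      ultimately show "mdist X p (c r) \<le> r + e"
        using cd[of t r] t \<open>0 \<le> r\<close> by auto
    qed
  qed
  moreover have "2 * r \<le> mdist X p (c r) + r"
    using mdist_triangle[OF mem(1) y(1) mem(2)] y(2) pq mdist_commute[of X q "c r"] by simp
  moreover have "mdist X (c r) w = D - r"
    using cd[of r D] c(3) \<open>0 \<le> r\<close> \<open>r \<le> D\<close> by simp
  ultimately show ?thesis
    using that[OF y(1) _ y(2)] y(2) by (auto simp: D_def)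
qed

text \<open>A point \<open>x\<close> of the ball around \<open>p\<close> which is not between \<open>p\<close> and \<open>q\<close> lies beyond \<open>p\<close>. Then the
  midpoint of \<open>p\<close> and \<open>q\<close> is unique, and the space consists of two arms which start there.\<close>

lemma two_ball_cover_arms:
  assumes X: "compact_metric X" "geodesic_space X" "non_branching X"
    and mem: "p \<in> mspace X" "q \<in> mspace X" "x \<in> mspace X"
    and pq: "mdist X p q = 2 * r"
    and cover: "\<And>x. x \<in> mspace X \<Longrightarrow> mdist X p x \<le> r \<or> mdist X q x \<le> r"
    and x: "mdist X p x \<le> r" "\<not> between X p x q"
  obtains a b where "a \<in> mspace X" "b \<in> mspace X" "\<And>w. w \<in> mspace X \<Longrightarrow> between X a w b"
proof -
  let ?d = "mdist X"
  have "0 \<le> r"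
    using pq mdist_nonneg[of X p q] by linarith
  have "r \<noteq> 0"
  proof
    assume "r = 0"
    then have "?d p x = 0" "?d p q = 0"
      using x(1) pq mdist_nonneg[of X p x] by auto
    then show False
      using mem x(2) by auto
  qed
  with \<open>0 \<le> r\<close> have "0 < r" by simp
  have qp: "?d q p = 2 * r"
    using pq by (simp add: mdist_commute)
  obtain y where y: "y \<in> mspace X" "?d p y = r" "?d q y = r" "between X q y x"
    using midpoint_towards[OF X(2) mem pq cover x(1)] by blast
  have ne: "q \<noteq> y" "p \<noteq> y"
    using y \<open>0 < r\<close> mem by (auto dest: mdist_refl)
  have yp: "?d y p = r" "?d y q = r"
    using y by (simp_all add: mdist_commute)
  have qyp: "between X q y p"
    using y qp yp by simp
  \<comment> \<open>If \<open>x\<close> were nearer to \<open>y\<close> than \<open>p\<close> is, it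
    would lie on the way from \<open>y\<close> to \<open>p\<close>, hence between \<open>p\<close>
    and \<open>q\<close>.\<close>
  have "r \<le> ?d y x"
  proof (rule ccontr)
    assume "\<not> r \<le> ?d y x"
    then have "between X y x p"
      using non_branching_between[OF X(2,3) mem(2) y(1) mem(3,1) ne(1) y(4) qyp] yp by simp
    then have "between X p x q"
      using y(3,4) yp pq by (simp add: mdist_commute)
    with x(2) show False by simp
  qed
  then have ypx: "between X y p x"
    using non_branching_between[OF X(2,3) mem(2) y(1) mem(1,3) ne(1) qyp y(4)] yp by simp
  have "x \<noteq> p"
    using x(2) mem by auto
  have qx: "?d q x = 2 * r + ?d p x"
    using ypx y(3,4) yp by simp
  \<comment> \<open>A shortcut from \<open>x\<close> to \<open>z\<close>, followed by the way of
    length \<open>r\<close> from \<open>z\<close> to \<open>q\<close>, would make \<open>x\<close>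
    closer to \<open>q\<close> than \<open>qx\<close> says.\<close>
  have beyond: "between X x p z" if z: "z \<in> mspace X" "?d p z = r" "?d q z = r" for z
  proof -
    have "?d q x \<le> ?d q z + ?d z x"
      using mem z by (intro mdist_triangle) auto
    moreover have "?d x z \<le> ?d x p + ?d p z"
      using mem z by (intro mdist_triangle) auto
    ultimately show ?thesis
      using qx z by (simp add: mdist_commute)
  qed
  \<comment> \<open>The ways from \<open>p\<close> to \<open>z\<close> and to \<open>y\<close> have
    the same length and both prolong the way from \<open>x\<close> to \<open>p\<close>.\<close>
  have unique: "z = y" if z: "z \<in> mspace X" "?d p z = r" "?d q z = r" for z
  proof -
    have "between X p z y"
      using non_branching_between[OF X(2,3) mem(3,1) z(1) y(1) \<open>x \<noteq> p\<close> beyond[OF z] beyond[OF y(1-3)]] z y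
      by simp
    then show ?thesis
      using z y by simp
  qed
  have A: "between X q y w" if "w \<in> mspace X" "?d p w \<le> r" for w
    using midpoint_towards[OF X(2) mem(1,2) that(1) pq cover that(2)] unique by metis
  have B: "between X p y w" if "w \<in> mspace X" "?d q w \<le> r" for w
    using midpoint_towards[OF X(2) mem(2,1) that(1) qp _ that(2)] cover unique by metis
  obtain a where a: "a \<in> mspace X" "?d p a \<le> r" "\<And>w. w \<in> mspace X \<Longrightarrow> ?d p w \<le> r \<Longrightarrow> ?d y w \<le> ?d y a"
    using compact_ball_farthest[OF X(1) y(1) mem(1) \<open>0 \<le> r\<close>] by blast
  obtain b where b: "b \<in> mspace X" "?d q b \<le> r" "\<And>w. w \<in> mspace X \<Longrightarrow> ?d q w \<le> r \<Longrightarrow> ?d y w \<le> ?d y b"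
    using compact_ball_farthest[OF X(1) y(1) mem(2) \<open>0 \<le> r\<close>] by blast
  \<comment> \<open>A shortest path from \<open>a\<close> to \<open>b\<close> starts at least as
    close to \<open>p\<close> as to \<open>q\<close> and ends the other way round. Where the two
    distances are equal, the cover bounds both by \<open>r\<close>, so this point is the midpoint
    \<open>y\<close>.\<close>
  have ayb: "between X a y b"
  proof -
    define D where "D = ?d a b"
    obtain c where c: "unit_speed X D c" "c 0 = a" "c D = b"
      using geodesic_space_segment[OF X(2) a(1) b(1)] unfolding D_def by blast
    have cm: "c t \<in> mspace X" if "0 \<le> t" "t \<le> D" for t
      using c(1) that by (auto simp: unit_speed_def)
    have cd: "?d (c s) (c t) = \<bar>s - t\<bar>" if "0 \<le> s" "s \<le> D" "0 \<le> t" "t \<le> D" for s t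
      using c(1) that by (auto simp: unit_speed_def)
    have "0 \<le> D" by (simp add: D_def)
    have lip: "1-lipschitz_on {0..D} (\<lambda>t. ?d z (c t))" if "z \<in> mspace X" for z
    proof (rule lipschitz_onI)
      fix s t assume st: "s \<in> {0..D}" "t \<in> {0..D}"
      have "?d z (c s) \<le> ?d z (c t) + ?d (c t) (c s)" "?d z (c t) \<le> ?d z (c s) + ?d (c s) (c t)"
        using st that by (auto intro!: mdist_triangle cm)
      then show "dist (?d z (c s)) (?d z (c t)) \<le> 1 * dist s t"
        using cd[of s t] cd[of t s] st by (simp add: dist_real_def)
    qed simp
    have "continuous_on {0..D} (\<lambda>t. ?d p (c t) - ?d q (c t))"
      using lip[OF mem(1)] lip[OF mem(2)] by (intro continuous_on_diff lipschitz_on_continuous_on)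
    moreover have "?d p (c 0) - ?d q (c 0) \<le> 0"
      using mdist_triangle[OF mem(1) a(1) mem(2)] a(2) pq c(2) by (simp add: mdist_commute)
    moreover have "0 \<le> ?d p (c D) - ?d q (c D)"
      using mdist_triangle[OF mem(1) b(1) mem(2)] b(2) pq c(3) by (simp add: mdist_commute)
    ultimately obtain t where t: "0 \<le> t" "t \<le> D" "?d p (c t) - ?d q (c t) = 0"
      using IVT'[of "\<lambda>t. ?d p (c t) - ?d q (c t)" 0 0 D] \<open>0 \<le> D\<close> by blast
    have "2 * r \<le> ?d p (c t) + ?d q (c t)"
      using mdist_triangle[OF mem(1) cm mem(2), of t] t pq by (simp add: mdist_commute)
    then have "c t = y"
      using t cover[OF cm, of t] by (intro unique cm) auto
    then show ?thesis
      using cd[of 0 t] cd[of t D] t c by (simp add: D_def)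
  qed
  show ?thesis
  proof (rule that[OF a(1) b(1)])
    fix w assume w: "w \<in> mspace X"
    have tri: "?d w b \<le> ?d w y + ?d y b" "?d a w \<le> ?d a y + ?d y w" "?d a b \<le> ?d a w + ?d w b"
      using w a b y by (auto intro!: mdist_triangle)
    from cover[OF w] show "between X a w b"
    proof
      assume wA: "?d p w \<le> r"
      \<comment> \<open>The ways from \<open>y\<close> to \<open>w\<close> and to \<open>a\<close>
        both prolong the way from \<open>q\<close> to \<open>y\<close>, and \<open>a\<close> is the
        farther point.\<close>
      have "between X y w a"
        by (rule non_branching_between[OF X(2,3) mem(2) y(1) w a(1) ne(1) A[OF w wA] A[OF a(1,2)] a(3)[OF w wA]])
      then show ?thesis
        using tri ayb by (simp add: mdist_commute)
    next
      assume wB: "?d q w \<le> r"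
      have "between X y w b"
        by (rule non_branching_between[OF X(2,3) mem(1) y(1) w b(1) ne(2) B[OF w wB] B[OF b(1,2)] b(3)[OF w wB]])
      then show ?thesis
        using tri ayb by (simp add: mdist_commute)
    qed
  qed
qed

theorem two_ball_cover_zero_excess:
  assumes X: "compact_metric X" "geodesic_space X" "non_branching X"
    and mem: "p \<in> mspace X" "q \<in> mspace X"
    and pq: "mdist X p q = 2 * r"
    and cover: "\<And>x. x \<in> mspace X \<Longrightarrow> mdist X p x \<le> r \<or> mdist X q x \<le> r"
  obtains a b where "a \<in> mspace X" "b \<in> mspace X" "\<And>w. w \<in> mspace X \<Longrightarrow> between X a w b"
proof (cases "\<forall>x\<in>mspace X. between X p x q")
  case True
  then show ?thesis using that mem by blast
next
  case False
  then obtain x where x: "x \<in> mspace X" "\<not> between X p x q" by blast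
  have qp: "mdist X q p = 2 * r" and x': "\<not> between X q x p"
    using pq x(2) by (simp_all add: mdist_commute add.commute)
  from cover[OF x(1)] show ?thesis
  proof
    assume "mdist X p x \<le> r"
    from two_ball_cover_arms[OF X mem x(1) pq cover this x(2)] show ?thesis
      using that by blast
  next
    assume "mdist X q x \<le> r"
    from two_ball_cover_arms[OF X mem(2,1) x(1) qp _ this x'] cover show ?thesis
      using that by blast
  qed
qed

section \<open>Gromov-Hausdorff closeness and correspondences\<close>

lemma compact_metric_bounded:
  assumes "compact_metric X"
  obtains B where "\<And>x y. x \<in> mspace X \<Longrightarrow> y \<in> mspace X \<Longrightarrow> mdist X x y \<le> B"
proof -
  interpret Metric_space "mspace X" "mdist X"
    by (rule Metric_space_mspace_mdist)
  have "compactin mtopology (mspace X)"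
    using assms by (simp add: compact_metric_def mtopology_of_def compact_space_def)
  then have "mbounded (mspace X)"
    by (rule compactin_imp_mbounded)
  then show ?thesis
    using that unfolding mbounded_alt by blast
qed

text \<open>A correspondence of distortion at most \<open>e\<close>. Distortion \<open>2 * e\<close>
  matches Gromov-Hausdorff distance \<open>e\<close>, see \<open>gh_dist_le\<close> and
  \<open>gh_close_if_gh_dist_less\<close>.\<close>

definition gh_close :: "real \<Rightarrow> 'a metric \<Rightarrow> 'b metric \<Rightarrow> bool" where
  "gh_close e X Y \<longleftrightarrow>
     (\<exists>R. (\<forall>x\<in>mspace X. \<exists>y\<in>mspace Y. R x y) \<and> (\<forall>y\<in>mspace Y. \<exists>x\<in>mspace X. R x y) \<and>
        (\<forall>x\<in>mspace X. \<forall>x'\<in>mspace X. \<forall>y\<in>mspace Y. \<forall>y'\<in>mspace Y.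
           R x y \<and> R x' y' \<longrightarrow> \<bar>mdist X x x' - mdist Y y y'\<bar> \<le> e))"

lemma gh_close_refl: "gh_close 0 X X"
  unfolding gh_close_def by (intro exI[of _ "(=)"]) auto

lemma gh_close_mono:
  assumes "gh_close e X Y" "e \<le> e'"
  shows "gh_close e' X Y"
proof -
  obtain R where R: "\<forall>x\<in>mspace X. \<exists>y\<in>mspace Y. R x y" "\<forall>y\<in>mspace Y. \<exists>x\<in>mspace X. R x y"
    "\<forall>x\<in>mspace X. \<forall>x'\<in>mspace X. \<forall>y\<in>mspace Y. \<forall>y'\<in>mspace Y.
       R x y \<and> R x' y' \<longrightarrow> \<bar>mdist X x x' - mdist Y y y'\<bar> \<le> e"
    using assms(1) unfolding gh_close_def by blast
  show ?thesis
    unfolding gh_close_def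
  proof (intro exI[of _ R] conjI ballI impI)
    fix x x' y y' assume "x \<in> mspace X" "x' \<in> mspace X" "y \<in> mspace Y" "y' \<in> mspace Y" "R x y \<and> R x' y'"
    then have "\<bar>mdist X x x' - mdist Y y y'\<bar> \<le> e"
      using R(3) by blast
    then show "\<bar>mdist X x x' - mdist Y y y'\<bar> \<le> e'"
      using assms(2) by simp
  qed (use R(1,2) in blast)+
qed

lemma gh_close_trans:
  assumes "gh_close e X Y" "gh_close e' Y Z"
  shows "gh_close (e + e') X Z"
proof -
  obtain R where R: "\<forall>x\<in>mspace X. \<exists>y\<in>mspace Y. R x y" "\<forall>y\<in>mspace Y. \<exists>x\<in>mspace X. R x y"
    "\<forall>x\<in>mspace X. \<forall>x'\<in>mspace X. \<forall>y\<in>mspace Y. \<forall>y'\<in>mspace Y.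
       R x y \<and> R x' y' \<longrightarrow> \<bar>mdist X x x' - mdist Y y y'\<bar> \<le> e"
    using assms(1) unfolding gh_close_def by blast
  obtain S where S: "\<forall>x\<in>mspace Y. \<exists>y\<in>mspace Z. S x y" "\<forall>y\<in>mspace Z. \<exists>x\<in>mspace Y. S x y"
    "\<forall>x\<in>mspace Y. \<forall>x'\<in>mspace Y. \<forall>y\<in>mspace Z. \<forall>y'\<in>mspace Z.
       S x y \<and> S x' y' \<longrightarrow> \<bar>mdist Y x x' - mdist Z y y'\<bar> \<le> e'"
    using assms(2) unfolding gh_close_def by blast
  let ?T = "\<lambda>x z. \<exists>y\<in>mspace Y. R x y \<and> S y z"
  show ?thesis
    unfolding gh_close_def
  proof (intro exI[of _ ?T] conjI)
    show "\<forall>x\<in>mspace X. \<exists>z\<in>mspace Z. ?T x z" "\<forall>z\<in>mspace Z. \<exists>x\<in>mspace X. ?T x z"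
      using R(1,2) S(1,2) by blast+
    show "\<forall>x\<in>mspace X. \<forall>x'\<in>mspace X. \<forall>z\<in>mspace Z. \<forall>z'\<in>mspace Z.
       ?T x z \<and> ?T x' z' \<longrightarrow> \<bar>mdist X x x' - mdist Z z z'\<bar> \<le> e + e'"
    proof (intro ballI impI, elim conjE bexE)
      fix x x' z z' y y'
      assume *: "x \<in> mspace X" "x' \<in> mspace X" "z \<in> mspace Z" "z' \<in> mspace Z" "y \<in> mspace Y" "y' \<in> mspace Y"
        "R x y" "S y z" "R x' y'" "S y' z'"
      have "\<bar>mdist X x x' - mdist Y y y'\<bar> \<le> e" "\<bar>mdist Y y y' - mdist Z z z'\<bar> \<le> e'"
        using R(3) S(3) * by blast+
      then show "\<bar>mdist X x x' - mdist Z z z'\<bar> \<le> e + e'"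
        by linarith
    qed
  qed
qed

text \<open>The cheapest passage from \<open>x\<close> to \<open>y\<close> through a related pair,
  with the jump between the spaces not yet counted.\<close>

definition gluing_gap :: "'a metric \<Rightarrow> 'b metric \<Rightarrow> ('a \<Rightarrow> 'b \<Rightarrow> bool) \<Rightarrow> 'a \<Rightarrow> 'b \<Rightarrow> real" where
  "gluing_gap X Y R x y =
     (INF (x', y') \<in> {(x', y'). x' \<in> mspace X \<and> y' \<in> mspace Y \<and> R x' y'}. mdist X x x' + mdist Y y' y)"

text \<open>Related points are placed at distance \<open>e\<close> from each other.\<close>

fun gluing_metric :: "real \<Rightarrow> 'a metric \<Rightarrow> 'b metric \<Rightarrow> ('a \<Rightarrow> 'b \<Rightarrow> bool) \<Rightarrow> 'a + 'b \<Rightarrow> 'a + 'b \<Rightarrow> real" where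
  "gluing_metric e X Y R (Inl x) (Inl x') = mdist X x x'"
| "gluing_metric e X Y R (Inr y) (Inr y') = mdist Y y y'"
| "gluing_metric e X Y R (Inl x) (Inr y) = e + gluing_gap X Y R x y"
| "gluing_metric e X Y R (Inr y) (Inl x) = e + gluing_gap X Y R x y"

lemma gluing_gap_le:
  assumes "x' \<in> mspace X" "y' \<in> mspace Y" "R x' y'"
  shows "gluing_gap X Y R x y \<le> mdist X x x' + mdist Y y' y"
  unfolding gluing_gap_def
proof (rule cINF_lower2[of _ _ "(x', y')"])
  show "bdd_below ((\<lambda>(x', y'). mdist X x x' + mdist Y y' y) ` {(x', y'). x' \<in> mspace X \<and> y' \<in> mspace Y \<and> R x' y'})"
    by (rule bdd_belowI2[of _ 0]) auto
qed (use assms in auto)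

lemma gluing_gap_greatest:
  assumes "x' \<in> mspace X" "y' \<in> mspace Y" "R x' y'"
    and "\<And>x' y'. x' \<in> mspace X \<Longrightarrow> y' \<in> mspace Y \<Longrightarrow> R x' y' \<Longrightarrow> t \<le> mdist X x x' + mdist Y y' y"
  shows "t \<le> gluing_gap X Y R x y"
  unfolding gluing_gap_def by (rule cINF_greatest) (use assms in auto)

text \<open>The jump is half the distortion: a route that leaves a space and returns jumps twice,
  and the cost \<open>2 * e\<close> makes up for what it may gain in the other space. Since
  \<open>e\<close> is positive, no two points of different spaces get distance zero.\<close>

lemma gh_close_admissible:
  fixes X :: "'a metric" and Y :: "'b metric"
  assumes close: "gh_close (2 * e) X Y" and "0 < e" and ne: "mspace X \<noteq> {}"
  obtains D where "admissible_metric X Y D" "hausdorff_dist D (Inl ` mspace X) (Inr ` mspace Y) \<le> e"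
proof -
  obtain R where R1: "\<forall>x\<in>mspace X. \<exists>y\<in>mspace Y. R x y" and R2: "\<forall>y\<in>mspace Y. \<exists>x\<in>mspace X. R x y"
    and R3: "\<And>x x' y y'. x \<in> mspace X \<Longrightarrow> x' \<in> mspace X \<Longrightarrow> y \<in> mspace Y \<Longrightarrow> y' \<in> mspace Y \<Longrightarrow>
       R x y \<Longrightarrow> R x' y' \<Longrightarrow> \<bar>mdist X x x' - mdist Y y y'\<bar> \<le> 2 * e"
    using close unfolding gh_close_def by blast
  obtain x0 y0 where R0: "x0 \<in> mspace X" "y0 \<in> mspace Y" "R x0 y0"
    using ne R1 by blast
  let ?g = "gluing_gap X Y R" and ?D = "gluing_metric e X Y R"
  have g0: "0 \<le> ?g x y" for x y
    by (rule gluing_gap_greatest[where R = R, OF R0]) simp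
  have gX: "?g x y \<le> mdist X x x1 + ?g x1 y" if x: "x \<in> mspace X" "x1 \<in> mspace X" for x x1 y
  proof -
    have "?g x y - mdist X x x1 \<le> ?g x1 y"
    proof (rule gluing_gap_greatest[where R = R, OF R0])
      fix x' y' assume *: "x' \<in> mspace X" "y' \<in> mspace Y" "R x' y'"
      show "?g x y - mdist X x x1 \<le> mdist X x1 x' + mdist Y y' y"
        using gluing_gap_le[where R = R, OF *, of x y] mdist_triangle[OF x *(1)] by linarith
    qed
    then show ?thesis by simp
  qed
  have gY: "?g x y \<le> ?g x y1 + mdist Y y1 y" if y: "y \<in> mspace Y" "y1 \<in> mspace Y" for x y y1
  proof -
    have "?g x y - mdist Y y1 y \<le> ?g x y1"
    proof (rule gluing_gap_greatest[where R = R, OF R0])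
      fix x' y' assume *: "x' \<in> mspace X" "y' \<in> mspace Y" "R x' y'"
      show "?g x y - mdist Y y1 y \<le> mdist X x x' + mdist Y y' y1"
        using gluing_gap_le[where R = R, OF *, of x y] mdist_triangle[OF *(2) y(2,1)] by linarith
    qed
    then show ?thesis by simp
  qed
  have dX: "mdist X x x1 \<le> 2 * e + (?g x y + ?g x1 y)" if x: "x \<in> mspace X" "x1 \<in> mspace X" "y \<in> mspace Y" for x x1 y
  proof -
    have "mdist X x x1 - 2 * e - ?g x y \<le> ?g x1 y"
    proof (rule gluing_gap_greatest[where R = R, OF R0])
      fix x' y' assume *: "x' \<in> mspace X" "y' \<in> mspace Y" "R x' y'"
      have "mdist X x x1 - 2 * e - (mdist X x1 x' + mdist Y y' y) \<le> ?g x y"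
      proof (rule gluing_gap_greatest[where R = R, OF R0])
        fix x'' y'' assume **: "x'' \<in> mspace X" "y'' \<in> mspace Y" "R x'' y''"
        have "mdist X x x1 \<le> mdist X x x'' + mdist X x'' x1" "mdist X x'' x1 \<le> mdist X x'' x' + mdist X x' x1"
          using x * ** by (auto intro!: mdist_triangle)
        moreover have "mdist Y y'' y' \<le> mdist Y y'' y + mdist Y y y'"
          using x * ** by (auto intro!: mdist_triangle)
        moreover have "\<bar>mdist X x'' x' - mdist Y y'' y'\<bar> \<le> 2 * e"
          using R3 * ** by blast
        ultimately show "mdist X x x1 - 2 * e - (mdist X x1 x' + mdist Y y' y) \<le> mdist X x x'' + mdist Y y'' y"
          using mdist_commute[of X x' x1] mdist_commute[of Y y' y] by linarith
      qed
      then show "mdist X x x1 - 2 * e - ?g x y \<le> mdist X x1 x' + mdist Y y' y"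
        by linarith
    qed
    then show ?thesis by linarith
  qed
  have dY: "mdist Y y y1 \<le> 2 * e + (?g x y + ?g x y1)" if y: "y \<in> mspace Y" "y1 \<in> mspace Y" "x \<in> mspace X" for x y y1
  proof -
    have "mdist Y y y1 - 2 * e - ?g x y \<le> ?g x y1"
    proof (rule gluing_gap_greatest[where R = R, OF R0])
      fix x' y' assume *: "x' \<in> mspace X" "y' \<in> mspace Y" "R x' y'"
      have "mdist Y y y1 - 2 * e - (mdist X x x' + mdist Y y' y1) \<le> ?g x y"
      proof (rule gluing_gap_greatest[where R = R, OF R0])
        fix x'' y'' assume **: "x'' \<in> mspace X" "y'' \<in> mspace Y" "R x'' y''"
        have "mdist Y y y1 \<le> mdist Y y y'' + mdist Y y'' y1" "mdist Y y'' y1 \<le> mdist Y y'' y' + mdist Y y' y1"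
          using y * ** by (auto intro!: mdist_triangle)
        moreover have "mdist X x'' x' \<le> mdist X x'' x + mdist X x x'"
          using y * ** by (auto intro!: mdist_triangle)
        moreover have "\<bar>mdist X x'' x' - mdist Y y'' y'\<bar> \<le> 2 * e"
          using R3 * ** by blast
        ultimately show "mdist Y y y1 - 2 * e - (mdist X x x' + mdist Y y' y1) \<le> mdist X x x'' + mdist Y y'' y"
          using mdist_commute[of X x'' x] mdist_commute[of Y y'' y] by linarith
      qed
      then show "mdist Y y y1 - 2 * e - ?g x y \<le> mdist X x x' + mdist Y y' y1"
        by linarith
    qed
    then show ?thesis by linarith
  qed
  have "Metric_space (mspace X <+> mspace Y) ?D"
  proof
    show "0 \<le> ?D u v" for u v
      using g0 \<open>0 < e\<close> by (cases u; cases v) (auto intro!: add_nonneg_nonneg)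
    show "?D u v = ?D v u" for u v
      by (cases u; cases v) (auto simp: mdist_commute)
    show "?D u v = 0 \<longleftrightarrow> u = v" if uv: "u \<in> mspace X <+> mspace Y" "v \<in> mspace X <+> mspace Y" for u v
    proof -
      have "e + ?g x y \<noteq> 0" for x y
        using g0[of x y] \<open>0 < e\<close> by linarith
      then show ?thesis
        using uv by auto
    qed
    show "?D u w \<le> ?D u v + ?D v w"
      if uvw: "u \<in> mspace X <+> mspace Y" "v \<in> mspace X <+> mspace Y" "w \<in> mspace X <+> mspace Y" for u v w
    proof -
      consider x x' x'' where "u = Inl x" "v = Inl x'" "w = Inl x''" "x \<in> mspace X" "x' \<in> mspace X" "x'' \<in> mspace X"
        | x x' y where "u = Inl x" "v = Inl x'" "w = Inr y" "x \<in> mspace X" "x' \<in> mspace X" "y \<in> mspace Y"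
        | x x' y where "u = Inl x" "v = Inr y" "w = Inl x'" "x \<in> mspace X" "x' \<in> mspace X" "y \<in> mspace Y"
        | x y y' where "u = Inl x" "v = Inr y" "w = Inr y'" "x \<in> mspace X" "y \<in> mspace Y" "y' \<in> mspace Y"
        | x x' y where "u = Inr y" "v = Inl x" "w = Inl x'" "x \<in> mspace X" "x' \<in> mspace X" "y \<in> mspace Y"
        | x y y' where "u = Inr y" "v = Inl x" "w = Inr y'" "x \<in> mspace X" "y \<in> mspace Y" "y' \<in> mspace Y"
        | x y y' where "u = Inr y" "v = Inr y'" "w = Inl x" "x \<in> mspace X" "y \<in> mspace Y" "y' \<in> mspace Y"
        | y y' y'' where "u = Inr y" "v = Inr y'" "w = Inr y''" "y \<in> mspace Y" "y' \<in> mspace Y" "y'' \<in> mspace Y"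
        using uvw by (cases u; cases v; cases w) auto
      then show ?thesis
      proof cases
        case 1 then show ?thesis by (simp add: mdist_triangle)
      next
        case (2 x x' y) then show ?thesis using gX[of x x' y] by simp
      next
        case (3 x x' y) then show ?thesis using dX[of x x' y] by simp
      next
        case (4 x y y') then show ?thesis using gY[of y' y x] by simp
      next
        case (5 x x' y) then show ?thesis using gX[of x' x y] by (simp add: mdist_commute)
      next
        case (6 x y y') then show ?thesis using dY[of y y' x] by simp
      next
        case (7 x y y') then show ?thesis using gY[of y y' x] by (simp add: mdist_commute)
      next
        case 8 then show ?thesis by (simp add: mdist_triangle)
      qed
    qed
  qed
  then have "admissible_metric X Y ?D"
    by (simp add: admissible_metric_def)
  moreover have "hausdorff_dist ?D (Inl ` mspace X) (Inr ` mspace Y) \<le> e"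
  \<comment> \<open>Related points have distance at most \<open>e\<close>, whereas
    \<open>hausdorff_dist\<close> asks for strict inequality; so only numbers above \<open>e\<close>
    are known to belong to its set.\<close>
  proof (rule dense_ge)
    fix e' assume "e < e'"
    have less: "?D (Inl x) (Inr y) < e'" if "x \<in> mspace X" "y \<in> mspace Y" "R x y" for x y
      using gluing_gap_le[where R = R, OF that, of x y] that \<open>e < e'\<close> by (simp add: mdist_refl)
    show "hausdorff_dist ?D (Inl ` mspace X) (Inr ` mspace Y) \<le> e'"
      unfolding hausdorff_dist_def
    proof (rule cInf_lower)
      have "\<forall>x\<in>Inl ` mspace X. \<exists>y\<in>Inr ` mspace Y. ?D x y < e'"
        using R1 less by blast
      moreover have "\<forall>y\<in>Inr ` mspace Y. \<exists>x\<in>Inl ` mspace X. ?D x y < e'"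
        using R2 less by blast
      ultimately show "e' \<in> {e. 0 < e \<and> (\<forall>x\<in>Inl ` mspace X. \<exists>y\<in>Inr ` mspace Y. ?D x y < e) \<and>
          (\<forall>y\<in>Inr ` mspace Y. \<exists>x\<in>Inl ` mspace X. ?D x y < e)}"
        using \<open>0 < e\<close> \<open>e < e'\<close> by simp
    qed (auto intro: bdd_belowI[of _ 0])
  qed
  ultimately show ?thesis by (rule that)
qed

text \<open>The real infimum in \<open>hausdorff_dist\<close> has its intended meaning only for a
  nonempty set; bounded diameters supply an element.\<close>

lemma hausdorff_set_nonempty:
  assumes X: "compact_metric X" and Y: "compact_metric Y" and D: "admissible_metric X Y D"
  shows "{e. 0 < e \<and> (\<forall>x\<in>Inl ` mspace X. \<exists>y\<in>Inr ` mspace Y. D x y < e) \<and>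
    (\<forall>y\<in>Inr ` mspace Y. \<exists>x\<in>Inl ` mspace X. D x y < e)} \<noteq> {}"
proof -
  interpret Metric_space "mspace X <+> mspace Y" D
    using D by (simp add: admissible_metric_def)
  obtain B where B: "\<And>x y. x \<in> mspace X \<Longrightarrow> y \<in> mspace X \<Longrightarrow> mdist X x y \<le> B"
    using compact_metric_bounded[OF X] by blast
  obtain C where C: "\<And>x y. x \<in> mspace Y \<Longrightarrow> y \<in> mspace Y \<Longrightarrow> mdist Y x y \<le> C"
    using compact_metric_bounded[OF Y] by blast
  obtain x0 y0 where 0: "x0 \<in> mspace X" "y0 \<in> mspace Y"
    using X Y by (auto simp: compact_metric_def)
  define e where "e = \<bar>B\<bar> + \<bar>C\<bar> + D (Inl x0) (Inr y0) + 1"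
  have "0 < e"
    using nonneg[of "Inl x0" "Inr y0"] unfolding e_def by linarith
  have less: "D (Inl x) (Inr y) < e" if "x \<in> mspace X" "y \<in> mspace Y" for x y
  proof -
    have "D (Inl x) (Inr y) \<le> D (Inl x) (Inl x0) + D (Inl x0) (Inr y)"
      "D (Inl x0) (Inr y) \<le> D (Inl x0) (Inr y0) + D (Inr y0) (Inr y)"
      using 0 that by (auto intro!: triangle)
    moreover have "D (Inl x) (Inl x0) \<le> B" "D (Inr y0) (Inr y) \<le> C"
      using D B C 0 that by (auto simp: admissible_metric_def)
    ultimately show ?thesis
      unfolding e_def by linarith
  qed
  then have "\<forall>x\<in>Inl ` mspace X. \<exists>y\<in>Inr ` mspace Y. D x y < e" "\<forall>y\<in>Inr ` mspace Y. \<exists>x\<in>Inl ` mspace X. D x y < e"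
    using 0 by auto
  then show ?thesis
    using \<open>0 < e\<close> by blast
qed

lemma gh_dist_bdd_below:
  assumes "compact_metric X" "compact_metric Y"
  shows "bdd_below {hausdorff_dist D (Inl ` mspace X) (Inr ` mspace Y) | D. admissible_metric X Y D}"
proof (rule bdd_belowI[of _ 0], clarify)
  fix D assume "admissible_metric X Y D"
  from hausdorff_set_nonempty[OF assms this]
  show "0 \<le> hausdorff_dist D (Inl ` mspace X) (Inr ` mspace Y)"
    unfolding hausdorff_dist_def by (rule cInf_greatest) auto
qed

lemma gh_dist_le:
  assumes "compact_metric X" "compact_metric Y" "gh_close (2 * e) X Y" "0 < e"
  shows "gh_dist X Y \<le> e"
proof -
  obtain D where D: "admissible_metric X Y D" "hausdorff_dist D (Inl ` mspace X) (Inr ` mspace Y) \<le> e"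
    using gh_close_admissible[OF assms(3,4)] assms(1) by (auto simp: compact_metric_def)
  have "gh_dist X Y \<le> hausdorff_dist D (Inl ` mspace X) (Inr ` mspace Y)"
    unfolding gh_dist_def by (rule cInf_lower[OF _ gh_dist_bdd_below[OF assms(1,2)]]) (use D in blast)
  with D show ?thesis by simp
qed

lemma gh_dist_nonneg:
  assumes "compact_metric X" "compact_metric Y" "\<exists>D. admissible_metric X Y D"
  shows "0 \<le> gh_dist X Y"
  unfolding gh_dist_def
proof (rule cInf_greatest, use assms in blast, clarify)
  fix D assume "admissible_metric X Y D"
  from hausdorff_set_nonempty[OF assms(1,2) this]
  show "0 \<le> hausdorff_dist D (Inl ` mspace X) (Inr ` mspace Y)"
    unfolding hausdorff_dist_def by (rule cInf_greatest) auto
qed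

lemma gh_dist_same:
  assumes "compact_metric X"
  shows "gh_dist X X = 0"
proof (rule antisym)
  have close: "gh_close (2 * e) X X" if "0 < e" for e
    by (rule gh_close_mono[OF gh_close_refl]) (use that in simp)
  show "gh_dist X X \<le> 0"
    by (rule dense_ge) (rule gh_dist_le[OF assms assms close])
  have "\<exists>D. admissible_metric X X D"
    using gh_close_admissible[OF close[of 1]] assms by (metis compact_metric_def zero_less_one)
  then show "0 \<le> gh_dist X X"
    by (intro gh_dist_nonneg assms)
qed

text \<open>Points that are close in a common admissible metric form the correspondence: exchanging
  both ends of a distance for related points changes it by less than \<open>2 * e\<close>.\<close>

lemma gh_close_if_gh_dist_less:
  fixes X :: "'a metric" and Y :: "'b metric"
  assumes X: "compact_metric X" and Y: "compact_metric Y" and less: "gh_dist X Y < e"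
  shows "gh_close (2 * e) X Y"
proof -
  obtain B where B: "\<And>x y. x \<in> mspace X \<Longrightarrow> y \<in> mspace X \<Longrightarrow> mdist X x y \<le> B"
    using compact_metric_bounded[OF X] by blast
  obtain C where C: "\<And>x y. x \<in> mspace Y \<Longrightarrow> y \<in> mspace Y \<Longrightarrow> mdist Y x y \<le> C"
    using compact_metric_bounded[OF Y] by blast
  \<comment> \<open>The full relation, with its crude distortion, only shows that some admissible
    metric exists, so that the infimum in \<open>gh_dist\<close> is over a nonempty set.\<close>
  have "gh_close (2 * (\<bar>B\<bar> + \<bar>C\<bar> + 1)) X Y"
    unfolding gh_close_def
  proof (intro exI[of _ "\<lambda>_ _. True"] conjI ballI impI)
    fix x x' y y' assume *: "x \<in> mspace X" "x' \<in> mspace X" "y \<in> mspace Y" "y' \<in> mspace Y"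
    show "\<bar>mdist X x x' - mdist Y y y'\<bar> \<le> 2 * (\<bar>B\<bar> + \<bar>C\<bar> + 1)"
      using B[OF *(1,2)] C[OF *(3,4)] mdist_nonneg[of X x x'] mdist_nonneg[of Y y y']
      by argo
  qed (use X Y in \<open>auto simp: compact_metric_def\<close>)
  moreover have "0 < \<bar>B\<bar> + \<bar>C\<bar> + 1" "mspace X \<noteq> {}"
    using X by (auto simp: compact_metric_def)
  ultimately obtain D0 where "admissible_metric X Y D0"
    using gh_close_admissible[of "\<bar>B\<bar> + \<bar>C\<bar> + 1" X Y] by blast
  then have "{hausdorff_dist D (Inl ` mspace X) (Inr ` mspace Y) | D. admissible_metric X Y D} \<noteq> {}"
    by blast
  from cInf_lessD[OF this less[unfolded gh_dist_def]]
  obtain D where D: "admissible_metric X Y D" "hausdorff_dist D (Inl ` mspace X) (Inr ` mspace Y) < e"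
    by blast
  from cInf_lessD[OF hausdorff_set_nonempty[OF X Y D(1)] D(2)[unfolded hausdorff_dist_def]]
  obtain e' where e': "e' < e" "\<forall>x\<in>Inl ` mspace X. \<exists>y\<in>Inr ` mspace Y. D x y < e'"
    "\<forall>y\<in>Inr ` mspace Y. \<exists>x\<in>Inl ` mspace X. D x y < e'"
    by blast
  interpret Metric_space "mspace X <+> mspace Y" D
    using D by (simp add: admissible_metric_def)
  show ?thesis
    unfolding gh_close_def
  proof (intro exI[of _ "\<lambda>x y. D (Inl x) (Inr y) < e'"] conjI)
    show "\<forall>x\<in>mspace X. \<exists>y\<in>mspace Y. D (Inl x) (Inr y) < e'"
      "\<forall>y\<in>mspace Y. \<exists>x\<in>mspace X. D (Inl x) (Inr y) < e'"
      using e' by simp_all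
    show "\<forall>x\<in>mspace X. \<forall>x'\<in>mspace X. \<forall>y\<in>mspace Y. \<forall>y'\<in>mspace Y.
       D (Inl x) (Inr y) < e' \<and> D (Inl x') (Inr y') < e' \<longrightarrow> \<bar>mdist X x x' - mdist Y y y'\<bar> \<le> 2 * e"
    proof (intro ballI impI)
      fix x x' y y'
      assume m: "x \<in> mspace X" "x' \<in> mspace X" "y \<in> mspace Y" "y' \<in> mspace Y"
        and l: "D (Inl x) (Inr y) < e' \<and> D (Inl x') (Inr y') < e'"
      have "D (Inl x) (Inl x') \<le> D (Inl x) (Inr y) + D (Inr y) (Inl x')"
        "D (Inr y) (Inl x') \<le> D (Inr y) (Inr y') + D (Inr y') (Inl x')"
        "D (Inr y) (Inr y') \<le> D (Inr y) (Inl x) + D (Inl x) (Inr y')"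
        "D (Inl x) (Inr y') \<le> D (Inl x) (Inl x') + D (Inl x') (Inr y')"
        using m by (auto intro!: triangle)
      moreover have "D (Inl x) (Inl x') = mdist X x x'" "D (Inr y) (Inr y') = mdist Y y y'"
        using D m by (auto simp: admissible_metric_def)
      ultimately show "\<bar>mdist X x x' - mdist Y y y'\<bar> \<le> 2 * e"
        using l e'(1) commute[of "Inr y" "Inl x"] commute[of "Inr y'" "Inl x'"] by linarith
    qed
  qed
qed

text \<open>The room left by \<open>e' < e\<close> absorbs the distortion \<open>2 * h\<close> of a
  further correspondence. Composing correspondences thus takes the place of a triangle inequality
  for \<open>gh_dist\<close>.\<close>

lemma gh_openin_gh_close:
  assumes X: "compact_metric X"
  shows "gh_openin {Y. compact_metric Y \<and> (\<exists>e'<e. gh_close e' X Y)}"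
  unfolding gh_openin_def
proof (intro conjI ballI)
  fix Y assume "Y \<in> {Y. compact_metric Y \<and> (\<exists>e'<e. gh_close e' X Y)}"
  then obtain e' where Y: "compact_metric Y" "e' < e" "gh_close e' X Y"
    by blast
  define h where "h = (e - e') / 4"
  have "0 < h" "e' + 2 * h < e"
    using Y(2) by (auto simp: h_def field_simps)
  moreover have "gh_close (e' + 2 * h) X Z" if "compact_metric Z" "gh_dist Y Z < h" for Z
    by (rule gh_close_trans[OF Y(3) gh_close_if_gh_dist_less[OF Y(1) that]])
  ultimately show "\<exists>h>0. \<forall>Z. compact_metric Z \<and> gh_dist Y Z < h \<longrightarrow>
      Z \<in> {Y. compact_metric Y \<and> (\<exists>e'<e. gh_close e' X Y)}"
    by blast
qed auto

text \<open>Finitely many of the neighbourhoods on which \<open>local\<close> gives \<open>Q\<close>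
  cover the closure. As \<open>Q\<close> passes to smaller parameters, the least of their radii
  serves all of \<open>S\<close>, which lies in its closure by constant sequences.\<close>

lemma gh_precompact_uniform:
  fixes S :: "'a metric set"
  assumes pre: "gh_precompact S" and S: "S \<subseteq> Collect compact_metric"
    and local: "\<And>X. X \<in> gh_closure S \<Longrightarrow> \<exists>e>0. \<forall>Y\<in>S. gh_close e X Y \<longrightarrow> Q e Y"
    and anti: "\<And>e e' Y. Q e Y \<Longrightarrow> 0 < e' \<Longrightarrow> e' \<le> e \<Longrightarrow> Q e' Y"
  shows "\<exists>e>0. \<forall>Y\<in>S. Q e Y"
proof -
  obtain r where r: "\<And>X. X \<in> gh_closure S \<Longrightarrow> 0 < r X" "\<And>X Y. X \<in> gh_closure S \<Longrightarrow> Y \<in> S \<Longrightarrow> gh_close (r X) X Y \<Longrightarrow> Q (r X) Y"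
    using local by metis
  define U :: "'a metric \<Rightarrow> 'a metric set" where "U X = {Y. compact_metric Y \<and> (\<exists>e'<r X. gh_close e' X Y)}" for X
  have compact: "compact_metric X" if "X \<in> gh_closure S" for X
    using that by (simp add: gh_closure_def)
  have "\<exists>\<F>. finite \<F> \<and> \<F> \<subseteq> U ` gh_closure S \<and> gh_closure S \<subseteq> \<Union>\<F>"
  proof (rule compactinD[OF pre[unfolded gh_precompact_def]])
    show "openin gh_topology V" if "V \<in> U ` gh_closure S" for V
      using that compact gh_openin_gh_close by (auto simp: openin_gh_topology U_def)
    show "gh_closure S \<subseteq> \<Union>(U ` gh_closure S)"
      using compact r(1) gh_close_refl unfolding U_def by blast
  qed
  then obtain F where F: "finite F" "F \<subseteq> gh_closure S" "gh_closure S \<subseteq> \<Union>(U ` F)"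
    by (metis finite_subset_image)
  \<comment> \<open>The element \<open>1\<close> keeps the minimum meaningful for empty
    \<open>F\<close>.\<close>
  define e where "e = Min (insert 1 (r ` F))"
  have "0 < e"
    unfolding e_def using F r(1) by (subst Min_gr_iff) auto
  moreover have "Q e Y" if "Y \<in> S" for Y
  proof -
    have "compact_metric Y"
      using S that by blast
    then have "Y \<in> gh_closure S"
      using that unfolding gh_closure_def by (auto intro!: exI[of _ "\<lambda>_. Y"] simp: gh_dist_same)
    then obtain X where X: "X \<in> F" "Y \<in> U X"
      using F(3) by blast
    then obtain e' where "e' < r X" "gh_close e' X Y"
      by (auto simp: U_def)
    then have "Q (r X) Y"
      using r(2)[of X Y] X F(2) that gh_close_mono[of e' X Y "r X"] by auto
    moreover have "e \<le> r X"
      unfolding e_def using F(1) X(1) by (intro Min_le) auto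
    ultimately show "Q e Y"
      using anti \<open>0 < e\<close> by blast
  qed
  ultimately show ?thesis by blast
qed

section \<open>Excess and tight covers of compact spaces\<close>

text \<open>The real supremum in \<open>excess\<close> can be used as a least upper bound only once
  some upper bound is known.\<close>

lemma bdd_above_excess:
  assumes "compact_metric X" "p \<in> mspace X" "q \<in> mspace X"
  shows "bdd_above ((\<lambda>x. mdist X p x + mdist X x q - mdist X p q) ` mspace X)"
proof -
  obtain B where B: "\<And>x y. x \<in> mspace X \<Longrightarrow> y \<in> mspace X \<Longrightarrow> mdist X x y \<le> B"
    using compact_metric_bounded[OF assms(1)] by blast
  show ?thesis
  proof (rule bdd_aboveI2)
    fix x assume x: "x \<in> mspace X"
    show "mdist X p x + mdist X x q - mdist X p q \<le> 2 * B"
      using B[OF assms(2) x] B[OF x assms(3)] mdist_nonneg[of X p q] by linarith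
  qed
qed

lemma excess_le:
  assumes X: "compact_metric X" and ab: "a \<in> mspace X" "b \<in> mspace X"
    and le: "\<And>x. x \<in> mspace X \<Longrightarrow> mdist X a x + mdist X x b - mdist X a b \<le> t"
  shows "excess X \<le> t"
  unfolding excess_def
proof (rule cINF_lower2[of _ _ "(a, b)"])
  show "(a, b) \<in> mspace X \<times> mspace X"
    using ab by simp
  show "(case (a, b) of (p, q) \<Rightarrow> SUP x\<in>mspace X. mdist X p x + mdist X x q - mdist X p q) \<le> t"
    using ab le by (auto intro!: cSUP_least)
  show "bdd_below ((\<lambda>(p, q). SUP x\<in>mspace X. mdist X p x + mdist X x q - mdist X p q) ` (mspace X \<times> mspace X))"
  proof (rule bdd_belowI2[of _ 0], clarify)
    fix p q assume pq: "p \<in> mspace X" "q \<in> mspace X"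
    show "0 \<le> (SUP x\<in>mspace X. mdist X p x + mdist X x q - mdist X p q)"
      by (rule cSUP_upper2[OF bdd_above_excess[OF X pq] pq(1)]) (use pq in auto)
  qed
qed

lemma excess_lessE:
  assumes X: "compact_metric X" and less: "excess X < t"
  obtains p q where "p \<in> mspace X" "q \<in> mspace X"
    "\<And>x. x \<in> mspace X \<Longrightarrow> mdist X p x + mdist X x q - mdist X p q < t"
proof -
  have "(\<lambda>(p, q). SUP x\<in>mspace X. mdist X p x + mdist X x q - mdist X p q) ` (mspace X \<times> mspace X) \<noteq> {}"
    using X by (auto simp: compact_metric_def)
  from cInf_lessD[OF this less[unfolded excess_def]]
  obtain p q where pq: "p \<in> mspace X" "q \<in> mspace X"
    "(SUP x\<in>mspace X. mdist X p x + mdist X x q - mdist X p q) < t"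
    by auto
  show ?thesis
  proof (rule that[OF pq(1,2)])
    fix x assume "x \<in> mspace X"
    from cSUP_upper[OF this bdd_above_excess[OF X pq(1,2)]] pq(3)
    show "mdist X p x + mdist X x q - mdist X p q < t" by linarith
  qed
qed

lemma tightly_covered_mono:
  assumes "tightly_covered e X" "e \<le> e'"
  shows "tightly_covered e' X"
proof -
  obtain p q r where *: "p \<in> mspace X" "q \<in> mspace X" "r > 0" "mdist X p q = 2 * r"
    "mspace X = mball_of X p (r + e) \<union> mball_of X q (r + e)"
    using assms(1) unfolding tightly_covered_def by blast
  have "mspace X = mball_of X p (r + e') \<union> mball_of X q (r + e')"
  proof
    show "mspace X \<subseteq> mball_of X p (r + e') \<union> mball_of X q (r + e')"
    proof
      fix x assume "x \<in> mspace X"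
      then have "x \<in> mball_of X p (r + e) \<union> mball_of X q (r + e)"
        using *(5) by blast
      then show "x \<in> mball_of X p (r + e') \<union> mball_of X q (r + e')"
        using assms(2) by auto
    qed
  qed auto
  then show ?thesis
    using * unfolding tightly_covered_def by blast
qed

lemma excess_less_imp_tightly_covered:
  assumes X: "compact_metric X" and two: "x0 \<in> mspace X" "x1 \<in> mspace X" "x0 \<noteq> x1"
    and less: "excess X < e"
  shows "tightly_covered e X"
proof -
  obtain p q where pq: "p \<in> mspace X" "q \<in> mspace X"
    and ex: "\<And>x. x \<in> mspace X \<Longrightarrow> mdist X p x + mdist X x q - mdist X p q < e"
    using excess_lessE[OF X less] by blast
  have pos: "0 < e"
    using ex[OF pq(1)] pq by (simp add: mdist_refl)
  obtain q' where q': "q' \<in> mspace X" "q' \<noteq> p" and cov: "\<And>x. x \<in> mspace X \<Longrightarrow>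
     mdist X p x < mdist X p q' / 2 + e \<or> mdist X q' x < mdist X p q' / 2 + e"
  \<comment> \<open>A tight cover has distinct centres. For \<open>q = p\<close> the bound reads
    \<open>2 * mdist X p x < e\<close>, so the ball around \<open>p\<close> alone covers the space,
    whatever second centre is taken.\<close>
  proof (cases "q = p")
    case False
    have "mdist X p x < mdist X p q / 2 + e \<or> mdist X q x < mdist X p q / 2 + e" if "x \<in> mspace X" for x
      using ex[OF that] pos mdist_commute[of X q x] by argo
    then show ?thesis
      using that pq False by blast
  next
    case True
    obtain q' where q': "q' \<in> mspace X" "q' \<noteq> p"
      using two by blast
    have "mdist X p x < mdist X p q' / 2 + e" if "x \<in> mspace X" for x
      using ex[OF that, unfolded True] mdist_refl[OF pq(1)] mdist_nonneg[of X p q'] mdist_commute[of X p x]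
        mdist_nonneg[of X p x] by argo
    then show ?thesis
      using that q' by blast
  qed
  have "0 < mdist X p q'"
    using q' pq by (simp add: less_le)
  then have "0 < mdist X p q' / 2" by simp
  moreover have "mdist X p q' = 2 * (mdist X p q' / 2)"
    by simp
  moreover have "mspace X = mball_of X p (mdist X p q' / 2 + e) \<union> mball_of X q' (mdist X p q' / 2 + e)"
  proof (intro equalityI subsetI)
    fix x assume x: "x \<in> mspace X"
    then show "x \<in> mball_of X p (mdist X p q' / 2 + e) \<union> mball_of X q' (mdist X p q' / 2 + e)"
      using cov[OF x] pq q' by auto
  qed auto
  ultimately show ?thesis
    unfolding tightly_covered_def using pq(1) q'(1) by blast
qed

text \<open>Otherwise there are centres \<open>p n\<close>, \<open>q n\<close> whose balls cover
  with margins tending to zero. Along a subsequence the centres converge; a point left uncovered for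
  the limit centres stays uncovered for late members of the subsequence.\<close>

lemma uncovered_uniform:
  assumes X: "compact_metric X"
    and unc: "\<And>p q. p \<in> mspace X \<Longrightarrow> q \<in> mspace X \<Longrightarrow>
      \<exists>x\<in>mspace X. mdist X p q / 2 < mdist X p x \<and> mdist X p q / 2 < mdist X q x"
  obtains t where "0 < t" "\<And>p q. p \<in> mspace X \<Longrightarrow> q \<in> mspace X \<Longrightarrow>
      \<exists>x\<in>mspace X. mdist X p q / 2 + t \<le> mdist X p x \<and> mdist X p q / 2 + t \<le> mdist X q x"
proof (rule ccontr)
  assume no: "\<not> thesis"
  interpret Metric_space "mspace X" "mdist X"
    by (rule Metric_space_mspace_mdist)
  have "\<exists>p q. p \<in> mspace X \<and> q \<in> mspace X \<and> (\<forall>x\<in>mspace X.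
      mdist X p x < mdist X p q / 2 + 1 / real (Suc n) \<or> mdist X q x < mdist X p q / 2 + 1 / real (Suc n))" for n
    using no that[of "1 / real (Suc n)"] by (force simp: not_le)
  then obtain p q where p: "\<And>n. p n \<in> mspace X" and q: "\<And>n. q n \<in> mspace X"
    and pq: "\<And>n x. x \<in> mspace X \<Longrightarrow>
      mdist X (p n) x < mdist X (p n) (q n) / 2 + 1 / real (Suc n) \<or>
      mdist X (q n) x < mdist X (p n) (q n) / 2 + 1 / real (Suc n)"
    by metis
  have seq: "\<exists>l r. l \<in> mspace X \<and> strict_mono (r :: nat \<Rightarrow> nat) \<and> limitin mtopology (s \<circ> r) l sequentially"
    if "\<And>n. s n \<in> mspace X" for s :: "nat \<Rightarrow> 'a"
    using X that unfolding compact_metric_def mtopology_of_def compact_space_sequentially by blast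
  obtain l r where l: "l \<in> mspace X" "strict_mono r" "limitin mtopology (p \<circ> r) l sequentially"
    using seq[of p] p by blast
  obtain k r' where k: "k \<in> mspace X" "strict_mono r'" "limitin mtopology (q \<circ> r \<circ> r') k sequentially"
    using seq[of "q \<circ> r"] q by auto
  have lim_p: "limitin mtopology (p \<circ> r \<circ> r') l sequentially"
    by (rule limitin_subsequence[OF k(2) l(3)])
  obtain x where x: "x \<in> mspace X" "mdist X l k / 2 < mdist X l x" "mdist X l k / 2 < mdist X k x"
    using unc[OF l(1) k(1)] by blast
  \<comment> \<open>The margin by which \<open>x\<close> is missed. The margin of the cover, the
    shift of a centre and half the shift of the distance of the centres each cost less than
    \<open>h / 4\<close>, altogether less than \<open>h\<close>.\<close>
  define h where "h = min (mdist X l x) (mdist X k x) - mdist X l k / 2"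
  have "0 < h"
    using x by (simp add: h_def)
  have near: "eventually (\<lambda>n. mdist X (s n) a < h / 4) sequentially"
    if "limitin mtopology s a sequentially" for s a
  proof -
    have "eventually (\<lambda>n. s n \<in> mspace X \<and> mdist X (s n) a < h / 4) sequentially"
      using that \<open>0 < h\<close> unfolding limitin_metric by (meson divide_pos_pos zero_less_numeral)
    then show ?thesis
      by (rule eventually_mono) simp
  qed
  have "eventually (\<lambda>n. 1 / real (Suc n) < h / 4) sequentially"
    using \<open>0 < h\<close> by (intro order_tendstoD[OF lim_1_over_n[THEN LIMSEQ_Suc]]) simp
  moreover have "eventually (\<lambda>n. mdist X ((p \<circ> r \<circ> r') n) l < h / 4) sequentially"
    by (rule near[OF lim_p])
  moreover have "eventually (\<lambda>n. mdist X ((q \<circ> r \<circ> r') n) k < h / 4) sequentially"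
    by (rule near[OF k(3)])
  ultimately have "eventually (\<lambda>n. 1 / real (Suc n) < h / 4 \<and> mdist X ((p \<circ> r \<circ> r') n) l < h / 4 \<and>
      mdist X ((q \<circ> r \<circ> r') n) k < h / 4) sequentially"
    by eventually_elim simp
  then obtain n where n: "1 / real (Suc n) < h / 4" "mdist X (p (r (r' n))) l < h / 4"
    "mdist X (q (r (r' n))) k < h / 4"
    by (auto simp: eventually_sequentially)
  define m where "m = r (r' n)"
  have "n \<le> m"
    unfolding m_def using seq_suble[OF l(2)] seq_suble[OF k(2)] le_trans by blast
  then have "1 / real (Suc m) \<le> 1 / real (Suc n)"
    by (simp add: frac_le)
  moreover have "mdist X (p m) (q m) \<le> mdist X (p m) l + mdist X l (q m)"
    "mdist X l (q m) \<le> mdist X l k + mdist X k (q m)"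
    "mdist X l x \<le> mdist X l (p m) + mdist X (p m) x"
    "mdist X k x \<le> mdist X k (q m) + mdist X (q m) x"
    using p q l(1) k(1) x(1) by (auto intro!: triangle)
  moreover have "mdist X l x \<ge> mdist X l k / 2 + h" "mdist X k x \<ge> mdist X l k / 2 + h"
    by (auto simp: h_def)
  ultimately show False
    using \<open>0 < h\<close> n pq[OF x(1), of m] commute[of l "p m"] commute[of k "q m"] unfolding m_def[symmetric] by linarith
qed

text \<open>If \<open>X\<close> has a pair of excess zero, every nearby space has small excess; if
  not, no nearby space is tightly covered and the implication holds vacuously.\<close>

lemma tightly_covered_imp_excess_less_near:
  assumes X: "compact_metric X" "geodesic_space X" "non_branching X" and "0 < \<epsilon>"
  shows "\<exists>e>0. \<forall>Y. compact_metric Y \<and> gh_close e X Y \<longrightarrow> tightly_covered e Y \<longrightarrow> excess Y < \<epsilon>"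
proof (cases "\<exists>a\<in>mspace X. \<exists>b\<in>mspace X. \<forall>x\<in>mspace X. between X a x b")
  case True
  then obtain a b where ab: "a \<in> mspace X" "b \<in> mspace X" "\<forall>x\<in>mspace X. between X a x b"
    by blast
  \<comment> \<open>Each of the three distances in the excess changes by at most
    \<open>\<epsilon> / 4\<close>.\<close>
  have "excess Y < \<epsilon>" if Y: "compact_metric Y" "gh_close (\<epsilon> / 4) X Y" for Y :: "'b metric"
  proof -
    obtain R where R: "\<forall>x\<in>mspace X. \<exists>y\<in>mspace Y. R x y" "\<forall>y\<in>mspace Y. \<exists>x\<in>mspace X. R x y"
      "\<And>x x' y y'. x \<in> mspace X \<Longrightarrow> x' \<in> mspace X \<Longrightarrow> y \<in> mspace Y \<Longrightarrow> y' \<in> mspace Y \<Longrightarrow>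
         R x y \<Longrightarrow> R x' y' \<Longrightarrow> \<bar>mdist X x x' - mdist Y y y'\<bar> \<le> \<epsilon> / 4"
      using Y(2) unfolding gh_close_def by blast
    obtain a' b' where a'b': "a' \<in> mspace Y" "R a a'" "b' \<in> mspace Y" "R b b'"
      using R(1) ab by blast
    have "excess Y \<le> 3 * (\<epsilon> / 4)"
    proof (rule excess_le[OF Y(1) a'b'(1,3)])
      fix y assume y: "y \<in> mspace Y"
      then obtain x where x: "x \<in> mspace X" "R x y"
        using R(2) by blast
      have "between X a x b"
        using ab(3) x(1) by blast
      moreover have "\<bar>mdist X a x - mdist Y a' y\<bar> \<le> \<epsilon> / 4" "\<bar>mdist X x b - mdist Y y b'\<bar> \<le> \<epsilon> / 4"
        "\<bar>mdist X a b - mdist Y a' b'\<bar> \<le> \<epsilon> / 4"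
        using R(3) ab(1,2) a'b' x y by blast+
      ultimately show "mdist Y a' y + mdist Y y b' - mdist Y a' b' \<le> 3 * (\<epsilon> / 4)"
        by argo
    qed
    then show ?thesis
      using \<open>0 < \<epsilon>\<close> by simp
  qed
  then show ?thesis
    using \<open>0 < \<epsilon>\<close> by (intro exI[of _ "\<epsilon> / 4"]) auto
next
  case False
  \<comment> \<open>The contrapositive of \<open>two_ball_cover_zero_excess\<close>, with
    \<open>r\<close> half the distance of the centres.\<close>
  have "\<exists>x\<in>mspace X. mdist X p q / 2 < mdist X p x \<and> mdist X p q / 2 < mdist X q x"
    if "p \<in> mspace X" "q \<in> mspace X" for p q
    using two_ball_cover_zero_excess[OF X that, of "mdist X p q / 2"] False
    by (metis mult_2 field_sum_of_halves not_le)
  then obtain t where t: "0 < t" "\<And>p q. p \<in> mspace X \<Longrightarrow> q \<in> mspace X \<Longrightarrow>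
      \<exists>x\<in>mspace X. mdist X p q / 2 + t \<le> mdist X p x \<and> mdist X p q / 2 + t \<le> mdist X q x"
    using uncovered_uniform[OF X(1)] by blast
  \<comment> \<open>The cover contributes \<open>t / 4\<close>, the distance to a centre changes by
    \<open>t / 4\<close> and half the distance of the centres by \<open>t / 8\<close>; the sum is
    below \<open>t\<close>.\<close>
  have "\<not> tightly_covered (t / 4) Y" if close: "gh_close (t / 4) X Y" for Y :: "'b metric"
  proof
    assume "tightly_covered (t / 4) Y"
    then obtain p q r where Y: "p \<in> mspace Y" "q \<in> mspace Y" "mdist Y p q = 2 * r"
      "mspace Y = mball_of Y p (r + t / 4) \<union> mball_of Y q (r + t / 4)"
      unfolding tightly_covered_def by blast
    obtain R where R: "\<forall>x\<in>mspace X. \<exists>y\<in>mspace Y. R x y" "\<forall>y\<in>mspace Y. \<exists>x\<in>mspace X. R x y"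
      "\<And>x x' y y'. x \<in> mspace X \<Longrightarrow> x' \<in> mspace X \<Longrightarrow> y \<in> mspace Y \<Longrightarrow> y' \<in> mspace Y \<Longrightarrow>
         R x y \<Longrightarrow> R x' y' \<Longrightarrow> \<bar>mdist X x x' - mdist Y y y'\<bar> \<le> t / 4"
      using close unfolding gh_close_def by blast
    obtain p' q' where p'q': "p' \<in> mspace X" "R p' p" "q' \<in> mspace X" "R q' q"
      using R(2) Y by blast
    obtain x where x: "x \<in> mspace X" "mdist X p' q' / 2 + t \<le> mdist X p' x" "mdist X p' q' / 2 + t \<le> mdist X q' x"
      using t(2)[OF p'q'(1,3)] by blast
    obtain y where y: "y \<in> mspace Y" "R x y"
      using R(1) x by blast
    have "\<bar>mdist X p' x - mdist Y p y\<bar> \<le> t / 4" "\<bar>mdist X q' x - mdist Y q y\<bar> \<le> t / 4"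
      "\<bar>mdist X p' q' - mdist Y p q\<bar> \<le> t / 4"
      using R(3) p'q' Y(1,2) x(1) y by blast+
    moreover have "y \<in> mball_of Y p (r + t / 4) \<union> mball_of Y q (r + t / 4)"
      using y(1) Y(4) by blast
    then have "mdist Y p y < r + t / 4 \<or> mdist Y q y < r + t / 4"
      by auto
    ultimately show False
      using x(2,3) Y(3) t(1) by argo
  qed
  then show ?thesis
    using t(1) by (intro exI[of _ "t / 4"]) auto
qed

theorem gh_precompact_tight_cover_excess:
  assumes pre: "gh_precompact S" and S: "S \<subseteq> Collect compact_metric"
    and nb: "\<And>X :: 'a metric. X \<in> gh_closure S \<Longrightarrow> geodesic_space X \<and> non_branching X" and "0 < \<epsilon>"
  shows "\<exists>\<delta>>0. \<forall>Y\<in>S. tightly_covered \<delta> Y \<longrightarrow> excess Y < \<epsilon>"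
proof (rule gh_precompact_uniform[OF pre S])
  fix X assume X: "X \<in> gh_closure S"
  then have "compact_metric X"
    by (simp add: gh_closure_def)
  then show "\<exists>e>0. \<forall>Y\<in>S. gh_close e X Y \<longrightarrow> tightly_covered e Y \<longrightarrow> excess Y < \<epsilon>"
    using tightly_covered_imp_excess_less_near[OF _ _ _ \<open>0 < \<epsilon>\<close>] nb[OF X] S by blast
next
  fix e e' :: real and Y :: "'a metric"
  assume "tightly_covered e Y \<longrightarrow> excess Y < \<epsilon>" "e' \<le> e"
  then show "tightly_covered e' Y \<longrightarrow> excess Y < \<epsilon>"
    using tightly_covered_mono[of e' Y e] by blast
qed

section \<open>Differentiation in coordinates\<close>

definition coord_space :: "nat \<Rightarrow> (nat \<Rightarrow> real) set" where
  "coord_space n = {x. \<forall>i\<ge>n. x i = 0}"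

lemma Euclidean_space_eq: "Euclidean_space n = top_of_set (coord_space n)"
  by (simp add: Euclidean_space_def euclidean_product_topology coord_space_def)

lemma continuous_map_coord_space:
  "V \<subseteq> coord_space n \<Longrightarrow>
     continuous_map (subtopology (Euclidean_space n) V) euclideanreal f \<longleftrightarrow> continuous_on V f"
  by (simp add: Euclidean_space_eq subtopology_subtopology Int_absorb1)

lemma coord_space_upd: "x \<in> coord_space n \<Longrightarrow> i < n \<Longrightarrow> x(i := t) \<in> coord_space n"
  by (auto simp: coord_space_def)

text \<open>Cubes fit both the product topology and the coordinatewise estimates below.\<close>

definition cbox_coord :: "nat \<Rightarrow> (nat \<Rightarrow> real) \<Rightarrow> real \<Rightarrow> (nat \<Rightarrow> real) set" where
  "cbox_coord n x \<rho> = {y \<in> coord_space n. \<forall>i<n. \<bar>y i - x i\<bar> \<le> \<rho>}"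

definition box_coord :: "nat \<Rightarrow> (nat \<Rightarrow> real) \<Rightarrow> real \<Rightarrow> (nat \<Rightarrow> real) set" where
  "box_coord n x \<rho> = {y \<in> coord_space n. \<forall>i<n. \<bar>y i - x i\<bar> < \<rho>}"

text \<open>A basic open set of the product restricts each coordinate. From index \<open>n\<close>
  on all coordinates vanish, so the least of finitely many radii suffices.\<close>

lemma openin_cbox_coord:
  assumes V: "openin (top_of_set (coord_space n)) V" and "x \<in> V"
  obtains \<rho> where "0 < \<rho>" "cbox_coord n x \<rho> \<subseteq> V"
proof -
  obtain W where W: "open W" "V = coord_space n \<inter> W"
    using V by (auto simp: openin_open)
  have "openin (product_topology (\<lambda>_. euclideanreal) UNIV) W" "x \<in> W"
    using W \<open>x \<in> V\<close> by (auto simp: euclidean_product_topology)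
  from product_topology_open_contains_basis[OF this]
  obtain X where X: "x \<in> (\<Pi>\<^sub>E i\<in>UNIV. X i)" "\<And>i. openin euclideanreal (X i)" "(\<Pi>\<^sub>E i\<in>UNIV. X i) \<subseteq> W"
    by blast
  have "\<exists>e>0. \<forall>t. \<bar>t - x i\<bar> < e \<longrightarrow> t \<in> X i" for i
  proof -
    have "open (X i)" "x i \<in> X i"
      using X by (auto simp: PiE_iff)
    then show ?thesis
      unfolding open_dist by (auto simp: dist_real_def)
  qed
  then obtain e where e: "\<And>i. 0 < e i" "\<And>i t. \<bar>t - x i\<bar> < e i \<Longrightarrow> t \<in> X i"
    by metis
  \<comment> \<open>Half the minimum, to fit a closed cube into open intervals; the element
    \<open>1\<close> provides for \<open>n = 0\<close>.\<close>
  define \<rho> where "\<rho> = Min (insert 1 (e ` {..<n})) / 2"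
  have Min: "0 < Min (insert 1 (e ` {..<n}))"
    using e(1) by (subst Min_gr_iff) auto
  have less: "\<rho> < e i" if "i < n" for i
  proof -
    have "Min (insert 1 (e ` {..<n})) \<le> e i"
      using that by (intro Min_le) auto
    then show ?thesis
      using Min unfolding \<rho>_def by linarith
  qed
  have "cbox_coord n x \<rho> \<subseteq> V"
  proof
    fix y assume y: "y \<in> cbox_coord n x \<rho>"
    have "y i \<in> X i" for i
    proof (cases "i < n")
      case True
      then show ?thesis
        using y less[OF True] by (intro e(2)) (auto simp: cbox_coord_def intro: le_less_trans)
    next
      case False
      then have "y i = x i"
        using y \<open>x \<in> V\<close> W by (auto simp: cbox_coord_def coord_space_def)
      then show ?thesis
        using X(1) by (auto simp: PiE_iff)
    qed
    then show "y \<in> V"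
      using y X(3) W(2) by (auto simp: cbox_coord_def PiE_iff)
  qed
  then show ?thesis
    using that[of \<rho>] Min by (simp add: \<rho>_def)
qed

lemma openin_box_coord: "openin (top_of_set (coord_space n)) (box_coord n x \<rho>)"
proof -
  have "open {y. \<bar>y i - x i\<bar> < \<rho>}" for i
    by (intro open_Collect_less continuous_intros continuous_on_product_coordinates)
  then have "open (\<Inter>i<n. {y. \<bar>y i - x i\<bar> < \<rho>})"
    by (intro open_INT) auto
  moreover have "box_coord n x \<rho> = coord_space n \<inter> (\<Inter>i<n. {y. \<bar>y i - x i\<bar> < \<rho>})"
    by (auto simp: box_coord_def)
  ultimately show ?thesis
    by (auto simp: openin_open)
qed

text \<open>A product of compact intervals, with \<open>{0}\<close> as factor from index
  \<open>n\<close> on, is compact by Tychonoff's theorem.\<close>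

lemma compact_cbox_coord: "compact (cbox_coord n x \<rho>)"
proof -
  have "cbox_coord n x \<rho> = (\<Pi>\<^sub>E i\<in>UNIV. if i < n then {x i - \<rho>..x i + \<rho>} else {0})"
    by (auto simp: cbox_coord_def coord_space_def PiE_iff abs_le_iff split: if_splits)
      (metis add.commute diff_le_eq le_diff_eq minus_le_iff minus_diff_eq)+
  moreover have "compactin (product_topology (\<lambda>_. euclideanreal) UNIV) \<dots>"
    by (subst compactin_PiE) auto
  ultimately show ?thesis
    by (simp add: euclidean_product_topology)
qed

lemma continuous_on_cbox_coord:
  fixes f :: "(nat \<Rightarrow> real) \<Rightarrow> real"
  assumes V: "openin (top_of_set (coord_space n)) V" and f: "continuous_on V f" and "x \<in> V" "0 < e"
  obtains \<rho> where "0 < \<rho>" "cbox_coord n x \<rho> \<subseteq> V" "\<And>y. y \<in> cbox_coord n x \<rho> \<Longrightarrow> \<bar>f y - f x\<bar> < e"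
proof -
  have "openin (top_of_set V) (V \<inter> f -` ball (f x) e)"
    by (rule continuous_openin_preimage_gen[OF f open_ball])
  then have "openin (top_of_set (coord_space n)) (V \<inter> f -` ball (f x) e)"
    using V by (rule openin_trans)
  then obtain \<rho> where "0 < \<rho>" "cbox_coord n x \<rho> \<subseteq> V \<inter> f -` ball (f x) e"
    using openin_cbox_coord[of n "V \<inter> f -` ball (f x) e" x] \<open>x \<in> V\<close> \<open>0 < e\<close>
    by (metis IntI vimageI centre_in_ball)
  then show ?thesis
    by (intro that[of \<rho>]) (auto simp: dist_real_def abs_minus_commute)
qed

text \<open>Used for the partial derivatives of a function and for the components of the metric
  tensor, which must be controlled on one common cube.\<close>

lemma finite_family_cbox_coord:
  fixes f :: "'i \<Rightarrow> (nat \<Rightarrow> real) \<Rightarrow> real"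
  assumes V: "openin (top_of_set (coord_space n)) V" and "finite I"
    and f: "\<And>i. i \<in> I \<Longrightarrow> continuous_on V (f i)" and "x \<in> V" "0 < e"
  obtains \<rho> where "0 < \<rho>" "cbox_coord n x \<rho> \<subseteq> V"
    "\<And>i y. i \<in> I \<Longrightarrow> y \<in> cbox_coord n x \<rho> \<Longrightarrow> \<bar>f i y - f i x\<bar> < e"
proof -
  have "\<exists>\<rho>>0. \<forall>y\<in>cbox_coord n x \<rho>. \<bar>f i y - f i x\<bar> < e" if "i \<in> I" for i
    using continuous_on_cbox_coord[OF V f[OF that] \<open>x \<in> V\<close> \<open>0 < e\<close>] by metis
  then obtain r where r: "\<And>i. i \<in> I \<Longrightarrow> 0 < r i"
    "\<And>i y. i \<in> I \<Longrightarrow> y \<in> cbox_coord n x (r i) \<Longrightarrow> \<bar>f i y - f i x\<bar> < e"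
    by metis
  obtain \<rho>0 where \<rho>0: "0 < \<rho>0" "cbox_coord n x \<rho>0 \<subseteq> V"
    using openin_cbox_coord[OF V \<open>x \<in> V\<close>] by blast
  define \<rho> where "\<rho> = Min (insert \<rho>0 (r ` I))"
  have le: "\<rho> \<le> \<rho>0" "\<And>i. i \<in> I \<Longrightarrow> \<rho> \<le> r i"
    unfolding \<rho>_def using \<open>finite I\<close> by (auto intro: Min_le)
  have mono: "cbox_coord n x s \<subseteq> cbox_coord n x t" if "s \<le> t" for s t
    using that by (fastforce simp: cbox_coord_def)
  show ?thesis
  proof (rule that[of \<rho>])
    show "0 < \<rho>"
      unfolding \<rho>_def using \<open>finite I\<close> \<rho>0(1) r(1) by (subst Min_gr_iff) auto
    show "cbox_coord n x \<rho> \<subseteq> V"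
      using mono[OF le(1)] \<rho>0(2) by blast
    show "\<bar>f i y - f i x\<bar> < e" if "i \<in> I" "y \<in> cbox_coord n x \<rho>" for i y
      using r(2)[of i y] mono[OF le(2)] that by blast
  qed
qed

text \<open>Changing one coordinate after the other reduces this to the mean value inequality in one
  variable.\<close>

lemma linear_approximation:
  fixes f :: "(nat \<Rightarrow> real) \<Rightarrow> real"
  assumes V: "openin (top_of_set (coord_space n)) V" and "x \<in> V" and "0 < e"
    and D: "\<And>i z. i < n \<Longrightarrow> z \<in> V \<Longrightarrow> ((\<lambda>t. f (z(i := t))) has_real_derivative g i z) (at (z i))"
    and g: "\<And>i. i < n \<Longrightarrow> continuous_on V (g i)"
  shows "\<exists>\<rho>>0. \<forall>y\<in>cbox_coord n x \<rho>.
       \<bar>f y - f x - (\<Sum>i<n. g i x * (y i - x i))\<bar> \<le> e * (\<Sum>i<n. \<bar>y i - x i\<bar>)"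
proof -
  obtain \<rho> where \<rho>: "0 < \<rho>" "cbox_coord n x \<rho> \<subseteq> V"
    "\<And>i y. i \<in> {..<n} \<Longrightarrow> y \<in> cbox_coord n x \<rho> \<Longrightarrow> \<bar>g i y - g i x\<bar> < e"
    using finite_family_cbox_coord[OF V finite_lessThan[of n], of g x e] g \<open>x \<in> V\<close> \<open>0 < e\<close> by (metis lessThan_iff)
  have xE: "x \<in> coord_space n"
    using V \<open>x \<in> V\<close> by (auto simp: openin_open)
  have "\<bar>f y - f x - (\<Sum>i<n. g i x * (y i - x i))\<bar> \<le> e * (\<Sum>i<n. \<bar>y i - x i\<bar>)"
    if y: "y \<in> cbox_coord n x \<rho>" for y
  proof -
    \<comment> \<open>A staircase from \<open>x\<close> to \<open>y\<close>: the step from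
      \<open>z k\<close> to \<open>z (Suc k)\<close> changes coordinate \<open>k\<close> alone and
      stays in the cube.\<close>
    define z where "z k = (\<lambda>i. if i < k then y i else x i)" for k
    have yE: "y \<in> coord_space n"
      using y by (simp add: cbox_coord_def)
    have z0: "z 0 = x"
      by (simp add: z_def)
    have zn: "z n = y"
      using xE yE by (auto simp: z_def coord_space_def)
    have z_upd: "(z k)(k := t) \<in> cbox_coord n x \<rho>" if "k < n" "\<bar>t - x k\<bar> \<le> \<rho>" for k t
      using that xE y \<rho>(1) by (auto simp: cbox_coord_def coord_space_def z_def)
    have step: "\<bar>f (z (Suc k)) - f (z k) - g k x * (y k - x k)\<bar> \<le> e * \<bar>y k - x k\<bar>" if k: "k < n" for k
    proof -
      \<comment> \<open>With the linear part removed, the derivative is a difference of values of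
        \<open>g k\<close> on the cube, hence at most \<open>e\<close>.\<close>
      define h where "h t = f ((z k)(k := t)) - g k x * t" for t
      have "norm (h (y k) - h (x k)) \<le> e * norm (y k - x k)"
      proof (rule field_differentiable_bound[of "cball (x k) \<rho>" h "\<lambda>t. g k ((z k)(k := t)) - g k x"])
        fix t assume "t \<in> cball (x k) \<rho>"
        then have t: "\<bar>t - x k\<bar> \<le> \<rho>"
          by (simp add: dist_real_def abs_minus_commute)
        have "((\<lambda>s. f ((z k)(k := t, k := s))) has_real_derivative g k ((z k)(k := t))) (at (((z k)(k := t)) k))"
          by (rule D[OF k]) (use \<rho>(2) z_upd[OF k t] in blast)
        then have "((\<lambda>s. f ((z k)(k := s))) has_real_derivative g k ((z k)(k := t))) (at t)"
          by simp
        then have "(h has_real_derivative g k ((z k)(k := t)) - g k x) (at t)"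
          unfolding h_def by (auto intro!: derivative_eq_intros)
        then show "(h has_real_derivative g k ((z k)(k := t)) - g k x) (at t within cball (x k) \<rho>)"
          by (rule has_field_derivative_at_within)
        show "norm (g k ((z k)(k := t)) - g k x) \<le> e"
          using \<rho>(3)[of k] z_upd[OF k t] k by (auto intro: less_imp_le)
      qed (use \<rho>(1) y k in \<open>auto simp: cbox_coord_def dist_real_def abs_minus_commute\<close>)
      moreover have "(z k)(k := y k) = z (Suc k)" "(z k)(k := x k) = z k"
        by (auto simp: z_def)
      ultimately show ?thesis
        by (simp add: h_def algebra_simps)
    qed
    have "f y - f x = (\<Sum>k<n. f (z (Suc k)) - f (z k))"
      using sum_lessThan_telescope[of "\<lambda>k. f (z k)" n] by (simp add: zn z0)
    then have "\<bar>f y - f x - (\<Sum>i<n. g i x * (y i - x i))\<bar> =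
        \<bar>\<Sum>k<n. f (z (Suc k)) - f (z k) - g k x * (y k - x k)\<bar>"
      by (simp add: sum_subtractf)
    also have "\<dots> \<le> (\<Sum>k<n. e * \<bar>y k - x k\<bar>)"
      by (rule order_trans[OF sum_abs sum_mono]) (use step in auto)
    finally show ?thesis
      by (simp add: sum_distrib_left)
  qed
  then show ?thesis
    using \<rho>(1) by blast
qed

text \<open>By \<open>linear_approximation\<close> the error of the difference quotient is a small
  multiple of the sum of the coordinate quotients \<open>q i s\<close>, which stay bounded near
  \<open>t\<close>. Derivatives are taken within \<open>S\<close> so that end points of intervals
  are included.\<close>

lemma chain_rule_coord:
  fixes f :: "(nat \<Rightarrow> real) \<Rightarrow> real" and x :: "real \<Rightarrow> nat \<Rightarrow> real"
  assumes V: "openin (top_of_set (coord_space n)) V"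
    and D: "\<And>i z. i < n \<Longrightarrow> z \<in> V \<Longrightarrow> ((\<lambda>t. f (z(i := t))) has_real_derivative g i z) (at (z i))"
    and g: "\<And>i. i < n \<Longrightarrow> continuous_on V (g i)"
    and x: "\<And>s. s \<in> S \<Longrightarrow> x s \<in> V" and "t \<in> S"
    and v: "\<And>i. i < n \<Longrightarrow> ((\<lambda>s. x s i) has_real_derivative v i) (at t within S)"
  shows "((\<lambda>s. f (x s)) has_real_derivative (\<Sum>i<n. g i (x t) * v i)) (at t within S)"
proof -
  define q where "q i s = (x s i - x t i) / (s - t)" for i s
  have q: "(q i \<longlongrightarrow> v i) (at t within S)" if "i < n" for i
    using v[OF that] unfolding has_field_derivative_iff q_def by simp
  have xi: "((\<lambda>s. x s i) \<longlongrightarrow> x t i) (at t within S)" if "i < n" for i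
    using DERIV_continuous[OF v[OF that]] by (simp add: continuous_within)
  have "((\<lambda>s. (f (x s) - f (x t)) / (s - t) - (\<Sum>i<n. g i (x t) * q i s)) \<longlongrightarrow> 0) (at t within S)"
  proof (rule tendstoI)
    fix e :: real assume "0 < e"
    \<comment> \<open>Bounds the sum of the quotients once each is within \<open>1\<close> of its
      limit \<open>v i\<close>; the last summand makes \<open>K\<close> positive. With
      \<open>e' = e / (2 * K)\<close> the error is at most \<open>e / 2\<close>.\<close>
    define K where "K = (\<Sum>i<n. \<bar>v i\<bar> + 1) + 1"
    have "0 < K"
      unfolding K_def by (intro add_nonneg_pos sum_nonneg) auto
    define e' where "e' = e / (2 * K)"
    have "0 < e'"
      using \<open>0 < e\<close> \<open>0 < K\<close> by (simp add: e'_def)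
    obtain \<rho> where \<rho>: "0 < \<rho>" "\<And>y. y \<in> cbox_coord n (x t) \<rho> \<Longrightarrow>
        \<bar>f y - f (x t) - (\<Sum>i<n. g i (x t) * (y i - x t i))\<bar> \<le> e' * (\<Sum>i<n. \<bar>y i - x t i\<bar>)"
      using linear_approximation[where f = f and g = g, OF V x[OF \<open>t \<in> S\<close>] \<open>0 < e'\<close> D g] by blast
    have "\<forall>i\<in>{..<n}. eventually (\<lambda>s. \<bar>x s i - x t i\<bar> < \<rho>) (at t within S)"
      using tendstoD[OF xi \<rho>(1)] by (auto simp: dist_real_def)
    then have ev1: "eventually (\<lambda>s. \<forall>i\<in>{..<n}. \<bar>x s i - x t i\<bar> < \<rho>) (at t within S)"
      by (rule eventually_ball_finite[rotated]) simp
    have "\<forall>i\<in>{..<n}. eventually (\<lambda>s. \<bar>q i s - v i\<bar> < 1) (at t within S)"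
      using tendstoD[OF q zero_less_one] by (auto simp: dist_real_def)
    then have ev2: "eventually (\<lambda>s. \<forall>i\<in>{..<n}. \<bar>q i s - v i\<bar> < 1) (at t within S)"
      by (rule eventually_ball_finite[rotated]) simp
    have ev3: "eventually (\<lambda>s. s \<in> S \<and> s \<noteq> t) (at t within S)"
      by (auto simp: eventually_at_filter)
    from ev1 ev2 ev3
    show "eventually (\<lambda>s. dist ((f (x s) - f (x t)) / (s - t) - (\<Sum>i<n. g i (x t) * q i s)) 0 < e) (at t within S)"
    proof eventually_elim
      case (elim s)
      have "x s \<in> coord_space n"
        using x[of s] elim V by (auto simp: openin_open)
      then have "x s \<in> cbox_coord n (x t) \<rho>"
        using elim by (auto simp: cbox_coord_def intro: less_imp_le)
      then have "\<bar>f (x s) - f (x t) - (\<Sum>i<n. g i (x t) * (x s i - x t i))\<bar> / \<bar>s - t\<bar>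
          \<le> e' * (\<Sum>i<n. \<bar>x s i - x t i\<bar>) / \<bar>s - t\<bar>"
        by (intro divide_right_mono \<rho>(2)) auto
      also have "\<dots> = e' * (\<Sum>i<n. \<bar>q i s\<bar>)"
        by (simp add: q_def sum_divide_distrib[symmetric])
      also have "\<dots> \<le> e' * (\<Sum>i<n. \<bar>v i\<bar> + 1)"
      proof (intro mult_left_mono sum_mono)
        fix i assume "i \<in> {..<n}"
        then have "\<bar>q i s - v i\<bar> < 1" using elim by blast
        then show "\<bar>q i s\<bar> \<le> \<bar>v i\<bar> + 1" by linarith
      qed (use \<open>0 < e'\<close> in simp)
      also have "\<dots> \<le> e' * K"
        using \<open>0 < e'\<close> by (simp add: K_def)
      also have "\<dots> < e"
        using \<open>0 < e\<close> \<open>0 < K\<close> by (simp add: e'_def)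
      finally have "\<bar>f (x s) - f (x t) - (\<Sum>i<n. g i (x t) * (x s i - x t i))\<bar> / \<bar>s - t\<bar> < e" .
      moreover have "(f (x s) - f (x t)) / (s - t) - (\<Sum>i<n. g i (x t) * q i s) =
          (f (x s) - f (x t) - (\<Sum>i<n. g i (x t) * (x s i - x t i))) / (s - t)"
        by (simp add: q_def diff_divide_distrib[of _ "\<Sum>i<n. _ i"] sum_divide_distrib)
      ultimately show ?case
        by simp
    qed
  qed
  moreover have "((\<lambda>s. \<Sum>i<n. g i (x t) * q i s) \<longlongrightarrow> (\<Sum>i<n. g i (x t) * v i)) (at t within S)"
    using q by (auto intro!: tendsto_intros)
  ultimately have "((\<lambda>s. (f (x s) - f (x t)) / (s - t)) \<longlongrightarrow> 0 + (\<Sum>i<n. g i (x t) * v i)) (at t within S)"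
    using tendsto_add by fastforce
  then show ?thesis
    unfolding has_field_derivative_iff by simp
qed

text \<open>Uniqueness of derivatives identifies the derivative whose existence \<open>Ck_on\<close>
  asserts with \<open>partial_deriv\<close>, which thereby inherits continuity.\<close>

lemma smooth_on_open_C1:
  assumes "smooth_on_open n V f"
  shows "openin (top_of_set (coord_space n)) V" "continuous_on V f"
    "\<And>i z. i < n \<Longrightarrow> z \<in> V \<Longrightarrow>
       ((\<lambda>t. f (z(i := t))) has_real_derivative partial_deriv i f z) (at (z i))"
    "\<And>i. i < n \<Longrightarrow> continuous_on V (partial_deriv i f)"
proof -
  show V: "openin (top_of_set (coord_space n)) V"
    using assms by (simp add: smooth_on_open_def Euclidean_space_eq)
  then have sub: "V \<subseteq> coord_space n"
    by (auto simp: openin_open)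
  have "Ck_on 1 n V f"
    using assms by (simp add: smooth_on_open_def)
  then have C: "continuous_on V f" "\<And>i. i < n \<Longrightarrow> \<exists>g. (\<forall>x\<in>V. ((\<lambda>t. f (x(i := t))) has_real_derivative g x) (at (x i))) \<and> continuous_on V g"
    using sub by (simp_all add: continuous_map_coord_space)
  show "continuous_on V f"
    by (rule C(1))
  have "((\<lambda>t. f (z(i := t))) has_real_derivative partial_deriv i f z) (at (z i))" if "i < n" "z \<in> V" for i z
    using C(2)[OF that(1)] that(2) unfolding partial_deriv_def by (metis DERIV_imp_deriv)
  then show "\<And>i z. i < n \<Longrightarrow> z \<in> V \<Longrightarrow>
      ((\<lambda>t. f (z(i := t))) has_real_derivative partial_deriv i f z) (at (z i))"
    by blast
  show "continuous_on V (partial_deriv i f)" if i: "i < n" for i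
  proof -
    obtain g where g: "\<forall>x\<in>V. ((\<lambda>t. f (x(i := t))) has_real_derivative g x) (at (x i))" "continuous_on V g"
      using C(2)[OF i] by blast
    have "g x = partial_deriv i f x" if "x \<in> V" for x
      using g(1) that DERIV_imp_deriv unfolding partial_deriv_def by metis
    then show ?thesis
      using g(2) by (simp cong: continuous_on_cong)
  qed
qed

section \<open>Charts and speed of curves\<close>

lemma mult_sum_sum:
  fixes g :: real
  shows "g * (\<Sum>i\<in>I. a i) * (\<Sum>j\<in>J. b j) = (\<Sum>i\<in>I. \<Sum>j\<in>J. g * a i * b j)"
  by (subst mult.assoc, subst sum_product) (simp add: sum_distrib_left mult.assoc)

locale closed_riem =
  fixes M :: "'a riemannian_manifold"
  assumes closed: "closed_riemannian_manifold M"
begin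

abbreviation "T \<equiv> rm_top M"
abbreviation "n \<equiv> rm_dim M"
abbreviation "A \<equiv> rm_atlas M"
abbreviation chart_image :: "'a chart \<Rightarrow> (nat \<Rightarrow> real) set" where
  "chart_image c \<equiv> snd c ` fst c"

lemma dim_pos: "0 < n"
  using closed by (simp add: closed_riemannian_manifold_def)

lemma smooth_atlas: "smooth_atlas T n A"
  using closed by (simp add: closed_riemannian_manifold_def)

lemma chart_open:
  assumes "c \<in> A"
  shows "openin T (fst c)" "openin (top_of_set (coord_space n)) (chart_image c)"
    "homeomorphic_map (subtopology T (fst c)) (subtopology (Euclidean_space n) (chart_image c)) (snd c)"
  using smooth_atlas assms unfolding smooth_atlas_def by (auto simp: Euclidean_space_eq)

lemma chart_covers:
  assumes "p \<in> topspace T"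
  obtains c where "c \<in> A" "p \<in> fst c"
  using smooth_atlas assms unfolding smooth_atlas_def by auto

lemma fst_chart_subset: "c \<in> A \<Longrightarrow> fst c \<subseteq> topspace T"
  using chart_open(1) openin_subset by blast

lemma chart_image_subset: "c \<in> A \<Longrightarrow> chart_image c \<subseteq> coord_space n"
  using chart_open(2)[of c] by (auto simp: openin_open)

lemma top_chart_image: "c \<in> A \<Longrightarrow> subtopology (Euclidean_space n) (chart_image c) = top_of_set (chart_image c)"
  using chart_image_subset[of c] by (simp add: Euclidean_space_eq subtopology_subtopology Int_absorb1)

lemma inj_on_chart: "c \<in> A \<Longrightarrow> inj_on (snd c) (fst c)"
  using homeomorphic_imp_injective_map[OF chart_open(3)] fst_chart_subset by (fastforce simp: Int_absorb1)

lemma chart_inv_left: "c \<in> A \<Longrightarrow> p \<in> fst c \<Longrightarrow> chart_inv c (snd c p) = p"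
  by (simp add: chart_inv_def inj_on_chart)

lemma chart_inv_right:
  assumes "x \<in> chart_image c"
  shows "snd c (chart_inv c x) = x" "chart_inv c x \<in> fst c"
  using assms by (simp_all add: chart_inv_def f_inv_into_f inv_into_into)

lemma chart_continuous: "c \<in> A \<Longrightarrow> continuous_map (subtopology T (fst c)) (top_of_set (chart_image c)) (snd c)"
  using homeomorphic_imp_continuous_map[OF chart_open(3)] top_chart_image by metis

lemma chart_inv_continuous:
  assumes c: "c \<in> A"
  shows "continuous_map (top_of_set (chart_image c)) T (chart_inv c)"
proof -
  obtain f where f: "homeomorphic_maps (subtopology T (fst c)) (top_of_set (chart_image c)) (snd c) f"
    using chart_open(3)[OF c] unfolding top_chart_image[OF c] homeomorphic_map_maps by blast
  have "f x = chart_inv c x" if x: "x \<in> chart_image c" for x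
  proof -
    obtain p where "p \<in> fst c" "x = snd c p"
      using x by blast
    then show ?thesis
      using f fst_chart_subset[OF c] chart_inv_left[OF c] by (auto simp: homeomorphic_maps_def)
  qed
  moreover have "continuous_map (top_of_set (chart_image c)) T f"
    using f by (auto simp: homeomorphic_maps_def continuous_map_in_subtopology)
  ultimately show ?thesis
    by (auto intro: continuous_map_eq)
qed

lemma chart_preimage_open:
  assumes c: "c \<in> A" and W: "openin (top_of_set (coord_space n)) W"
  shows "openin T {p \<in> fst c. snd c p \<in> W}"
proof -
  have "openin (top_of_set (chart_image c)) (chart_image c \<inter> W)"
    using W chart_image_subset[OF c] by (auto simp: openin_open)
  from openin_continuous_map_preimage[OF chart_continuous[OF c] this]
  have "openin (subtopology T (fst c)) {p \<in> fst c. snd c p \<in> W}"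
    using fst_chart_subset[OF c] by (simp add: Int_absorb1 cong: conj_cong)
  then show ?thesis
    using chart_open(1)[OF c] openin_trans_full by blast
qed

abbreviation jacobian :: "'a chart \<Rightarrow> 'a chart \<Rightarrow> 'a \<Rightarrow> nat \<Rightarrow> nat \<Rightarrow> real" where
  "jacobian c c' p k i \<equiv> partial_deriv i (\<lambda>x. snd c' (chart_inv c x) k) (snd c p)"

lemma openin_preimage_curve:
  assumes "continuous_map (top_of_set S) T \<gamma>" "openin T W"
  obtains U where "open U" "{s \<in> S. \<gamma> s \<in> W} = S \<inter> U"
  using openin_continuous_map_preimage[OF assms] by (auto simp: openin_open)

text \<open>Near \<open>t\<close> the curve stays in the overlap of the charts, so \<open>S\<close>
  may be shrunk to \<open>S \<inter> U\<close>, where the chain rule applies to the change of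
  coordinates.\<close>

lemma velocity_transition:
  assumes c: "c \<in> A" and c': "c' \<in> A" and \<gamma>: "continuous_map (top_of_set S) T \<gamma>"
    and t: "t \<in> S" "\<gamma> t \<in> fst c" "\<gamma> t \<in> fst c'" and k: "k < n"
    and v: "\<And>i. i < n \<Longrightarrow> ((\<lambda>s. snd c (\<gamma> s) i) has_real_derivative v i) (at t within S)"
  shows "((\<lambda>s. snd c' (\<gamma> s) k) has_real_derivative (\<Sum>i<n. jacobian c c' (\<gamma> t) k i * v i)) (at t within S)"
proof -
  let ?V = "snd c ` (fst c \<inter> fst c')" and ?F = "\<lambda>x. snd c' (chart_inv c x) k"
  have smooth: "smooth_on_open n ?V ?F"
    using smooth_atlas c c' k unfolding smooth_atlas_def by blast
  have W: "openin T (fst c \<inter> fst c')"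
    using chart_open(1)[OF c] chart_open(1)[OF c'] by (rule openin_Int)
  obtain U where U: "open U" "{s \<in> S. \<gamma> s \<in> fst c \<inter> fst c'} = S \<inter> U"
    using openin_preimage_curve[OF \<gamma> W] by blast
  have tN: "t \<in> S \<inter> U"
    using U(2) t by blast
  have within: "at t within S = at t within (S \<inter> U)"
    using U(1) tN by (intro at_within_nhd[of t U]) auto
  have mem: "\<gamma> s \<in> fst c \<inter> fst c'" if "s \<in> S \<inter> U" for s
    using that U(2) by blast
  have "((\<lambda>s. ?F (snd c (\<gamma> s))) has_real_derivative (\<Sum>i<n. partial_deriv i ?F (snd c (\<gamma> t)) * v i)) (at t within (S \<inter> U))"
  proof (rule chain_rule_coord[where V = ?V and f = ?F and g = "\<lambda>i. partial_deriv i ?F" and x = "\<lambda>s. snd c (\<gamma> s)"])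
    show "((\<lambda>s. snd c (\<gamma> s) i) has_real_derivative v i) (at t within S \<inter> U)" if "i < n" for i
      using v[OF that] within by simp
  qed (use smooth_on_open_C1[OF smooth] mem tN in blast)+
  then show ?thesis
    unfolding within
  proof (rule has_field_derivative_transform_within[OF _ zero_less_one tN])
    fix s assume "s \<in> S \<inter> U"
    then show "snd c' (chart_inv c (snd c (\<gamma> s))) k = snd c' (\<gamma> s) k"
      using mem[of s] chart_inv_left[OF c] by simp
  qed
qed

section \<open>Norms of tangent vectors and the speed of a curve\<close>

definition chart_norm :: "'a chart \<Rightarrow> 'a \<Rightarrow> (nat \<Rightarrow> real) \<Rightarrow> real" where
  "chart_norm c p v = sqrt (\<Sum>i<n. \<Sum>j<n. rm_tensor M c p i j * v i * v j)"

lemma chart_norm_cong: "(\<And>k. k < n \<Longrightarrow> v k = v' k) \<Longrightarrow> chart_norm c p v = chart_norm c p v'"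
  unfolding chart_norm_def by (intro arg_cong[of _ _ sqrt] sum.cong) auto

lemma tensor_pos:
  assumes "c \<in> A" "p \<in> fst c" "\<exists>i<n. v i \<noteq> 0"
  shows "(\<Sum>i<n. \<Sum>j<n. rm_tensor M c p i j * v i * v j) > 0"
  using closed assms unfolding closed_riemannian_manifold_def riemannian_metric_def by blast

lemma chart_norm_nonneg:
  assumes "c \<in> A" "p \<in> fst c"
  shows "0 \<le> chart_norm c p v"
proof (cases "\<exists>i<n. v i \<noteq> 0")
  case True
  then show ?thesis
    using tensor_pos[OF assms True] by (simp add: chart_norm_def)
qed (simp add: chart_norm_def)

lemma chart_norm_scale: "chart_norm c p (\<lambda>k. b * v k) = \<bar>b\<bar> * chart_norm c p v"
proof -
  have "(\<Sum>i<n. \<Sum>j<n. rm_tensor M c p i j * (b * v i) * (b * v j)) = b\<^sup>2 * (\<Sum>i<n. \<Sum>j<n. rm_tensor M c p i j * v i * v j)"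
    by (simp add: sum_distrib_left power2_eq_square mult_ac)
  then show ?thesis
    by (simp add: chart_norm_def real_sqrt_mult)
qed

text \<open>The Jacobian factors in the transformation law of the tensor are exactly those of the
  transformed vector; what remains is to reorder a fourfold sum.\<close>

lemma chart_norm_transition:
  assumes c: "c \<in> A" "c' \<in> A" and p: "p \<in> fst c" "p \<in> fst c'"
  shows "chart_norm c' p (\<lambda>k. \<Sum>i<n. jacobian c c' p k i * v i) = chart_norm c p v"
proof -
  let ?G = "rm_tensor M c' p" and ?J = "jacobian c c' p"
  let ?f = "\<lambda>k l i j. ?G k l * ?J k i * ?J l j * v i * v j"
  have law: "rm_tensor M c p i j = (\<Sum>k<n. \<Sum>l<n. ?G k l * ?J k i * ?J l j)" if "i < n" "j < n" for i j
    using closed c p that unfolding closed_riemannian_manifold_def riemannian_metric_def by blast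
  have "(\<Sum>k<n. \<Sum>l<n. ?G k l * (\<Sum>i<n. ?J k i * v i) * (\<Sum>j<n. ?J l j * v j))
      = (\<Sum>k<n. \<Sum>l<n. \<Sum>i<n. \<Sum>j<n. ?f k l i j)"
    unfolding mult_sum_sum by (intro sum.cong refl) (simp add: mult_ac)
  also have "\<dots> = (\<Sum>k<n. \<Sum>i<n. \<Sum>l<n. \<Sum>j<n. ?f k l i j)"
    by (intro sum.cong refl sum.swap)
  also have "\<dots> = (\<Sum>i<n. \<Sum>k<n. \<Sum>l<n. \<Sum>j<n. ?f k l i j)"
    by (rule sum.swap)
  also have "\<dots> = (\<Sum>i<n. \<Sum>k<n. \<Sum>j<n. \<Sum>l<n. ?f k l i j)"
    by (intro sum.cong refl sum.swap)
  also have "\<dots> = (\<Sum>i<n. \<Sum>j<n. \<Sum>k<n. \<Sum>l<n. ?f k l i j)"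
    by (intro sum.cong refl sum.swap)
  also have "\<dots> = (\<Sum>i<n. \<Sum>j<n. rm_tensor M c p i j * v i * v j)"
    by (intro sum.cong refl) (simp add: law sum_distrib_right)
  finally show ?thesis
    by (simp add: chart_norm_def)
qed

text \<open>All charts around the point must give the same value, so the arbitrary choice of a chart
  in \<open>riem_speed\<close> does no harm. Derivatives within \<open>S\<close> give a speed also
  at end points.\<close>

definition has_speed :: "(real \<Rightarrow> 'a) \<Rightarrow> real set \<Rightarrow> real \<Rightarrow> real \<Rightarrow> bool" where
  "has_speed \<gamma> S t s \<longleftrightarrow> \<gamma> t \<in> topspace T \<and> (\<forall>c\<in>A. \<gamma> t \<in> fst c \<longrightarrow>
     (\<exists>v. (\<forall>k<n. ((\<lambda>r. snd c (\<gamma> r) k) has_real_derivative v k) (at t within S)) \<and> s = chart_norm c (\<gamma> t) v))"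

text \<open>One chart suffices: velocities transform by the Jacobian, and this preserves the
  norm.\<close>

lemma has_speedI:
  assumes c: "c \<in> A" and \<gamma>: "continuous_map (top_of_set S) T \<gamma>" and t: "t \<in> S" "\<gamma> t \<in> fst c"
    and v: "\<And>i. i < n \<Longrightarrow> ((\<lambda>s. snd c (\<gamma> s) i) has_real_derivative v i) (at t within S)"
  shows "has_speed \<gamma> S t (chart_norm c (\<gamma> t) v)"
  unfolding has_speed_def
proof (intro conjI ballI impI)
  show "\<gamma> t \<in> topspace T"
    using fst_chart_subset[OF c] t by blast
  fix c' assume c': "c' \<in> A" "\<gamma> t \<in> fst c'"
  show "\<exists>v'. (\<forall>k<n. ((\<lambda>r. snd c' (\<gamma> r) k) has_real_derivative v' k) (at t within S)) \<and>
      chart_norm c (\<gamma> t) v = chart_norm c' (\<gamma> t) v'"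
  proof (intro exI conjI allI impI)
    show "((\<lambda>r. snd c' (\<gamma> r) k) has_real_derivative (\<Sum>i<n. jacobian c c' (\<gamma> t) k i * v i)) (at t within S)"
      if "k < n" for k
      by (rule velocity_transition[OF c c'(1) \<gamma> t c'(2) that v])
    show "chart_norm c (\<gamma> t) v = chart_norm c' (\<gamma> t) (\<lambda>k. \<Sum>i<n. jacobian c c' (\<gamma> t) k i * v i)"
      by (rule chart_norm_transition[OF c c'(1) t(2) c'(2), symmetric])
  qed
qed

lemma has_speed_nonneg:
  assumes "has_speed \<gamma> S t s"
  shows "0 \<le> s"
proof -
  have "\<gamma> t \<in> topspace T"
    using assms by (simp add: has_speed_def)
  then obtain c where "c \<in> A" "\<gamma> t \<in> fst c"
    by (rule chart_covers)
  then show ?thesis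
    using assms chart_norm_nonneg unfolding has_speed_def by blast
qed

lemma riem_speed_eq:
  assumes s: "has_speed \<gamma> UNIV t s"
  shows "riem_speed M \<gamma> t = s"
proof -
  define c where "c = (SOME c. c \<in> A \<and> \<gamma> t \<in> fst c)"
  have "\<gamma> t \<in> topspace T"
    using s by (simp add: has_speed_def)
  then have "\<exists>c. c \<in> A \<and> \<gamma> t \<in> fst c"
    using chart_covers by metis
  then have c: "c \<in> A" "\<gamma> t \<in> fst c"
    unfolding c_def by (metis (mono_tags, lifting) someI_ex)+
  then obtain v where v: "\<forall>k<n. ((\<lambda>r. snd c (\<gamma> r) k) has_real_derivative v k) (at t)" "s = chart_norm c (\<gamma> t) v"
    using s unfolding has_speed_def by blast
  have "riem_speed M \<gamma> t = chart_norm c (\<gamma> t) (\<lambda>k. deriv (\<lambda>s. snd c (\<gamma> s) k) t)"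
    by (simp add: riem_speed_def Let_def chart_norm_def c_def)
  also have "\<dots> = s"
    unfolding v(2) by (rule chart_norm_cong) (use v(1) DERIV_imp_deriv in blast)
  finally show ?thesis .
qed

lemma has_speed_interior:
  assumes "has_speed \<gamma> {a..b} t s" "a < t" "t < b"
  shows "has_speed \<gamma> UNIV t s"
  using assms by (simp add: has_speed_def at_within_Icc_at)

lemma tensor_continuous:
  assumes "c \<in> A" "i < n" "j < n"
  shows "continuous_on (chart_image c) (\<lambda>x. rm_tensor M c (chart_inv c x) i j)"
proof -
  have "smooth_on_open n (chart_image c) (\<lambda>x. rm_tensor M c (chart_inv c x) i j)"
    using closed assms unfolding closed_riemannian_manifold_def riemannian_metric_def by blast
  then show ?thesis
    by (rule smooth_on_open_C1(2))
qed

text \<open>The chart \<open>C t\<close> may jump with \<open>t\<close>, but near a given time the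
  fixed chart \<open>c\<close> yields the same values of \<open>h\<close>: speed is independent of
  the chart, and derivatives within a nondegenerate interval are unique. In \<open>c\<close>, tensor
  and velocity components are continuous along the curve.\<close>

lemma C1_speed:
  assumes C1: "C1_curve_on M a b \<gamma>" and "a < b"
  obtains h where "continuous_on {a..b} h" "\<And>t. t \<in> {a..b} \<Longrightarrow> has_speed \<gamma> {a..b} t (h t)"
proof -
  have \<gamma>: "continuous_map (top_of_set {a..b}) T \<gamma>"
    using C1 by (simp add: C1_curve_on_def)
  have mem: "\<gamma> t \<in> topspace T" if "t \<in> {a..b}" for t
    using \<gamma> that by (auto simp: continuous_map_def)
  define P where "P c k v \<longleftrightarrow> continuous_on {t\<in>{a..b}. \<gamma> t \<in> fst c} v \<and>
      (\<forall>t\<in>{a..b}. \<gamma> t \<in> fst c \<longrightarrow> ((\<lambda>s. snd c (\<gamma> s) k) has_real_derivative v t) (at t within {a..b}))"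
    for c :: "'a chart" and k and v :: "real \<Rightarrow> real"
  define v where "v c k = (SOME v. P c k v)" for c k
  have P: "P c k (v c k)" if "c \<in> A" "k < n" for c k
  proof -
    have "\<exists>v. P c k v"
      using C1 that unfolding C1_curve_on_def P_def by blast
    then show ?thesis
      unfolding v_def by (rule someI_ex)
  qed
  have v: "\<And>c k. c \<in> A \<Longrightarrow> k < n \<Longrightarrow> continuous_on {t\<in>{a..b}. \<gamma> t \<in> fst c} (v c k)"
    "\<And>c k t. c \<in> A \<Longrightarrow> k < n \<Longrightarrow> t \<in> {a..b} \<Longrightarrow> \<gamma> t \<in> fst c \<Longrightarrow>
       ((\<lambda>s. snd c (\<gamma> s) k) has_real_derivative v c k t) (at t within {a..b})"
    using P unfolding P_def by blast+
  define C where "C t = (SOME c. c \<in> A \<and> \<gamma> t \<in> fst c)" for t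
  have C: "C t \<in> A \<and> \<gamma> t \<in> fst (C t)" if "t \<in> {a..b}" for t
    unfolding C_def by (rule someI_ex) (metis chart_covers[OF mem[OF that]])
  define h where "h t = chart_norm (C t) (\<gamma> t) (\<lambda>k. v (C t) k t)" for t
  have speed: "has_speed \<gamma> {a..b} t (h t)" if "t \<in> {a..b}" for t
    unfolding h_def using C[OF that] that v(2) by (intro has_speedI \<gamma>) auto
  have h: "h t = chart_norm c (\<gamma> t) (\<lambda>k. v c k t)" if tc: "t \<in> {a..b}" "c \<in> A" "\<gamma> t \<in> fst c" for t c
  proof -
    obtain w where w: "\<forall>k<n. ((\<lambda>r. snd c (\<gamma> r) k) has_real_derivative w k) (at t within {a..b})"
      "h t = chart_norm c (\<gamma> t) w"
      using speed[OF tc(1)] tc unfolding has_speed_def by blast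
    have "w k = v c k t" if "k < n" for k
      using w(1) v(2)[OF tc(2) that tc(1,3)] that \<open>a < b\<close> tc(1)
      by (intro vector_derivative_unique_within_closed_interval[of a b t "\<lambda>r. snd c (\<gamma> r) k"])
         (auto simp: has_real_derivative_iff_has_vector_derivative)
    then show ?thesis
      unfolding w(2) by (rule chart_norm_cong)
  qed
  have "continuous_on {a..b} h"
    unfolding continuous_on_eq_continuous_within
  proof
    fix t assume t: "t \<in> {a..b}"
    define c where "c = C t"
    have c: "c \<in> A" "\<gamma> t \<in> fst c"
      using C[OF t] by (simp_all add: c_def)
    obtain U where U: "open U" "{s \<in> {a..b}. \<gamma> s \<in> fst c} = {a..b} \<inter> U"
      using openin_preimage_curve[OF \<gamma> chart_open(1)[OF c(1)]] by blast
    let ?N = "{a..b} \<inter> U"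
    have tN: "t \<in> ?N"
      using U(2) t c by blast
    have memN: "s \<in> {a..b}" "\<gamma> s \<in> fst c" if "s \<in> ?N" for s
      using U(2) that by blast+
    have "continuous_map (top_of_set ?N) (subtopology T (fst c)) \<gamma>"
      using continuous_map_from_subtopology[OF \<gamma>, of U] memN
      by (auto simp: continuous_map_in_subtopology subtopology_subtopology)
    from continuous_map_compose[OF this chart_continuous[OF c(1)]]
    have xN: "continuous_on ?N (\<lambda>s. snd c (\<gamma> s))" "(\<lambda>s. snd c (\<gamma> s)) ` ?N \<subseteq> chart_image c"
      by (auto simp: comp_def)
    have "continuous_on ?N (\<lambda>s. rm_tensor M c (\<gamma> s) i j)" if "i < n" "j < n" for i j
    proof (rule continuous_on_eq)
      show "continuous_on ?N (\<lambda>s. rm_tensor M c (chart_inv c (snd c (\<gamma> s))) i j)"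
        using continuous_on_compose2[OF tensor_continuous[OF c(1) that] xN] .
    qed (use memN chart_inv_left[OF c(1)] in auto)
    moreover have "continuous_on ?N (v c k)" if "k < n" for k
      using v(1)[OF c(1) that] unfolding U(2) .
    ultimately have "continuous_on ?N (\<lambda>s. chart_norm c (\<gamma> s) (\<lambda>k. v c k s))"
      unfolding chart_norm_def by (auto intro!: continuous_intros)
    then have "continuous_on ?N h"
      by (rule continuous_on_eq) (use h[OF _ c(1)] memN in auto)
    then have "continuous (at t within ?N) h"
      using tN by (simp add: continuous_on_eq_continuous_within)
    moreover have "at t within {a..b} = at t within ?N"
      using U(1) tN by (intro at_within_nhd[of t U]) auto
    ultimately show "continuous (at t within {a..b}) h"
      by simp
  qed
  then show ?thesis
    using that speed by blast
qed

text \<open>On the compact unit sphere of the sum norm the quadratic form at \<open>p\<close> has a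
  positive minimum \<open>m\<close>. In a cube where the tensor components vary by less than
  \<open>m / 2\<close>, the form keeps at least half of this bound.\<close>

lemma local_norm_bounds:
  assumes c: "c \<in> A" and p: "p \<in> fst c"
  obtains \<rho> K where "0 < \<rho>" "0 < K" "cbox_coord n (snd c p) \<rho> \<subseteq> chart_image c"
    "\<And>q v. q \<in> fst c \<Longrightarrow> snd c q \<in> cbox_coord n (snd c p) \<rho> \<Longrightarrow> (\<Sum>k<n. \<bar>v k\<bar>) \<le> K * chart_norm c q v"
    "\<And>q v. q \<in> fst c \<Longrightarrow> snd c q \<in> cbox_coord n (snd c p) \<rho> \<Longrightarrow> chart_norm c q v \<le> K * (\<Sum>k<n. \<bar>v k\<bar>)"
proof -
  define Q where "Q q v = (\<Sum>i<n. \<Sum>j<n. rm_tensor M c q i j * v i * v j)" for q and v :: "nat \<Rightarrow> real"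
  let ?N = "\<lambda>v :: nat \<Rightarrow> real. \<Sum>k<n. \<bar>v k\<bar>"
  let ?S = "{v \<in> coord_space n. ?N v = 1}"
  have "compact ?S"
  proof -
    have "?S = cbox_coord n (\<lambda>_. 0) 1 \<inter> {v. ?N v = 1}"
    proof -
      have "\<bar>v k\<bar> \<le> 1" if "?N v = 1" "k < n" for v k
        using that member_le_sum[of k "{..<n}" "\<lambda>k. \<bar>v k\<bar>"] by simp
      then show ?thesis
        by (auto simp: cbox_coord_def)
    qed
    moreover have "closed {v. ?N v = 1}"
      by (intro closed_Collect_eq continuous_intros continuous_on_product_coordinates)
    ultimately show ?thesis
      using compact_cbox_coord compact_Int_closed by metis
  qed
  moreover have "?S \<noteq> {}"
  proof -
    have "(\<Sum>k<n. \<bar>if k = 0 then 1 else 0 :: real\<bar>) = (\<Sum>k<n. if k = 0 then 1 else 0)"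
      by (intro sum.cong) auto
    also have "\<dots> = 1"
      using dim_pos by (simp add: sum.delta')
    finally have "(\<lambda>k. if k = 0 then 1 else 0) \<in> ?S"
      using dim_pos by (auto simp: coord_space_def)
    then show ?thesis by blast
  qed
  moreover have "continuous_on ?S (Q p)"
    unfolding Q_def
    by (intro continuous_intros continuous_on_subset[OF continuous_on_product_coordinates]) auto
  ultimately obtain w where w: "w \<in> ?S" "\<And>v. v \<in> ?S \<Longrightarrow> Q p w \<le> Q p v"
    using continuous_attains_inf[of ?S "Q p"] by blast
  define m where "m = Q p w"
  have "0 < m"
    unfolding m_def Q_def
  proof (rule tensor_pos[OF c p])
    show "\<exists>i<n. w i \<noteq> 0"
    proof (rule ccontr)
      assume "\<not> ?thesis"
      then have "?N w = 0" by simp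
      with w(1) show False by simp
    qed
  qed
  \<comment> \<open>Bounds the form on the unit sphere throughout the cube: the sum covers the form
    at \<open>p\<close>, and \<open>m\<close> exceeds the variation \<open>m / 2\<close>.\<close>
  define G where "G = (\<Sum>i<n. \<Sum>j<n. \<bar>rm_tensor M c p i j\<bar>) + m"
  have "0 < G"
    unfolding G_def using \<open>0 < m\<close> by (intro add_nonneg_pos sum_nonneg) auto
  have pimg: "snd c p \<in> chart_image c"
    using p by blast
  obtain \<rho> where \<rho>: "0 < \<rho>" "cbox_coord n (snd c p) \<rho> \<subseteq> chart_image c"
    "\<And>ij y. ij \<in> {..<n} \<times> {..<n} \<Longrightarrow> y \<in> cbox_coord n (snd c p) \<rho> \<Longrightarrow>
       \<bar>rm_tensor M c (chart_inv c y) (fst ij) (snd ij) - rm_tensor M c (chart_inv c (snd c p)) (fst ij) (snd ij)\<bar> < m / 2"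
    by (rule finite_family_cbox_coord[OF chart_open(2)[OF c], of "{..<n} \<times> {..<n}"
          "\<lambda>ij y. rm_tensor M c (chart_inv c y) (fst ij) (snd ij)" "snd c p" "m / 2"])
       (use tensor_continuous[OF c] pimg \<open>0 < m\<close> in auto)
  have near: "\<bar>rm_tensor M c q i j - rm_tensor M c p i j\<bar> \<le> m / 2"
    if "q \<in> fst c" "snd c q \<in> cbox_coord n (snd c p) \<rho>" "i < n" "j < n" for q i j
    using \<rho>(3)[of "(i, j)" "snd c q"] that chart_inv_left[OF c] p by simp
  have quad: "(\<Sum>i<n. \<Sum>j<n. b * \<bar>v i\<bar> * \<bar>v j\<bar>) = b * (?N v)\<^sup>2" for b v
    by (simp add: mult_sum_sum[symmetric] power2_eq_square)
  have Qnear: "\<bar>Q q v - Q p v\<bar> \<le> m / 2 * (?N v)\<^sup>2"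
    if q: "q \<in> fst c" "snd c q \<in> cbox_coord n (snd c p) \<rho>" for q v
  proof -
    have "\<bar>Q q v - Q p v\<bar> = \<bar>\<Sum>i<n. \<Sum>j<n. (rm_tensor M c q i j - rm_tensor M c p i j) * v i * v j\<bar>"
      by (simp add: Q_def sum_subtractf algebra_simps)
    also have "\<dots> \<le> (\<Sum>i<n. \<Sum>j<n. \<bar>(rm_tensor M c q i j - rm_tensor M c p i j) * v i * v j\<bar>)"
      by (rule order_trans[OF sum_abs]) (rule sum_mono[OF sum_abs])
    also have "\<dots> \<le> (\<Sum>i<n. \<Sum>j<n. m / 2 * \<bar>v i\<bar> * \<bar>v j\<bar>)"
      unfolding abs_mult by (intro sum_mono mult_right_mono near q) auto
    finally show ?thesis
      unfolding quad .
  qed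
  have Qp: "m * (?N v)\<^sup>2 \<le> Q p v" for v
  proof (cases "?N v = 0")
    case True
    then have "v i = 0" if "i < n" for i
      using that sum_nonneg_eq_0_iff[of "{..<n}" "\<lambda>k. \<bar>v k\<bar>"] by auto
    then have "Q p v = 0"
      by (simp add: Q_def)
    then show ?thesis
      using True by simp
  next
    case False
    moreover have "0 \<le> ?N v"
      by (simp add: sum_nonneg)
    ultimately have pos: "0 < ?N v"
      by (simp only: less_le) simp
    \<comment> \<open>Normalised to lie on the unit sphere, with zeros from index \<open>n\<close>
      on.\<close>
    define u where "u i = (if i < n then v i / ?N v else 0)" for i
    have "?N u = ?N v / ?N v"
      unfolding sum_divide_distrib by (rule sum.cong) (use pos in \<open>auto simp: u_def\<close>)
    then have "u \<in> ?S"
      using pos by (auto simp: coord_space_def u_def)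
    from w(2)[OF this] have "m \<le> Q p u"
      by (simp add: m_def)
    also have "Q p u = Q p v / (?N v)\<^sup>2"
      unfolding Q_def sum_divide_distrib by (intro sum.cong) (auto simp: u_def power2_eq_square)
    finally show ?thesis
      using pos by (simp add: field_simps)
  qed
  \<comment> \<open>With \<open>N\<close> the sum norm, \<open>m / 2 * N\<^sup>2\<close> and
    \<open>G * N\<^sup>2\<close> enclose the form; square roots give the two constants.\<close>
  define K where "K = max (sqrt (2 / m)) (sqrt G + 1)"
  show ?thesis
  proof (rule that[OF \<rho>(1) _ \<rho>(2)])
    show "0 < K"
      using \<open>0 < G\<close> unfolding K_def by (simp add: less_max_iff_disj add_pos_pos)
    fix q v assume q: "q \<in> fst c" "snd c q \<in> cbox_coord n (snd c p) \<rho>"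
    have N0: "0 \<le> ?N v"
      by (simp add: sum_nonneg)
    have "m / 2 * (?N v)\<^sup>2 \<le> Q q v"
      using Qnear[OF q, of v] Qp[of v] by linarith
    then have "(?N v)\<^sup>2 \<le> 2 / m * Q q v"
      using \<open>0 < m\<close> by (simp add: field_simps)
    then have "sqrt ((?N v)\<^sup>2) \<le> sqrt (2 / m * Q q v)"
      by (rule real_sqrt_le_mono)
    then have "?N v \<le> sqrt (2 / m) * chart_norm c q v"
      using N0 unfolding real_sqrt_mult chart_norm_def Q_def by simp
    also have "\<dots> \<le> K * chart_norm c q v"
      by (intro mult_right_mono chart_norm_nonneg c q) (simp add: K_def)
    finally show "?N v \<le> K * chart_norm c q v" .
    have "Q p v \<le> (\<Sum>i<n. \<Sum>j<n. \<bar>rm_tensor M c p i j\<bar> * (\<bar>v i\<bar> * \<bar>v j\<bar>))"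
      unfolding Q_def by (intro sum_mono) (simp add: abs_mult[symmetric] mult.assoc)
    also have "\<dots> \<le> (\<Sum>i<n. \<Sum>j<n. \<bar>rm_tensor M c p i j\<bar> * (?N v * ?N v))"
      by (intro sum_mono mult_left_mono mult_mono member_le_sum) (auto simp: sum_nonneg)
    also have "\<dots> = (\<Sum>i<n. \<Sum>j<n. \<bar>rm_tensor M c p i j\<bar>) * (?N v)\<^sup>2"
      by (simp add: sum_distrib_right power2_eq_square)
    finally have "Q q v \<le> (\<Sum>i<n. \<Sum>j<n. \<bar>rm_tensor M c p i j\<bar>) * (?N v)\<^sup>2 + m / 2 * (?N v)\<^sup>2"
      using Qnear[OF q, of v] by linarith
    also have "\<dots> \<le> G * (?N v)\<^sup>2"
      using \<open>0 < m\<close> by (simp add: G_def distrib_right mult_right_mono)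
    finally have "chart_norm c q v \<le> sqrt (G * (?N v)\<^sup>2)"
      unfolding chart_norm_def Q_def by (rule real_sqrt_le_mono)
    also have "\<dots> = sqrt G * ?N v"
      using N0 by (simp add: real_sqrt_mult)
    also have "\<dots> \<le> K * ?N v"
      using N0 by (intro mult_right_mono) (simp_all add: K_def)
    finally show "chart_norm c q v \<le> K * ?N v" .
  qed
qed

section \<open>Piecewise continuously differentiable curves\<close>

text \<open>At \<open>a\<close> and \<open>b\<close> the two-sided derivative in
  \<open>riem_speed\<close> may be meaningless; elsewhere it agrees with the continuous function of
  \<open>C1_speed\<close>.\<close>

lemma C1_speed_integrable:
  assumes "C1_curve_on M a b \<gamma>" "a < b"
  shows "riem_speed M \<gamma> integrable_on {a..b}" "\<And>t. a < t \<Longrightarrow> t < b \<Longrightarrow> \<exists>s. has_speed \<gamma> UNIV t s"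
proof -
  obtain h where h: "continuous_on {a..b} h" "\<And>t. t \<in> {a..b} \<Longrightarrow> has_speed \<gamma> {a..b} t (h t)"
    using C1_speed[OF assms] by blast
  have eq: "has_speed \<gamma> UNIV t (h t)" if "a < t" "t < b" for t
    using h(2)[of t] that by (intro has_speed_interior) auto
  then show "\<And>t. a < t \<Longrightarrow> t < b \<Longrightarrow> \<exists>s. has_speed \<gamma> UNIV t s"
    by blast
  show "riem_speed M \<gamma> integrable_on {a..b}"
  proof (rule integrable_spike_finite[of "{a, b}"])
    show "h integrable_on {a..b}"
      by (rule integrable_continuous_interval[OF h(1)])
    show "riem_speed M \<gamma> t = h t" if "t \<in> {a..b} - {a, b}" for t
      by (rule riem_speed_eq[OF eq]) (use that in auto)
  qed simp
qed

text \<open>The function \<open>g\<close> is the speed with its meaningless values at the corners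
  replaced by \<open>0\<close>: same integral, but nonnegative everywhere, so lengths can be
  estimated by monotonicity of the integral.\<close>

lemma piecewise_speedE:
  assumes \<gamma>: "piecewise_C1_curve M \<gamma>"
  obtains F g where "finite F" "(g has_integral riem_length M \<gamma>) {0..1}" "\<And>t. 0 \<le> g t"
    "\<And>t. t \<in> F \<Longrightarrow> g t = 0" "\<And>t. t \<in> {0..1} - F \<Longrightarrow> 0 < t \<and> t < 1 \<and> has_speed \<gamma> UNIV t (g t)"
proof -
  obtain m and t :: "nat \<Rightarrow> real" where t: "t 0 = 0" "t m = 1"
    "\<And>i. i < m \<Longrightarrow> t i < t (Suc i)" "\<And>i. i < m \<Longrightarrow> C1_curve_on M (t i) (t (Suc i)) \<gamma>"
    using \<gamma> unfolding piecewise_C1_curve_def by blast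
  \<comment> \<open>Induction along the breakpoints: the integral over one more piece is
    appended.\<close>
  have *: "t 0 \<le> t i \<and> riem_speed M \<gamma> integrable_on {t 0..t i} \<and> (\<forall>x\<in>{t 0..t i} - t ` {..i}. \<exists>s. has_speed \<gamma> UNIV x s)"
    if "i \<le> m" for i
    using that
  proof (induction i)
    case (Suc i)
    then have IH: "t 0 \<le> t i" "riem_speed M \<gamma> integrable_on {t 0..t i}"
      "\<And>x. x \<in> {t 0..t i} - t ` {..i} \<Longrightarrow> \<exists>s. has_speed \<gamma> UNIV x s" and i: "i < m"
      by auto
    note C1 = C1_speed_integrable[OF t(4)[OF i] t(3)[OF i]]
    have "\<exists>s. has_speed \<gamma> UNIV x s" if x: "x \<in> {t 0..t (Suc i)} - t ` {..Suc i}" for x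
    proof (cases "x \<le> t i")
      case True
      then show ?thesis using IH(3)[of x] x by (auto simp: atMost_Suc)
    next
      case False
      moreover have "x \<noteq> t (Suc i)"
        using x by auto
      ultimately show ?thesis using C1(2)[of x] x by auto
    qed
    moreover have "riem_speed M \<gamma> integrable_on {t 0..t (Suc i)}"
      using Henstock_Kurzweil_Integration.integrable_combine[OF IH(1) less_imp_le[OF t(3)[OF i]] IH(2) C1(1)] .
    ultimately show ?case
      using IH(1) t(3)[OF i] by auto
  qed (use integrable_on_refl[of "riem_speed M \<gamma>" "t 0"] in simp)
  \<comment> \<open>\<open>F\<close> contains \<open>0\<close> and \<open>1\<close>, so every other
    time is interior and has a two-sided speed.\<close>
  define F where "F = t ` {..m}"
  have F: "finite F" "0 \<in> F" "1 \<in> F"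
    using t(1,2) unfolding F_def by (auto intro: image_eqI[of _ _ m] image_eqI[of _ _ 0])
  have int: "riem_speed M \<gamma> integrable_on {0..1}"
    and sp: "\<And>x. x \<in> {0..1} - F \<Longrightarrow> \<exists>s. has_speed \<gamma> UNIV x s"
    using *[of m] t(1,2) by (auto simp: F_def)
  define g where "g x = (if x \<in> {0..1} - F then riem_speed M \<gamma> x else 0)" for x
  have g: "has_speed \<gamma> UNIV x (g x)" if x: "x \<in> {0..1} - F" for x
  proof -
    obtain s where "has_speed \<gamma> UNIV x s"
      using sp[OF x] by blast
    then show ?thesis
      using x riem_speed_eq[of \<gamma> x s] unfolding g_def by simp
  qed
  show ?thesis
  proof (rule that[OF F(1)])
    have "(riem_speed M \<gamma> has_integral riem_length M \<gamma>) {0..1}"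
      using int unfolding riem_length_def by (rule integrable_integral)
    then show "(g has_integral riem_length M \<gamma>) {0..1}"
      by (rule has_integral_spike_finite[OF F(1), rotated]) (simp add: g_def)
    show "0 \<le> g x" for x
      using g[of x] has_speed_nonneg by (cases "x \<in> {0..1} - F") (auto simp: g_def)
    show "g x = 0" if "x \<in> F" for x
      using that by (simp add: g_def)
    show "0 < x \<and> x < 1 \<and> has_speed \<gamma> UNIV x (g x)" if x: "x \<in> {0..1} - F" for x
    proof -
      have "x \<noteq> 0" "x \<noteq> 1" using x F by auto
      then show ?thesis using x g[OF x] by auto
    qed
  qed
qed

text \<open>Used with slope \<open>- 1\<close> to reverse a curve and with slope \<open>2\<close> to
  run through it on half of the unit interval.\<close>

lemma C1_curve_on_affine:
  assumes C1: "C1_curve_on M a b \<gamma>"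
    and \<sigma>: "\<And>t. t \<in> {a'..b'} \<Longrightarrow> \<alpha> + \<beta> * t \<in> {a..b} \<and> \<sigma> t = \<gamma> (\<alpha> + \<beta> * t)"
  shows "C1_curve_on M a' b' \<sigma>"
  unfolding C1_curve_on_def
proof (intro conjI ballI allI impI)
  let ?f = "\<lambda>t. \<alpha> + \<beta> * t"
  have f: "continuous_on {a'..b'} ?f" "?f ` {a'..b'} \<subseteq> {a..b}"
    using \<sigma> by (auto intro!: continuous_intros)
  have "continuous_map (top_of_set {a'..b'}) (top_of_set {a..b}) ?f"
    using f by (auto simp: continuous_map_in_subtopology)
  moreover have "continuous_map (top_of_set {a..b}) T \<gamma>"
    using C1 by (simp add: C1_curve_on_def)
  ultimately have "continuous_map (top_of_set {a'..b'}) T (\<gamma> \<circ> ?f)"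
    by (rule continuous_map_compose)
  then show "continuous_map (top_of_set {a'..b'}) T \<sigma>"
    by (rule continuous_map_eq) (use \<sigma> in auto)
  fix c k assume c: "c \<in> A" and k: "k < n"
  obtain v where v: "continuous_on {t \<in> {a..b}. \<gamma> t \<in> fst c} v"
    "\<And>t. t \<in> {a..b} \<Longrightarrow> \<gamma> t \<in> fst c \<Longrightarrow> ((\<lambda>s. snd c (\<gamma> s) k) has_real_derivative v t) (at t within {a..b})"
    using C1 c k unfolding C1_curve_on_def by metis
  show "\<exists>v. continuous_on {t \<in> {a'..b'}. \<sigma> t \<in> fst c} v \<and>
      (\<forall>t\<in>{a'..b'}. \<sigma> t \<in> fst c \<longrightarrow> ((\<lambda>s. snd c (\<sigma> s) k) has_real_derivative v t) (at t within {a'..b'}))"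
  proof (intro exI conjI ballI impI)
    have "continuous_on {t \<in> {a'..b'}. \<sigma> t \<in> fst c} (\<lambda>t. v (?f t))"
      by (rule continuous_on_compose2[OF v(1)]) (use \<sigma> in \<open>auto intro!: continuous_intros\<close>)
    then show "continuous_on {t \<in> {a'..b'}. \<sigma> t \<in> fst c} (\<lambda>t. v (?f t) * \<beta>)"
      by (intro continuous_intros)
    fix t assume t: "t \<in> {a'..b'}" "\<sigma> t \<in> fst c"
    have "((\<lambda>s. snd c (\<gamma> s) k) has_real_derivative v (?f t)) (at (?f t) within ?f ` {a'..b'})"
      by (rule DERIV_subset[OF v(2) f(2)]) (use t \<sigma>[OF t(1)] in auto)
    moreover have "(?f has_real_derivative \<beta>) (at t within {a'..b'})"
      by (auto intro!: derivative_eq_intros)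
    ultimately have "((\<lambda>s. snd c (\<gamma> s) k) \<circ> ?f has_real_derivative v (?f t) * \<beta>) (at t within {a'..b'})"
      by (rule DERIV_image_chain)
    then show "((\<lambda>s. snd c (\<sigma> s) k) has_real_derivative v (?f t) * \<beta>) (at t within {a'..b'})"
      by (rule has_field_derivative_transform_within[OF _ zero_less_one t(1)]) (use \<sigma> in auto)
  qed
qed

text \<open>Agreement is required only near \<open>t\<close>, because a concatenation is a
  reparametrisation of either part on one half of the interval only.\<close>

lemma has_speed_affine:
  assumes s: "has_speed \<gamma> UNIV (\<alpha> + \<beta> * t) s"
    and \<sigma>: "eventually (\<lambda>r. \<sigma> r = \<gamma> (\<alpha> + \<beta> * r)) (nhds t)"
  shows "has_speed \<sigma> UNIV t (\<bar>\<beta>\<bar> * s)"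
  unfolding has_speed_def
proof (intro conjI ballI impI)
  let ?f = "\<lambda>r. \<alpha> + \<beta> * r"
  have \<sigma>t: "\<sigma> t = \<gamma> (?f t)"
    using \<sigma> by (rule eventually_nhds_x_imp_x)
  then show "\<sigma> t \<in> topspace T"
    using s by (simp add: has_speed_def)
  fix c assume c: "c \<in> A" "\<sigma> t \<in> fst c"
  then obtain v where v: "\<forall>k<n. ((\<lambda>r. snd c (\<gamma> r) k) has_real_derivative v k) (at (?f t))"
    "s = chart_norm c (\<gamma> (?f t)) v"
    using s \<sigma>t unfolding has_speed_def by metis
  show "\<exists>w. (\<forall>k<n. ((\<lambda>r. snd c (\<sigma> r) k) has_real_derivative w k) (at t)) \<and> \<bar>\<beta>\<bar> * s = chart_norm c (\<sigma> t) w"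
  proof (intro exI conjI allI impI)
    fix k assume "k < n"
    have "((\<lambda>r. snd c (\<gamma> (?f r)) k) has_real_derivative v k * \<beta>) (at t)"
    proof (rule DERIV_chain2[where f = "\<lambda>r. snd c (\<gamma> r) k" and g = ?f])
      show "((\<lambda>r. snd c (\<gamma> r) k) has_real_derivative v k) (at (?f t))"
        using v(1) \<open>k < n\<close> by blast
      show "(?f has_real_derivative \<beta>) (at t)"
        by (auto intro!: derivative_eq_intros)
    qed
    moreover have "eventually (\<lambda>r. snd c (\<sigma> r) k = snd c (\<gamma> (?f r)) k) (nhds t)"
      using \<sigma> by (rule eventually_mono) simp
    ultimately show "((\<lambda>r. snd c (\<sigma> r) k) has_real_derivative \<beta> * v k) (at t)"
      by (subst DERIV_cong_ev[OF refl _ refl]) (auto simp: mult.commute)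
  qed (simp add: chart_norm_scale v(2) \<sigma>t)
qed

text \<open>The factor \<open>\<bar>\<beta>\<bar>\<close> of the speed cancels against the
  substitution. \<open>dom\<close> describes the preimage of \<open>{0..1}\<close> in the form
  produced by \<open>has_integral_affinity\<close>.\<close>

lemma riem_speed_affine_integral:
  assumes \<gamma>: "piecewise_C1_curve M \<gamma>" and "\<beta> \<noteq> 0"
    and dom: "{a..b} = (\<lambda>x. (1 / \<beta>) * x + - ((1 / \<beta>) * \<alpha>)) ` {0..1}"
    and \<sigma>: "\<And>t. a < t \<Longrightarrow> t < b \<Longrightarrow> \<sigma> t = \<gamma> (\<alpha> + \<beta> * t)"
  shows "(riem_speed M \<sigma> has_integral riem_length M \<gamma>) {a..b}"
proof -
  obtain F g where F: "finite F" and g: "(g has_integral riem_length M \<gamma>) {0..1}"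
    and sp: "\<And>t. t \<in> {0..1} - F \<Longrightarrow> 0 < t \<and> t < 1 \<and> has_speed \<gamma> UNIV t (g t)"
    using piecewise_speedE[OF \<gamma>] by metis
  have "((\<lambda>x. g (\<beta> *\<^sub>R x + \<alpha>)) has_integral (1 / \<bar>\<beta>\<bar> ^ DIM(real)) *\<^sub>R riem_length M \<gamma>)
      ((\<lambda>x. (1 / \<beta>) *\<^sub>R x + - ((1 / \<beta>) *\<^sub>R \<alpha>)) ` cbox 0 1)"
    by (rule has_integral_affinity) (use g \<open>\<beta> \<noteq> 0\<close> in auto)
  then have "((\<lambda>x. g (\<alpha> + \<beta> * x)) has_integral (1 / \<bar>\<beta>\<bar>) * riem_length M \<gamma>) {a..b}"
    unfolding dom by (simp add: add.commute)
  from has_integral_mult_right[OF this, of "\<bar>\<beta>\<bar>"]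
  have int: "((\<lambda>x. \<bar>\<beta>\<bar> * g (\<alpha> + \<beta> * x)) has_integral riem_length M \<gamma>) {a..b}"
    using \<open>\<beta> \<noteq> 0\<close> by simp
  let ?F = "{a, b} \<union> (\<lambda>x. \<alpha> + \<beta> * x) -` F"
  have "finite ((\<lambda>x. \<alpha> + \<beta> * x) -` F)"
    using F \<open>\<beta> \<noteq> 0\<close> by (intro finite_vimageI injI) auto
  then have "finite ?F" by simp
  then show ?thesis
  proof (rule has_integral_spike_finite[OF _ _ int])
    fix t assume t: "t \<in> {a..b} - ?F"
    then have ab: "a < t" "t < b" by auto
    have "t \<in> (\<lambda>x. (1 / \<beta>) * x + - ((1 / \<beta>) * \<alpha>)) ` {0..1}"
      using t unfolding dom[symmetric] by simp
    then have "\<alpha> + \<beta> * t \<in> {0..1}"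
      using \<open>\<beta> \<noteq> 0\<close> by (auto simp: field_simps)
    then have "has_speed \<gamma> UNIV (\<alpha> + \<beta> * t) (g (\<alpha> + \<beta> * t))"
      using sp t by auto
    moreover have "eventually (\<lambda>r. \<sigma> r = \<gamma> (\<alpha> + \<beta> * r)) (nhds t)"
    proof -
      have "eventually (\<lambda>r. r \<in> {a<..<b}) (nhds t)"
        using ab by (intro eventually_nhds_in_open) auto
      then show ?thesis
        by (rule eventually_mono) (use \<sigma> in auto)
    qed
    ultimately show "riem_speed M \<sigma> t = \<bar>\<beta>\<bar> * g (\<alpha> + \<beta> * t)"
      by (intro riem_speed_eq has_speed_affine)
  qed
qed

section \<open>Lengths of connecting curves: reversal and concatenation\<close>

definition reaches :: "'a \<Rightarrow> 'a \<Rightarrow> real \<Rightarrow> bool" where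
  "reaches p q l \<longleftrightarrow> (\<exists>\<gamma>. piecewise_C1_curve M \<gamma> \<and> \<gamma> 0 = p \<and> \<gamma> 1 = q \<and> riem_length M \<gamma> = l)"

lemma reaches_nonneg: "reaches p q l \<Longrightarrow> 0 \<le> l"
  unfolding reaches_def by (metis piecewise_speedE has_integral_nonneg)

lemma reaches_reverse:
  assumes "reaches p q l"
  shows "reaches q p l"
proof -
  obtain \<gamma> where \<gamma>: "piecewise_C1_curve M \<gamma>" "\<gamma> 0 = p" "\<gamma> 1 = q" "riem_length M \<gamma> = l"
    using assms unfolding reaches_def by blast
  obtain m and t :: "nat \<Rightarrow> real" where t: "t 0 = 0" "t m = 1"
    "\<And>i. i < m \<Longrightarrow> t i < t (Suc i)" "\<And>i. i < m \<Longrightarrow> C1_curve_on M (t i) (t (Suc i)) \<gamma>"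
    and cont: "continuous_map (top_of_set {0..1}) T \<gamma>"
    using \<gamma>(1) unfolding piecewise_C1_curve_def by blast
  define \<sigma> where "\<sigma> s = \<gamma> (1 + (- 1) * s)" for s
  have "piecewise_C1_curve M \<sigma>"
    unfolding piecewise_C1_curve_def
  \<comment> \<open>Reflection reverses the order of the breakpoints, hence the index
    \<open>m - i\<close>.\<close>
  proof (intro conjI exI[of _ m] exI[of _ "\<lambda>i. 1 - t (m - i)"] allI impI)
    have "continuous_map (top_of_set {0..1}) (top_of_set {0..1}) (\<lambda>s :: real. 1 + (- 1) * s)"
      by (auto simp: continuous_map_in_subtopology intro!: continuous_intros)
    from continuous_map_compose[OF this cont]
    show "continuous_map (top_of_set {0..1}) T \<sigma>"
      by (simp add: \<sigma>_def[abs_def] comp_def)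
    fix i assume i: "i < m"
    then have j: "m - Suc i < m" "Suc (m - Suc i) = m - i"
      by auto
    show "1 - t (m - i) < 1 - t (m - Suc i)"
      using t(3)[OF j(1)] j(2) by simp
    show "C1_curve_on M (1 - t (m - i)) (1 - t (m - Suc i)) \<sigma>"
      by (rule C1_curve_on_affine[OF t(4)[OF j(1)], of _ _ 1 "- 1"]) (auto simp: \<sigma>_def j(2))
  qed (use t in auto)
  moreover have "riem_length M \<sigma> = l"
  proof -
    have "(riem_speed M \<sigma> has_integral riem_length M \<gamma>) {0..1}"
      by (rule riem_speed_affine_integral[OF \<gamma>(1), of "- 1" _ _ 1])
         (simp_all add: \<sigma>_def image_affinity_atLeastAtMost[of "- 1" 1, simplified])
    then show ?thesis
      using \<gamma>(4) by (simp add: riem_length_def integral_unique)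
  qed
  moreover have "\<sigma> 0 = q" "\<sigma> 1 = p"
    using \<gamma> by (simp_all add: \<sigma>_def)
  ultimately show ?thesis
    unfolding reaches_def by blast
qed

lemma reaches_concat:
  assumes "reaches p q l" "reaches q r l'"
  shows "reaches p r (l + l')"
proof -
  obtain \<gamma> where \<gamma>: "piecewise_C1_curve M \<gamma>" "\<gamma> 0 = p" "\<gamma> 1 = q" "riem_length M \<gamma> = l"
    using assms(1) unfolding reaches_def by blast
  obtain m and t :: "nat \<Rightarrow> real" where t: "t 0 = 0" "t m = 1"
    "\<And>i. i < m \<Longrightarrow> t i < t (Suc i)" "\<And>i. i < m \<Longrightarrow> C1_curve_on M (t i) (t (Suc i)) \<gamma>"
    and cont: "continuous_map (top_of_set {0..1}) T \<gamma>"
    using \<gamma>(1) unfolding piecewise_C1_curve_def by blast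
  obtain \<gamma>' where \<gamma>': "piecewise_C1_curve M \<gamma>'" "\<gamma>' 0 = q" "\<gamma>' 1 = r" "riem_length M \<gamma>' = l'"
    using assms(2) unfolding reaches_def by blast
  obtain m' and t' :: "nat \<Rightarrow> real" where t': "t' 0 = 0" "t' m' = 1"
    "\<And>i. i < m' \<Longrightarrow> t' i < t' (Suc i)" "\<And>i. i < m' \<Longrightarrow> C1_curve_on M (t' i) (t' (Suc i)) \<gamma>'"
    and cont': "continuous_map (top_of_set {0..1}) T \<gamma>'"
    using \<gamma>'(1) unfolding piecewise_C1_curve_def by blast
  have mono: "t i \<le> 1" if "i \<le> m" for i
    using that unfolding t(2)[symmetric]
    by (induction rule: inc_induct) (use t(3) in \<open>auto intro: order_trans less_imp_le\<close>)
  have mono': "0 \<le> t' i" if "i \<le> m'" for i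
    using that
  proof (induction i)
    case (Suc i)
    then show ?case using t'(3)[of i] by simp
  qed (simp add: t'(1))
  define \<sigma> where "\<sigma> s = (if s \<le> 1 / 2 then \<gamma> (0 + 2 * s) else \<gamma>' (- 1 + 2 * s))" for s
  \<comment> \<open>At \<open>s = 1 / 2\<close> both formulas give the common point
    \<open>q\<close>, so the second one holds on a closed half.\<close>
  have \<sigma>': "\<sigma> s = \<gamma>' (- 1 + 2 * s)" if "1 / 2 \<le> s" for s
  proof (cases "s = 1 / 2")
    case True
    then have "2 * s = 1" by simp
    with True show ?thesis
      using \<gamma>(3) \<gamma>'(2) unfolding \<sigma>_def by simp
  next
    case False
    then show ?thesis
      using that by (simp add: \<sigma>_def)
  qed
  \<comment> \<open>Both partitions halved; the index \<open>m\<close> stands for the end of the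
    first and the start of the second.\<close>
  define u where "u i = (if i \<le> m then t i / 2 else 1 / 2 + t' (i - m) / 2)" for i
  have "piecewise_C1_curve M \<sigma>"
    unfolding piecewise_C1_curve_def
  proof (intro conjI exI[of _ "m + m'"] exI[of _ u] allI impI)
    show "continuous_map (top_of_set {0..1}) T \<sigma>"
      unfolding \<sigma>_def[abs_def]
    proof (rule continuous_map_cases_le)
      have "continuous_map (subtopology (top_of_set {0..1}) {x \<in> topspace (top_of_set {0..1}). x \<le> 1 / 2})
          (top_of_set {0..1}) (\<lambda>s :: real. 0 + 2 * s)"
        by (auto simp: continuous_map_in_subtopology subtopology_subtopology intro!: continuous_intros)
      from continuous_map_compose[OF this cont]
      show "continuous_map (subtopology (top_of_set {0..1}) {x \<in> topspace (top_of_set {0..1}). x \<le> 1 / 2}) T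
          (\<lambda>s. \<gamma> (0 + 2 * s))"
        by (simp add: comp_def)
      have "continuous_map (subtopology (top_of_set {0..1}) {x \<in> topspace (top_of_set {0..1}). 1 / 2 \<le> x})
          (top_of_set {0..1}) (\<lambda>s :: real. - 1 + 2 * s)"
        by (auto simp: continuous_map_in_subtopology subtopology_subtopology intro!: continuous_intros)
      from continuous_map_compose[OF this cont']
      show "continuous_map (subtopology (top_of_set {0..1}) {x \<in> topspace (top_of_set {0..1}). 1 / 2 \<le> x}) T
          (\<lambda>s. \<gamma>' (- 1 + 2 * s))"
        by (simp add: comp_def)
      show "\<gamma> (0 + 2 * x) = \<gamma>' (- 1 + 2 * x)" if "x = 1 / 2" for x
      proof -
        have "2 * x = 1" using that by simp
        then show ?thesis using \<gamma>(3) \<gamma>'(2) by simp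
      qed
    qed auto
    \<comment> \<open>Ensures that \<open>u (m + m')\<close> is computed by the second
      branch.\<close>
    have "m' \<noteq> 0"
      using t'(1,2) by (intro notI) simp
    then show "u 0 = 0" "u (m + m') = 1"
      using t(1) t'(2) by (auto simp: u_def)
    fix i assume i: "i < m + m'"
    have "u i < u (Suc i) \<and> C1_curve_on M (u i) (u (Suc i)) \<sigma>"
    proof (cases "i < m")
      case True
      then have u: "u i = t i / 2" "u (Suc i) = t (Suc i) / 2"
        by (auto simp: u_def)
      have "C1_curve_on M (t i / 2) (t (Suc i) / 2) \<sigma>"
        by (rule C1_curve_on_affine[OF t(4)[OF True], of _ _ 0 2])
           (use mono[of "Suc i"] True in \<open>auto simp: \<sigma>_def\<close>)
      then show ?thesis
        using t(3)[OF True] by (simp add: u)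
    next
      case False
      define j where "j = i - m"
      have j: "j < m'" "i = m + j"
        using False i by (auto simp: j_def)
      have u: "u i = 1 / 2 + t' j / 2" "u (Suc i) = 1 / 2 + t' (Suc j) / 2"
        using t t' j by (auto simp: u_def)
      have "C1_curve_on M (1 / 2 + t' j / 2) (1 / 2 + t' (Suc j) / 2) \<sigma>"
      proof (rule C1_curve_on_affine[OF t'(4)[OF j(1)], of _ _ "- 1" 2])
        fix s assume s: "s \<in> {1 / 2 + t' j / 2..1 / 2 + t' (Suc j) / 2}"
        then have "1 / 2 \<le> s"
          using mono'[of j] j by auto
        then show "- 1 + 2 * s \<in> {t' j..t' (Suc j)} \<and> \<sigma> s = \<gamma>' (- 1 + 2 * s)"
          using s \<sigma>'[of s] by auto
      qed
      then show ?thesis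
        using t'(3)[OF j(1)] by (simp add: u)
    qed
    then show "u i < u (Suc i)" "C1_curve_on M (u i) (u (Suc i)) \<sigma>"
      by auto
  qed
  moreover have "riem_length M \<sigma> = l + l'"
  proof -
    have "(riem_speed M \<sigma> has_integral riem_length M \<gamma>) {0..1 / 2}"
      by (rule riem_speed_affine_integral[OF \<gamma>(1), of 2 _ _ 0])
         (auto simp: \<sigma>_def image_affinity_atLeastAtMost[of "1 / 2" 0, simplified])
    moreover have "(riem_speed M \<sigma> has_integral riem_length M \<gamma>') {1 / 2..1}"
      by (rule riem_speed_affine_integral[OF \<gamma>'(1), of 2 _ _ "- 1"])
         (auto simp: \<sigma>' image_affinity_atLeastAtMost[of "1 / 2" "1 / 2", simplified])
    ultimately have "(riem_speed M \<sigma> has_integral (riem_length M \<gamma> + riem_length M \<gamma>')) {0..1}"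
      by (rule has_integral_combine[rotated 2]) auto
    then show ?thesis
      using \<gamma>(4) \<gamma>'(4) by (simp add: riem_length_def integral_unique)
  qed
  moreover have "\<sigma> 0 = p" "\<sigma> 1 = r"
    using \<gamma> \<gamma>' by (simp_all add: \<sigma>_def)
  ultimately show ?thesis
    unfolding reaches_def by blast
qed

section \<open>The Riemannian distance\<close>

text \<open>The segment in coordinates from \<open>p\<close> to \<open>q\<close> has velocity
  \<open>d\<close>, and its speed is at most \<open>K\<close> times the sum norm of
  \<open>d\<close>.\<close>

lemma reaches_near:
  assumes p: "p \<in> topspace T" and "0 < e"
  obtains W where "openin T W" "p \<in> W" "\<And>q. q \<in> W \<Longrightarrow> \<exists>l<e. reaches p q l"
proof -
  obtain c where c: "c \<in> A" "p \<in> fst c"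
    using chart_covers[OF p] .
  obtain \<rho> K where \<rho>: "0 < \<rho>" "0 < K" "cbox_coord n (snd c p) \<rho> \<subseteq> chart_image c"
    and K: "\<And>q v. q \<in> fst c \<Longrightarrow> snd c q \<in> cbox_coord n (snd c p) \<rho> \<Longrightarrow> chart_norm c q v \<le> K * (\<Sum>k<n. \<bar>v k\<bar>)"
    using local_norm_bounds[OF c] by metis
  \<comment> \<open>Each of the \<open>n\<close> coordinates changes by less than \<open>r\<close>,
    so the length is at most \<open>K * (n * r)\<close>, that is at most
    \<open>e / 2\<close>.\<close>
  define r where "r = min \<rho> (e / (2 * K * n))"
  have r: "0 < r" "r \<le> \<rho>" "K * (n * r) < e"
  proof -
    show "0 < r" "r \<le> \<rho>"
      using \<rho> \<open>0 < e\<close> dim_pos by (simp_all add: r_def)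
    have "K * (n * r) \<le> K * (n * (e / (2 * K * n)))"
      using \<rho>(2) by (intro mult_left_mono) (auto simp: r_def)
    also have "\<dots> = e / 2"
      using \<rho>(2) dim_pos by simp
    finally show "K * (n * r) < e"
      using \<open>0 < e\<close> by simp
  qed
  have x0E: "snd c p \<in> coord_space n"
    using chart_image_subset[OF c(1)] c(2) by blast
  define W where "W = {q \<in> fst c. snd c q \<in> box_coord n (snd c p) r}"
  show ?thesis
  proof (rule that)
    show "openin T W"
      unfolding W_def by (rule chart_preimage_open[OF c(1) openin_box_coord])
    show "p \<in> W"
      using c x0E r(1) by (simp add: W_def box_coord_def)
    fix q assume q: "q \<in> W"
    define d where "d i = snd c q i - snd c p i" for i
    define x where "x t = (\<lambda>i. snd c p i + t * d i)" for t :: real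
    define \<gamma> where "\<gamma> t = chart_inv c (x t)" for t
    have qE: "q \<in> fst c" "snd c q \<in> coord_space n" "\<And>i. i < n \<Longrightarrow> \<bar>d i\<bar> < r"
      using q by (auto simp: W_def box_coord_def d_def)
    have x_box: "x t \<in> cbox_coord n (snd c p) \<rho>" if t: "t \<in> {0..1}" for t
      unfolding cbox_coord_def
    proof (intro CollectI conjI allI impI)
      show "x t \<in> coord_space n"
        using x0E qE(2) by (auto simp: x_def d_def coord_space_def)
      fix i assume "i < n"
      have "\<bar>t * d i\<bar> \<le> 1 * \<bar>d i\<bar>"
        unfolding abs_mult using t by (intro mult_right_mono) auto
      then show "\<bar>x t i - snd c p i\<bar> \<le> \<rho>"
        using qE(3)[OF \<open>i < n\<close>] r(2) by (simp add: x_def)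
    qed
    then have x_img: "x t \<in> chart_image c" if "t \<in> {0..1}" for t
      using that \<rho>(3) by blast
    have \<gamma>c: "\<gamma> t \<in> fst c" "snd c (\<gamma> t) = x t" if "t \<in> {0..1}" for t
      using chart_inv_right[OF x_img[OF that]] by (auto simp: \<gamma>_def)
    have contx: "continuous_on S x" for S
      unfolding x_def by (intro continuous_on_coordinatewise_then_product continuous_intros)
    have cont: "continuous_map (top_of_set {0..1}) T \<gamma>"
    proof -
      have "continuous_map (top_of_set {0..1}) (top_of_set (chart_image c)) x"
        using contx x_img by (auto simp: continuous_map_in_subtopology)
      from continuous_map_compose[OF this chart_inv_continuous[OF c(1)]] show ?thesis
        by (simp add: \<gamma>_def[abs_def] comp_def)
    qed
    have deriv: "((\<lambda>s. snd c (\<gamma> s) i) has_real_derivative d i) (at t within {0..1})" if "t \<in> {0..1}" for i t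
    proof -
      have "((\<lambda>s. x s i) has_real_derivative d i) (at t within {0..1})"
        unfolding x_def by (auto intro!: derivative_eq_intros)
      then show ?thesis
        by (rule has_field_derivative_transform_within[OF _ zero_less_one that]) (simp add: \<gamma>c(2))
    qed
    have C1: "C1_curve_on M 0 1 \<gamma>"
      unfolding C1_curve_on_def
    proof (intro conjI ballI allI impI cont)
      fix c' k assume c': "c' \<in> A" and k: "k < n"
      let ?V = "snd c ` (fst c \<inter> fst c')" and ?N = "{t \<in> {0..1}. \<gamma> t \<in> fst c'}"
      have "smooth_on_open n ?V (\<lambda>x. snd c' (chart_inv c x) k)"
        using smooth_atlas c(1) c' k unfolding smooth_atlas_def by blast
      note smooth = smooth_on_open_C1(4)[OF this]
      have sub: "(\<lambda>t. snd c (\<gamma> t)) ` ?N \<subseteq> ?V"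
        using \<gamma>c(1) by auto
      have contN: "continuous_on ?N (\<lambda>t. snd c (\<gamma> t))"
        using contx[of ?N] by (rule continuous_on_eq) (use \<gamma>c(2) in auto)
      show "\<exists>v. continuous_on ?N v \<and> (\<forall>t\<in>{0..1}. \<gamma> t \<in> fst c' \<longrightarrow>
          ((\<lambda>s. snd c' (\<gamma> s) k) has_real_derivative v t) (at t within {0..1}))"
      proof (intro exI conjI ballI impI)
        show "continuous_on ?N (\<lambda>t. \<Sum>i<n. jacobian c c' (\<gamma> t) k i * d i)"
          by (intro continuous_intros continuous_on_compose2[OF smooth contN sub]) auto
        show "((\<lambda>s. snd c' (\<gamma> s) k) has_real_derivative (\<Sum>i<n. jacobian c c' (\<gamma> t) k i * d i)) (at t within {0..1})"
          if "t \<in> {0..1}" "\<gamma> t \<in> fst c'" for t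
          by (rule velocity_transition[OF c(1) c' cont that(1) \<gamma>c(1)[OF that(1)] that(2) k deriv[OF that(1)]])
      qed
    qed
    have pw: "piecewise_C1_curve M \<gamma>"
      unfolding piecewise_C1_curve_def
      by (intro conjI cont exI[of _ 1] exI[of _ real]) (use C1 in auto)
    have ends: "\<gamma> 0 = p" "\<gamma> 1 = q"
      using chart_inv_left[OF c] chart_inv_left[OF c(1) qE(1)] by (simp_all add: \<gamma>_def x_def d_def)
    let ?B = "K * (\<Sum>k<n. \<bar>d k\<bar>)"
    have B: "?B < e"
    proof -
      have "(\<Sum>k<n. \<bar>d k\<bar>) \<le> (\<Sum>k<n. r)"
        using qE(3) by (intro sum_mono) (auto intro: less_imp_le)
      then have "?B \<le> K * (n * r)"
        using \<rho>(2) by (intro mult_left_mono) auto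
      then show ?thesis using r(3) by simp
    qed
    have B0: "0 \<le> ?B"
      using \<rho>(2) by (intro mult_nonneg_nonneg sum_nonneg) auto
    obtain F g where g: "(g has_integral riem_length M \<gamma>) {0..1}" "\<And>t. t \<in> F \<Longrightarrow> g t = 0"
      "\<And>t. t \<in> {0..1} - F \<Longrightarrow> 0 < t \<and> t < 1 \<and> has_speed \<gamma> UNIV t (g t)"
      using piecewise_speedE[OF pw] by metis
    have "riem_length M \<gamma> \<le> ?B * (1 - 0)"
    proof (rule has_integral_le[OF g(1)])
      show "((\<lambda>_. ?B) has_integral ?B * (1 - 0)) {0..1::real}"
        using has_integral_const_real[of ?B 0 1] by simp
      fix t :: real assume t: "t \<in> {0..1}"
      show "g t \<le> ?B"
      proof (cases "t \<in> F")
        case True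
        then show ?thesis using g(2) B0 by simp
      next
        case False
        have "has_speed \<gamma> UNIV t (chart_norm c (\<gamma> t) d)"
          by (rule has_speed_interior[OF has_speedI[OF c(1) cont t \<gamma>c(1)[OF t] deriv[OF t]]])
             (use g(3)[of t] False t in auto)
        then have "riem_speed M \<gamma> t = chart_norm c (\<gamma> t) d"
          by (rule riem_speed_eq)
        moreover have "riem_speed M \<gamma> t = g t"
          using g(3)[of t] False t by (intro riem_speed_eq) auto
        ultimately have "g t = chart_norm c (\<gamma> t) d"
          by simp
        also have "\<dots> \<le> ?B"
          by (rule K[OF \<gamma>c(1)[OF t]]) (simp add: \<gamma>c(2)[OF t] x_box[OF t])
        finally show ?thesis .
      qed
    qed
    then show "\<exists>l<e. reaches p q l"
      using B pw ends unfolding reaches_def by (intro exI[of _ "riem_length M \<gamma>"]) auto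
  qed
qed

text \<open>A curve from \<open>p\<close> to \<open>q\<close> must leave a small coordinate box around \<open>p\<close>, and this takes a definite
  length since the tensor dominates the Euclidean norm in the box.\<close>

lemma reaches_far:
  assumes p: "p \<in> topspace T" and "q \<noteq> p"
  obtains e where "0 < e" "\<And>l. reaches p q l \<Longrightarrow> e \<le> l"
proof -
  obtain c where c: "c \<in> A" "p \<in> fst c"
    using chart_covers[OF p] .
  obtain \<rho>0 K where \<rho>0: "0 < \<rho>0" "0 < K" "cbox_coord n (snd c p) \<rho>0 \<subseteq> chart_image c"
    and K: "\<And>q v. q \<in> fst c \<Longrightarrow> snd c q \<in> cbox_coord n (snd c p) \<rho>0 \<Longrightarrow> (\<Sum>k<n. \<bar>v k\<bar>) \<le> K * chart_norm c q v"
    using local_norm_bounds[OF c] by metis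
  have pE: "snd c p \<in> coord_space n"
    using chart_image_subset[OF c(1)] c(2) by blast
  \<comment> \<open>If \<open>q\<close> lies in the chart, it differs from \<open>p\<close> in some
    coordinate, and a box no wider than this difference excludes it.\<close>
  obtain \<rho> where \<rho>: "0 < \<rho>" "\<rho> \<le> \<rho>0" and q: "\<not> (q \<in> fst c \<and> snd c q \<in> box_coord n (snd c p) \<rho>)"
  proof (cases "q \<in> fst c")
    case True
    have "snd c q \<noteq> snd c p"
      using inj_on_chart[OF c(1)] True c(2) \<open>q \<noteq> p\<close> by (auto simp: inj_on_def)
    then obtain i where i: "snd c q i \<noteq> snd c p i"
      by blast
    have qE: "snd c q \<in> coord_space n"
      using chart_image_subset[OF c(1)] True by blast
    have "i < n"
    proof (rule ccontr)
      assume "\<not> i < n"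
      then show False
        using pE qE i by (simp add: coord_space_def)
    qed
    have "\<not> \<bar>snd c q i - snd c p i\<bar> < min \<rho>0 \<bar>snd c q i - snd c p i\<bar>"
      by simp
    then have "snd c q \<notin> box_coord n (snd c p) (min \<rho>0 \<bar>snd c q i - snd c p i\<bar>)"
      using \<open>i < n\<close> unfolding box_coord_def by blast
    then show ?thesis
      using that[of "min \<rho>0 \<bar>snd c q i - snd c p i\<bar>"] \<rho>0(1) i by simp
  next
    case False
    then show ?thesis
      using that[of \<rho>0] \<rho>0(1) by simp
  qed
  have box_sub: "box_coord n (snd c p) \<rho> \<subseteq> cbox_coord n (snd c p) \<rho>0"
    using \<rho>(2) by (fastforce simp: box_coord_def cbox_coord_def)
  have half_sub: "cbox_coord n (snd c p) (\<rho> / 2) \<subseteq> box_coord n (snd c p) \<rho>"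
    using \<rho>(1) by (fastforce simp: box_coord_def cbox_coord_def)
  define W where "W = {x \<in> fst c. snd c x \<in> box_coord n (snd c p) \<rho>}"
  \<comment> \<open>The half-size cube is compact, hence closed in the Hausdorff space, and lies
    inside the open set \<open>W\<close>: a curve that stays in \<open>C\<close> cannot leave
    \<open>W\<close> at its next moment.\<close>
  define C where "C = chart_inv c ` cbox_coord n (snd c p) (\<rho> / 2)"
  have W: "openin T W"
    unfolding W_def by (rule chart_preimage_open[OF c(1) openin_box_coord])
  have half_img: "cbox_coord n (snd c p) (\<rho> / 2) \<subseteq> chart_image c"
    using half_sub box_sub \<rho>0(3) by blast
  have CW: "C \<subseteq> W"
  proof
    fix z assume "z \<in> C"
    then obtain x where x: "x \<in> cbox_coord n (snd c p) (\<rho> / 2)" "z = chart_inv c x"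
      unfolding C_def by blast
    then have "x \<in> chart_image c" "x \<in> box_coord n (snd c p) \<rho>"
      using half_img half_sub by blast+
    then show "z \<in> W"
      using chart_inv_right[of x c] unfolding W_def x(2) by simp
  qed
  have "compactin T C"
    unfolding C_def
  proof (rule image_compactin[OF _ chart_inv_continuous[OF c(1)]])
    show "compactin (top_of_set (chart_image c)) (cbox_coord n (snd c p) (\<rho> / 2))"
      using half_img compact_cbox_coord by (simp add: compactin_subtopology)
  qed
  then have C: "closedin T C"
    using closed compactin_imp_closedin unfolding closed_riemannian_manifold_def by blast
  \<comment> \<open>While a shorter curve is in \<open>W\<close>, each of its coordinates moves by
    less than \<open>\<rho> / 2\<close>, which confines it to \<open>C\<close>.\<close>
  have "\<rho> / (2 * K) \<le> l" if l: "reaches p q l" for l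
  proof (rule ccontr)
    assume "\<not> \<rho> / (2 * K) \<le> l"
    then have small: "K * l < \<rho> / 2"
      using \<rho>0(2) by (simp add: field_simps)
    obtain \<gamma> where \<gamma>: "piecewise_C1_curve M \<gamma>" "\<gamma> 0 = p" "\<gamma> 1 = q" "riem_length M \<gamma> = l"
      using l unfolding reaches_def by blast
    have cont: "continuous_map (top_of_set {0..1}) T \<gamma>"
      using \<gamma>(1) by (simp add: piecewise_C1_curve_def)
    obtain F g where F: "finite F" and g: "(g has_integral l) {0..1}" "\<And>t. 0 \<le> g t" "\<And>t. t \<in> F \<Longrightarrow> g t = 0"
      "\<And>t. t \<in> {0..1} - F \<Longrightarrow> 0 < t \<and> t < 1 \<and> has_speed \<gamma> UNIV t (g t)"
      using piecewise_speedE[OF \<gamma>(1)] \<gamma>(4) by metis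
    have inside: "\<gamma> t \<in> C" if t: "0 \<le> t" "t \<le> 1" and stay: "\<And>s. 0 \<le> s \<Longrightarrow> s \<le> t \<Longrightarrow> \<gamma> s \<in> W" for t
    proof -
      have "\<bar>snd c (\<gamma> t) k - snd c p k\<bar> \<le> \<rho> / 2" if k: "k < n" for k
      proof -
        let ?u = "\<lambda>s. snd c (\<gamma> s) k"
        \<comment> \<open>Zero at the exceptional times, so that \<open>K * g s\<close> dominates
          \<open>f\<close> on all of \<open>{0..t}\<close>.\<close>
        define f where "f s = (if s \<in> {0..1} - F then deriv ?u s else 0)" for s
        have v: "(?u has_real_derivative f s) (at s) \<and> \<bar>f s\<bar> \<le> K * g s" if s: "s \<in> {0..t} - F" for s
        proof -
          have "s \<in> {0..1} - F" "\<gamma> s \<in> W"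
            using s t stay by auto
          then obtain v where v: "\<forall>k<n. ((\<lambda>r. snd c (\<gamma> r) k) has_real_derivative v k) (at s)" "g s = chart_norm c (\<gamma> s) v"
            using g(4)[of s] c(1) unfolding has_speed_def W_def by blast
          have "f s = v k"
            using v(1) k \<open>s \<in> {0..1} - F\<close> DERIV_imp_deriv by (auto simp: f_def)
          moreover have "\<bar>v k\<bar> \<le> (\<Sum>k<n. \<bar>v k\<bar>)"
            using k by (intro member_le_sum) auto
          moreover have "\<dots> \<le> K * chart_norm c (\<gamma> s) v"
            using \<open>\<gamma> s \<in> W\<close> box_sub by (intro K) (auto simp: W_def)
          ultimately show ?thesis
            using v k by auto
        qed
        have "(f has_integral ?u t - ?u 0) {0..t}"
        proof (rule fundamental_theorem_of_calculus_interior_strong[OF F t(1)])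
          fix s assume "s \<in> {0<..<t} - F"
          then show "(?u has_vector_derivative f s) (at s)"
            using v[of s] by (auto simp: has_real_derivative_iff_has_vector_derivative)
        next
          have "continuous_map (top_of_set {0..t}) (subtopology T (fst c)) \<gamma>"
            using continuous_map_from_subtopology_mono[OF cont, of "{0..t}"] t stay
            by (auto simp: continuous_map_in_subtopology W_def)
          from continuous_map_compose[OF this chart_continuous[OF c(1)]]
          have "continuous_on {0..t} (\<lambda>s. snd c (\<gamma> s))"
            by (simp add: comp_def continuous_map_in_subtopology)
          from continuous_on_compose2[OF continuous_on_product_coordinates this, of k]
          show "continuous_on {0..t} ?u"
            by simp
        qed
        then have f: "f integrable_on {0..t}" "integral {0..t} f = ?u t - ?u 0"
          by (auto simp: integral_unique)
        have Kg: "((\<lambda>s. K * g s) has_integral K * l) {0..1}"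
          by (rule has_integral_mult_right[OF g(1)])
        then have Kg1: "(\<lambda>s. K * g s) integrable_on {0..1}"
          by blast
        then have Kgt: "(\<lambda>s. K * g s) integrable_on {0..t}"
          by (rule integrable_on_subinterval) (use t in auto)
        have Kg0: "0 \<le> K * g s" for s
          using \<rho>0(2) g(2) by simp
        have "norm (integral {0..t} f) \<le> integral {0..t} (\<lambda>s. K * g s)"
        proof (rule Henstock_Kurzweil_Integration.integral_norm_bound_integral[OF f(1) Kgt])
          fix s assume s: "s \<in> {0..t}"
          show "norm (f s) \<le> K * g s"
            using v[of s] Kg0[of s] s by (cases "s \<in> F") (auto simp: f_def)
        qed
        also have "\<dots> \<le> integral {0..1} (\<lambda>s. K * g s)"
          by (rule integral_subset_le[OF _ Kgt Kg1]) (use t Kg0 in auto)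
        also have "\<dots> = K * l"
          using Kg by (rule integral_unique)
        finally show ?thesis
          using small \<gamma>(2) f(2) by simp
      qed
      moreover have \<gamma>t: "\<gamma> t \<in> fst c" "snd c (\<gamma> t) \<in> coord_space n"
        using stay[of t] t by (auto simp: W_def box_coord_def)
      ultimately have "snd c (\<gamma> t) \<in> cbox_coord n (snd c p) (\<rho> / 2)"
        by (simp add: cbox_coord_def)
      then show ?thesis
        using chart_inv_left[OF c(1) \<gamma>t(1)] unfolding C_def by (metis imageI)
    qed
    define Z where "Z = {t \<in> {0..1}. \<gamma> t \<in> topspace T - W}"
    have "closedin (top_of_set {0..1}) Z"
      using closedin_continuous_map_preimage[OF cont closedin_diff[OF closedin_topspace W]] by (simp add: Z_def)
    then have "closed Z"
      using closedin_closed_trans by blast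
    have \<gamma>_top: "\<gamma> t \<in> topspace T" if "t \<in> {0..1}" for t
      using cont that by (auto simp: continuous_map_def)
    have "1 \<in> Z"
      using \<gamma>(3) q \<gamma>_top[of 1] by (auto simp: Z_def W_def)
    have bdd: "bdd_below Z"
      by (auto simp: Z_def intro: bdd_belowI[of _ 0])
    \<comment> \<open>The first time outside \<open>W\<close>. Before it the curve lies in the
      closed set \<open>C\<close>, so it still does at time \<open>a\<close>, a
      contradiction.\<close>
    define a where "a = Inf Z"
    have "a \<in> Z"
      unfolding a_def using closed_contains_Inf[OF _ bdd \<open>closed Z\<close>] \<open>1 \<in> Z\<close> by blast
    then have a: "0 \<le> a" "a \<le> 1" "\<gamma> a \<notin> W"
      by (auto simp: Z_def)
    have "p \<in> W"
      using c pE \<rho>(1) by (simp add: W_def box_coord_def)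
    then have "0 < a"
      using a \<gamma>(2) by (metis less_eq_real_def)
    have before: "\<gamma> s \<in> W" if "0 \<le> s" "s < a" for s
    proof (rule ccontr)
      assume "\<gamma> s \<notin> W"
      then have "s \<in> Z"
        using that a \<gamma>_top[of s] by (auto simp: Z_def)
      then have "a \<le> s"
        unfolding a_def by (rule cInf_lower[OF _ bdd])
      with that show False by simp
    qed
    have "closedin (top_of_set {0..1}) {t \<in> {0..1}. \<gamma> t \<in> C}"
      using closedin_continuous_map_preimage[OF cont C] by simp
    then have "closed {t \<in> {0..1}. \<gamma> t \<in> C}"
      using closedin_closed_trans by blast
    moreover have "{0..<a} \<subseteq> {t \<in> {0..1}. \<gamma> t \<in> C}"
      using a before by (auto intro!: inside)
    ultimately have "closure {0..<a} \<subseteq> {t \<in> {0..1}. \<gamma> t \<in> C}"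
      by (rule closure_minimal[rotated])
    moreover have "a \<in> closure {0..<a}"
      using \<open>0 < a\<close> by simp
    ultimately show False
      using CW a(3) by blast
  qed
  then show ?thesis
    using that[of "\<rho> / (2 * K)"] \<rho>(1) \<rho>0(2) by simp
qed

text \<open>By \<open>reaches_near\<close>, with concatenation and reversal, the points that can be
  reached from \<open>p\<close> and those that cannot both form open sets; the manifold is
  connected.\<close>

lemma reaches_exists:
  assumes p: "p \<in> topspace T" and q: "q \<in> topspace T"
  shows "\<exists>l. reaches p q l"
proof (rule ccontr)
  assume no: "\<nexists>l. reaches p q l"
  define E where "E = {x \<in> topspace T. \<exists>l. reaches p x l}"
  have nbhd: "\<exists>W. openin T W \<and> x \<in> W \<and> W \<subseteq> topspace T \<and> (\<forall>y\<in>W. \<exists>l. reaches x y l)" if "x \<in> topspace T" for x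
    using reaches_near[OF that zero_less_one] openin_subset by metis
  have "openin T E"
    unfolding openin_subopen[of _ E]
  proof
    fix x assume x: "x \<in> E"
    then obtain W where W: "openin T W" "x \<in> W" "W \<subseteq> topspace T" "\<forall>y\<in>W. \<exists>l. reaches x y l"
      using nbhd unfolding E_def by blast
    then have "W \<subseteq> E"
      using x reaches_concat unfolding E_def by blast
    then show "\<exists>W. openin T W \<and> x \<in> W \<and> W \<subseteq> E"
      using W by blast
  qed
  moreover have "openin T (topspace T - E)"
    unfolding openin_subopen[of _ "topspace T - E"]
  proof
    fix x assume x: "x \<in> topspace T - E"
    then obtain W where W: "openin T W" "x \<in> W" "W \<subseteq> topspace T" "\<forall>y\<in>W. \<exists>l. reaches x y l"
      using nbhd by blast
    then have "W \<subseteq> topspace T - E"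
      using x reaches_concat reaches_reverse unfolding E_def by blast
    then show "\<exists>W. openin T W \<and> x \<in> W \<and> W \<subseteq> topspace T - E"
      using W by blast
  qed
  moreover have "p \<in> E"
    using nbhd[OF p] p unfolding E_def by blast
  moreover have "q \<in> topspace T - E"
    using no q by (simp add: E_def)
  moreover have "connected_space T"
    using closed by (simp add: closed_riemannian_manifold_def)
  ultimately show False
    unfolding connected_space_def E_def by blast
qed

section \<open>The distance as a metric with compact topology\<close>

lemma riem_dist_eq:
  "p \<in> topspace T \<Longrightarrow> q \<in> topspace T \<Longrightarrow> riem_dist M p q = Inf {l. reaches p q l}"
  by (auto simp: riem_dist_def reaches_def intro!: arg_cong[of _ _ Inf])

lemma bdd_below_reaches: "bdd_below {l. reaches p q l}"
  by (rule bdd_belowI[of _ 0]) (simp add: reaches_nonneg)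

lemma riem_dist_le:
  assumes "p \<in> topspace T" "q \<in> topspace T" "reaches p q l"
  shows "riem_dist M p q \<le> l"
  unfolding riem_dist_eq[OF assms(1,2)] by (rule cInf_lower[OF _ bdd_below_reaches]) (use assms in simp)

text \<open>\<open>reaches_exists\<close> keeps the infimum from ranging over the empty set.\<close>

lemma riem_dist_greatest:
  assumes "p \<in> topspace T" "q \<in> topspace T" "\<And>l. reaches p q l \<Longrightarrow> a \<le> l"
  shows "a \<le> riem_dist M p q"
  unfolding riem_dist_eq[OF assms(1,2)]
  by (rule cInf_greatest) (use assms reaches_exists[OF assms(1,2)] in auto)

lemma riem_dist_metric: "Metric_space (topspace T) (riem_dist M)"
proof
  show "0 \<le> riem_dist M p q" for p q
  proof (cases "p \<in> topspace T \<and> q \<in> topspace T")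
    case True
    then show ?thesis
      using reaches_nonneg by (intro riem_dist_greatest) auto
  qed (auto simp: riem_dist_def)
  show "riem_dist M p q = riem_dist M q p" for p q
  proof (cases "p \<in> topspace T \<and> q \<in> topspace T")
    case True
    have "{l. reaches p q l} = {l. reaches q p l}"
      using reaches_reverse by blast
    then show ?thesis
      using True by (simp add: riem_dist_eq)
  qed (auto simp: riem_dist_def)
  show "riem_dist M p q = 0 \<longleftrightarrow> p = q" if pq: "p \<in> topspace T" "q \<in> topspace T" for p q
  proof
    assume 0: "riem_dist M p q = 0"
    show "p = q"
    proof (rule ccontr)
      assume "p \<noteq> q"
      then obtain e where "0 < e" "\<And>l. reaches p q l \<Longrightarrow> e \<le> l"
        using reaches_far[OF pq(1), of q] by metis
      then have "e \<le> riem_dist M p q"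
        by (intro riem_dist_greatest pq) auto
      with 0 \<open>0 < e\<close> show False by simp
    qed
  next
    assume "p = q"
    have "riem_dist M p p \<le> e" if e: "0 < e" for e
    proof -
      obtain W where "p \<in> W" "\<And>q. q \<in> W \<Longrightarrow> \<exists>l<e. reaches p q l"
        using reaches_near[OF pq(1) e] by blast
      then obtain l where "l < e" "reaches p p l"
        by blast
      then show ?thesis
        using riem_dist_le[OF pq(1,1)] by force
    qed
    then have "riem_dist M p p \<le> 0"
      by (rule dense_ge)
    moreover have "0 \<le> riem_dist M p p"
      using reaches_nonneg pq by (intro riem_dist_greatest) auto
    ultimately show "riem_dist M p q = 0"
      using \<open>p = q\<close> by simp
  qed
  show "riem_dist M p r \<le> riem_dist M p q + riem_dist M q r"
    if pqr: "p \<in> topspace T" "q \<in> topspace T" "r \<in> topspace T" for p q r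
  proof -
    have "riem_dist M p r - l \<le> riem_dist M q r" if l: "reaches p q l" for l
    proof (rule riem_dist_greatest[OF pqr(2,3)])
      fix l' assume "reaches q r l'"
      from riem_dist_le[OF pqr(1,3) reaches_concat[OF l this]]
      show "riem_dist M p r - l \<le> l'" by simp
    qed
    then have "riem_dist M p r - riem_dist M q r \<le> riem_dist M p q"
      by (intro riem_dist_greatest[OF pqr(1,2)]) (simp add: algebra_simps)
    then show ?thesis by simp
  qed
qed

lemma mspace_riem: "mspace (riem_metric_space M) = topspace T"
  unfolding riem_metric_space_def by (rule Metric_space.mspace_metric[OF riem_dist_metric])

lemma mdist_riem: "mdist (riem_metric_space M) = riem_dist M"
  unfolding riem_metric_space_def by (rule Metric_space.mdist_metric[OF riem_dist_metric])

text \<open>By \<open>reaches_near\<close> the identity is continuous from the manifold topology to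
  the metric topology, and continuous images of compact sets are compact.\<close>

lemma compact_metric_riem: "compact_metric (riem_metric_space M)"
proof -
  interpret D: Metric_space "topspace T" "riem_dist M"
    by (rule riem_dist_metric)
  have "continuous_map T D.mtopology (\<lambda>x. x)"
    unfolding D.continuous_map_to_metric
  proof (intro ballI allI impI)
    fix p and e :: real assume p: "p \<in> topspace T" and "0 < e"
    obtain W where W: "openin T W" "p \<in> W" "\<And>q. q \<in> W \<Longrightarrow> \<exists>l<e. reaches p q l"
      using reaches_near[OF p \<open>0 < e\<close>] by blast
    have "q \<in> D.mball p e" if q: "q \<in> W" for q
    proof -
      have "q \<in> topspace T"
        using openin_subset[OF W(1)] q by blast
      moreover obtain l where "l < e" "reaches p q l"
        using W(3)[OF q] by blast
      ultimately show ?thesis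
        using riem_dist_le[OF p, of q l] p by simp
    qed
    then show "\<exists>W. openin T W \<and> p \<in> W \<and> (\<forall>q\<in>W. q \<in> D.mball p e)"
      using W(1,2) by blast
  qed
  moreover have "compactin T (topspace T)"
    using closed by (simp add: closed_riemannian_manifold_def compact_space_def)
  ultimately have "compactin D.mtopology ((\<lambda>x. x) ` topspace T)"
    by (rule image_compactin[rotated])
  then have "compact_space (mtopology_of (riem_metric_space M))"
    by (simp add: mtopology_of_def mspace_riem mdist_riem compact_space_def)
  moreover have "topspace T \<noteq> {}"
    using closed by (simp add: closed_riemannian_manifold_def)
  ultimately show ?thesis
    by (simp add: compact_metric_def mspace_riem)
qed

text \<open>As the dimension is positive, the coordinate with index \<open>0\<close> can be varied
  within a chart. The second point serves as a centre when the pair of small excess consists of one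
  point twice.\<close>

lemma two_points:
  obtains p q where "p \<in> topspace T" "q \<in> topspace T" "p \<noteq> q"
proof -
  have "topspace T \<noteq> {}"
    using closed unfolding closed_riemannian_manifold_def by blast
  then obtain p where p: "p \<in> topspace T"
    by blast
  obtain c where c: "c \<in> A" "p \<in> fst c"
    using chart_covers[OF p] .
  have pE: "snd c p \<in> coord_space n"
    using chart_image_subset[OF c(1)] c(2) by blast
  obtain \<rho> where \<rho>: "0 < \<rho>" "cbox_coord n (snd c p) \<rho> \<subseteq> chart_image c"
    using openin_cbox_coord[OF chart_open(2)[OF c(1)], of "snd c p"] c(2) by blast
  define x where "x = (snd c p)(0 := snd c p 0 + \<rho>)"
  have "x \<in> cbox_coord n (snd c p) \<rho>"
    using coord_space_upd[OF pE dim_pos] \<rho>(1) by (auto simp: x_def cbox_coord_def)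
  then have "x \<in> chart_image c"
    using \<rho>(2) by blast
  then obtain q where q: "q \<in> fst c" "x = snd c q"
    by blast
  have "x \<noteq> snd c p"
    using \<rho>(1) by (auto simp: x_def dest: fun_cong[of _ _ 0])
  then show ?thesis
    using that[OF p, of q] q fst_chart_subset[OF c(1)] by blast
qed

end

theorem theoremA:
  fixes \<M> :: "'a riemannian_manifold set"
  assumes "\<And>M. M \<in> \<M> \<Longrightarrow> closed_riemannian_manifold M"
    and "gh_precompact (riem_metric_space ` \<M>)"
    and "\<And>X. X \<in> gh_closure (riem_metric_space ` \<M>) \<Longrightarrow> geodesic_space X \<and> non_branching X"
  shows "(\<forall>\<epsilon>>0. \<exists>\<delta>>0. \<forall>M\<in>\<M>.
            tightly_covered \<delta> (riem_metric_space M) \<longrightarrow> excess (riem_metric_space M) < \<epsilon>) \<and>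
         (\<forall>\<epsilon>>0. \<exists>\<delta>>0. \<forall>M\<in>\<M>.
            excess (riem_metric_space M) < \<delta> \<longrightarrow> tightly_covered \<epsilon> (riem_metric_space M))"
proof (intro conjI allI impI)
  have riem: "closed_riem M" if "M \<in> \<M>" for M
    by (rule closed_riem.intro) (rule assms(1)[OF that])
  have compact: "riem_metric_space ` \<M> \<subseteq> Collect compact_metric"
    using closed_riem.compact_metric_riem[OF riem] by blast
  fix \<epsilon> :: real assume "0 < \<epsilon>"
  have "\<exists>\<delta>>0. \<forall>X\<in>riem_metric_space ` \<M>. tightly_covered \<delta> X \<longrightarrow> excess X < \<epsilon>"
    by (rule gh_precompact_tight_cover_excess[OF assms(2) compact assms(3) \<open>0 < \<epsilon>\<close>])
  then show "\<exists>\<delta>>0. \<forall>M\<in>\<M>. tightly_covered \<delta> (riem_metric_space M) \<longrightarrow> excess (riem_metric_space M) < \<epsilon>"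
    by simp
  \<comment> \<open>In this direction \<delta> = \<epsilon> works for every single manifold.\<close>
  have "tightly_covered \<epsilon> (riem_metric_space M)" if M: "M \<in> \<M>" "excess (riem_metric_space M) < \<epsilon>" for M
  proof -
    obtain p q where "p \<in> mspace (riem_metric_space M)" "q \<in> mspace (riem_metric_space M)" "p \<noteq> q"
      using closed_riem.two_points[OF riem[OF M(1)]] unfolding closed_riem.mspace_riem[OF riem[OF M(1)]] by blast
    then show ?thesis
      using excess_less_imp_tightly_covered[OF closed_riem.compact_metric_riem[OF riem[OF M(1)]] _ _ _ M(2)]
      by blast
  qed
  then show "\<exists>\<delta>>0. \<forall>M\<in>\<M>. excess (riem_metric_space M) < \<delta> \<longrightarrow> tightly_covered \<epsilon> (riem_metric_space M)"
    using \<open>0 < \<epsilon>\<close> by blast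
qed

end
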